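(* Let $K$ be a field, let $n\geq m\geq 1$ and $t\geq 1$ be integers, let $S=K[x_1,\ldots,x_n]$, and let $I_{n,m}=(x_1x_2\cdots x_m,\; x_2x_3\cdots x_{m+1},\;\ldots,\; x_{n-m+1}\cdots x_n)\subset S$. The projective dimension of the $S$-module $S/I_{n,m}^t$ is $$\operatorname{pd}(S/I_{n,m}^t)=\begin{cases} t-2+\left\lfloor \frac{n-t+2}{m+1}\right\rfloor+\left\lceil \frac{n-t+2}{m+1}\right\rceil, & t\leq n+1-m\\ n-m+1, & t>n+1-m.\end{cases}$$
   Context: The ideal $I_{n,m}$ (the $m$-path ideal of the path graph of length $n$) is generated by all products of $m$ consecutive variables among $x_1,\ldots,x_n$, and $I_{n,m}^t$ is its ordinary $t$-th power. *)

theory Defs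
  imports Complex_Main "HOL-Library.Poly_Mapping" "HOL-Library.Extended_Nat" "HOL-Algebra.Algebra"
begin

section \<open>Modules, projective resolutions, projective dimension\<close>

definition mod_hom ::
  "('a, 'r) ring_scheme \<Rightarrow> ('a, 'b, 'm) module_scheme \<Rightarrow> ('a, 'c, 'n) module_scheme \<Rightarrow> ('b \<Rightarrow> 'c) set"
  where "mod_hom R M N =
    {f \<in> hom (add_monoid M) (add_monoid N).
       \<forall>r\<in>carrier R. \<forall>x\<in>carrier M. f (r \<odot>\<^bsub>M\<^esub> x) = r \<odot>\<^bsub>N\<^esub> f x}"

text \<open>
  Projectivity is the lifting property along surjections \<open>g : M \<rightarrow> N\<close>.  A definition cannot
  quantify over the carrier types of \<open>M\<close> and \<open>N\<close>, so they are fixed: \<open>N\<close> ranges over the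
  type of \<open>P\<close> itself and \<open>M\<close> over a type containing the free module on the carrier of \<open>P\<close>.
  This loses nothing: \<open>projective_module_lift\<close> below gives the lifting property for
  modules over arbitrary types.
\<close>

definition projective_module :: "('a, 'r) ring_scheme \<Rightarrow> ('a, 'b) module \<Rightarrow> bool"
  where "projective_module R P \<longleftrightarrow> module R P \<and>
    (\<forall>(M :: ('a, 'b \<Rightarrow> 'a) module) (N :: ('a, 'b) module) g f.
       module R M \<and> module R N \<and>
       g \<in> mod_hom R M N \<and> g ` carrier M = carrier N \<and> f \<in> mod_hom R P N \<longrightarrow>
       (\<exists>h \<in> mod_hom R P M. \<forall>x\<in>carrier P. g (h x) = f x))"

text \<open>\<open>\<dots> \<rightarrow> P 2 \<rightarrow> P 1 \<rightarrow> P 0 \<rightarrow> M \<rightarrow> 0\<close> with maps \<open>d i : P (i + 1) \<rightarrow> P i\<close> and \<open>e : P 0 \<rightarrow> M\<close>.\<close>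

definition projective_resolution ::
  "('a, 'r) ring_scheme \<Rightarrow> ('a, 'b) module \<Rightarrow> (nat \<Rightarrow> ('a, 'c) module) \<Rightarrow>
    (nat \<Rightarrow> 'c \<Rightarrow> 'c) \<Rightarrow> ('c \<Rightarrow> 'b) \<Rightarrow> bool"
  where "projective_resolution R M P d e \<longleftrightarrow>
    (\<forall>i. projective_module R (P i)) \<and>
    (\<forall>i. d i \<in> mod_hom R (P (Suc i)) (P i)) \<and>
    e \<in> mod_hom R (P 0) M \<and>
    e ` carrier (P 0) = carrier M \<and>
    a_kernel (P 0) M e = d 0 ` carrier (P 1) \<and>
    (\<forall>i. a_kernel (P (Suc i)) (P i) (d i) = d (Suc i) ` carrier (P (Suc (Suc i))))"

text \<open>
  The infimum is \<open>\<infinity>\<close> if there is no finite resolution; the zero module gets dimension \<open>0\<close>.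
  The members of the resolutions have carriers in the fixed type \<open>(nat \<Rightarrow> 'a) \<times> 'b\<close>.  Over a
  nonzero ring this type is infinite and at least as large as the ring and the module, hence so
  large that it contains a copy of every free module on a generating set of \<open>M\<close> and
  of every free module on a set of generators of each successive syzygy.  By Schanuel's lemma, if \<open>M\<close> has a
  projective resolution of length \<open>l\<close> over any type, then the \<open>l\<close>-th syzygy of such a free
  resolution is projective, and so there is one of length \<open>l\<close> over this type.
\<close>

definition projective_dimension :: "('a, 'r) ring_scheme \<Rightarrow> ('a, 'b) module \<Rightarrow> enat"
  where "projective_dimension R M =
    Inf {enat l | l. \<exists>(P :: nat \<Rightarrow> ('a, (nat \<Rightarrow> 'a) \<times> 'b) module) d e.
           projective_resolution R M P d e \<and> (\<forall>i>l. carrier (P i) = {\<zero>\<^bsub>P i\<^esub>})}"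

text \<open>The quotient ring \<open>R Quot I\<close> with its structure as an \<open>R\<close>-module.\<close>

definition quotient_module :: "('a, 'r) ring_scheme \<Rightarrow> 'a set \<Rightarrow> ('a, 'a set) module"
  where "quotient_module R I =
    ring.extend (R Quot I) (module.fields (\<lambda>r A. (I +>\<^bsub>R\<^esub> r) \<otimes>\<^bsub>R Quot I\<^esub> A))"


section \<open>Polynomial rings and path ideals\<close>

text \<open>A monomial is a finitely supported exponent function.\<close>

type_synonym 'k mpoly = "(nat \<Rightarrow>\<^sub>0 nat) \<Rightarrow>\<^sub>0 'k"

text \<open>The type \<open>'k mpoly\<close> has variables \<open>x\<^sub>i\<close> for all \<open>i :: nat\<close>; the ring \<open>K[x\<^sub>1, \<dots>, x\<^sub>n]\<close> consists of
  the polynomials in which only \<open>x\<^sub>1, \<dots>, x\<^sub>n\<close> occur.\<close>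

definition mpoly_ring :: "nat \<Rightarrow> 'k::field mpoly ring"
  where "mpoly_ring n =
    \<lparr>carrier = {p. \<forall>\<mu>\<in>Poly_Mapping.keys p. Poly_Mapping.keys \<mu> \<subseteq> {1..n}},
     monoid.mult = (*), one = 1, ring.zero = 0, add = (+)\<rparr>"

definition poly_var :: "nat \<Rightarrow> 'k::field mpoly"
  where "poly_var i = Poly_Mapping.single (Poly_Mapping.single i 1) 1"

definition path_ideal :: "nat \<Rightarrow> nat \<Rightarrow> 'k::field mpoly set"
  where "path_ideal n m =
    Idl\<^bsub>mpoly_ring n\<^esub> {\<Prod>j\<in>{i..<i + m}. poly_var j | i. 1 \<le> i \<and> i + m \<le> n + 1}"


section \<open>Well-formedness\<close>

lemma quotient_module_simps:
  "carrier (quotient_module R I) = a_rcosets\<^bsub>R\<^esub> I"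
  "add (quotient_module R I) = set_add R"
  "ring.zero (quotient_module R I) = I"
  "r \<odot>\<^bsub>quotient_module R I\<^esub> V = rcoset_mult R I (I +>\<^bsub>R\<^esub> r) V"
  by (simp_all add: quotient_module_def ring.extend_def module.fields_def FactRing_def)

lemma (in cring) quotient_module_is_module:
  assumes "ideal I R"
  shows "module R (quotient_module R I)"
proof -
  interpret I: ideal I R by fact
  interpret Q: ring "R Quot I" by (rule I.quotient_is_ring)
  have eqs: "carrier (quotient_module R I) = carrier (R Quot I)"
    "add (quotient_module R I) = add (R Quot I)" "ring.zero (quotient_module R I) = ring.zero (R Quot I)"
    by (simp_all add: quotient_module_simps FactRing_def)
  have "abelian_group (quotient_module R I)"
  proof (rule abelian_groupI)
    fix x assume x: "x \<in> carrier (quotient_module R I)"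
    show "\<exists>y\<in>carrier (quotient_module R I). y \<oplus>\<^bsub>quotient_module R I\<^esub> x = \<zero>\<^bsub>quotient_module R I\<^esub>"
      by (rule bexI[of _ "\<ominus>\<^bsub>R Quot I\<^esub> x"]) (use x Q.l_neg in \<open>auto simp: eqs\<close>)
  qed (auto simp: eqs Q.a_ac)
  then show ?thesis
    by (intro moduleI is_cring)
      (auto simp: quotient_module_simps A_RCOSETS_defs I.rcoset_mult_add a_r_coset_def[symmetric]
         I.a_rcos_sum l_distr r_distr m_assoc)
qed

lemma mpoly_ring_cring: "cring (mpoly_ring n :: 'k::field mpoly ring)"
proof -
  let ?S = "mpoly_ring n :: 'k mpoly ring"
  have mult: "p * q \<in> carrier ?S" if "p \<in> carrier ?S" "q \<in> carrier ?S" for p q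
  proof -
    have "Poly_Mapping.keys \<mu> \<subseteq> {1..n}" if mu: "\<mu> \<in> Poly_Mapping.keys (p * q)" for \<mu>
    proof -
      from keys_mult mu obtain a b where "\<mu> = a + b" "a \<in> Poly_Mapping.keys p" "b \<in> Poly_Mapping.keys q"
        by blast
      then show ?thesis
        using Poly_Mapping.keys_add[of a b] \<open>p \<in> carrier ?S\<close> \<open>q \<in> carrier ?S\<close>
        unfolding mpoly_ring_def by fastforce
    qed
    then show ?thesis by (auto simp: mpoly_ring_def)
  qed
  have add: "p + q \<in> carrier ?S" if "p \<in> carrier ?S" "q \<in> carrier ?S" for p q
    using Poly_Mapping.keys_add[of p q] that unfolding mpoly_ring_def by fastforce
  have neg: "\<exists>q\<in>carrier ?S. q + p = 0" if "p \<in> carrier ?S" for p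
    by (rule bexI[of _ "-p"]) (use that in \<open>auto simp: mpoly_ring_def\<close>)
  show ?thesis
  proof (intro cringI abelian_groupI comm_monoidI)
    fix p q r assume "p \<in> carrier ?S" "q \<in> carrier ?S" "r \<in> carrier ?S"
    show "(p \<oplus>\<^bsub>?S\<^esub> q) \<otimes>\<^bsub>?S\<^esub> r = p \<otimes>\<^bsub>?S\<^esub> r \<oplus>\<^bsub>?S\<^esub> q \<otimes>\<^bsub>?S\<^esub> r"
      by (simp add: mpoly_ring_def distrib_right)
  next
    fix p assume "p \<in> carrier ?S"
    from neg[OF this] show "\<exists>q\<in>carrier ?S. q \<oplus>\<^bsub>?S\<^esub> p = \<zero>\<^bsub>?S\<^esub>"
      by (simp add: mpoly_ring_def)
  next
    show "\<zero>\<^bsub>?S\<^esub> \<in> carrier ?S" by (simp add: mpoly_ring_def)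
    show "\<one>\<^bsub>?S\<^esub> \<in> carrier ?S" by (simp add: mpoly_ring_def)
  next
    fix p q assume "p \<in> carrier ?S" "q \<in> carrier ?S"
    then show "p \<oplus>\<^bsub>?S\<^esub> q \<in> carrier ?S" "p \<otimes>\<^bsub>?S\<^esub> q \<in> carrier ?S"
      using add[of p q] mult[of p q] by (simp_all add: mpoly_ring_def)
  qed (simp_all add: mpoly_ring_def ac_simps)
qed

lemma path_ideal_ideal: "ideal (path_ideal n m) (mpoly_ring n :: 'k::field mpoly ring)"
proof -
  interpret cring "mpoly_ring n :: 'k mpoly ring" by (rule mpoly_ring_cring)
  have prodc: "(\<Prod>j\<in>A. poly_var j) \<in> carrier (mpoly_ring n :: 'k mpoly ring)" if "finite A" "A \<subseteq> {1..n}" for A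
    using that
  proof (induction A rule: finite_induct)
    case empty
    then show ?case using one_closed by (simp add: mpoly_ring_def)
  next
    case (insert a A)
    have "poly_var a \<in> carrier (mpoly_ring n :: 'k mpoly ring)"
      using insert by (auto simp: mpoly_ring_def poly_var_def)
    then have "poly_var a \<otimes>\<^bsub>mpoly_ring n\<^esub> (\<Prod>j\<in>A. poly_var j) \<in> carrier (mpoly_ring n :: 'k mpoly ring)"
      using insert by (intro m_closed) auto
    then show ?case using insert by (simp add: mpoly_ring_def)
  qed
  show ?thesis unfolding path_ideal_def
    by (rule genideal_ideal) (auto intro!: prodc)
qed

lemma path_ideal_power_ideal:
  "ideal (path_ideal n m [^]\<^bsub>ideals_set (mpoly_ring n)\<^esub> (t::nat)) (mpoly_ring n :: 'k::field mpoly ring)"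
proof -
  interpret cring "mpoly_ring n :: 'k mpoly ring" by (rule mpoly_ring_cring)
  interpret J: semiring "ideals_set (mpoly_ring n :: 'k mpoly ring)" by (rule ideals_set_is_semiring)
  have "path_ideal n m \<in> carrier (ideals_set (mpoly_ring n :: 'k mpoly ring))"
    using path_ideal_ideal by (simp add: ideals_set_def)
  from J.nat_pow_closed[OF this, of t] show ?thesis by (simp add: ideals_set_def)
qed


section \<open>Projective modules lift along surjections over arbitrary carrier types\<close>

lemma mod_homD:
  assumes "f \<in> mod_hom R M N"
  shows "x \<in> carrier M \<Longrightarrow> f x \<in> carrier N"
    "x \<in> carrier M \<Longrightarrow> y \<in> carrier M \<Longrightarrow> f (x \<oplus>\<^bsub>M\<^esub> y) = f x \<oplus>\<^bsub>N\<^esub> f y"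
    "r \<in> carrier R \<Longrightarrow> x \<in> carrier M \<Longrightarrow> f (r \<odot>\<^bsub>M\<^esub> x) = r \<odot>\<^bsub>N\<^esub> f x"
  using assms by (auto simp: mod_hom_def hom_def)

lemma mod_homI:
  assumes "\<And>x. x \<in> carrier M \<Longrightarrow> f x \<in> carrier N"
    "\<And>x y. x \<in> carrier M \<Longrightarrow> y \<in> carrier M \<Longrightarrow> f (x \<oplus>\<^bsub>M\<^esub> y) = f x \<oplus>\<^bsub>N\<^esub> f y"
    "\<And>r x. r \<in> carrier R \<Longrightarrow> x \<in> carrier M \<Longrightarrow> f (r \<odot>\<^bsub>M\<^esub> x) = r \<odot>\<^bsub>N\<^esub> f x"
  shows "f \<in> mod_hom R M N"
  using assms by (auto simp: mod_hom_def hom_def)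

lemma mod_hom_zero:
  assumes "f \<in> mod_hom R M N" "module R M" "module R N"
  shows "f \<zero>\<^bsub>M\<^esub> = \<zero>\<^bsub>N\<^esub>"
proof -
  interpret M: module R M by fact
  interpret N: module R N by fact
  have "f (\<zero>\<^bsub>R\<^esub> \<odot>\<^bsub>M\<^esub> \<zero>\<^bsub>M\<^esub>) = \<zero>\<^bsub>R\<^esub> \<odot>\<^bsub>N\<^esub> f \<zero>\<^bsub>M\<^esub>"
    by (rule mod_homD(3)[OF assms(1)]) auto
  then show ?thesis using mod_homD(1)[OF assms(1)] by simp
qed

lemma mod_hom_finsum:
  assumes "f \<in> mod_hom R M N" "module R M" "module R N" "finite A" "g \<in> A \<rightarrow> carrier M"
  shows "f (finsum M g A) = finsum N (\<lambda>a. f (g a)) A"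
proof -
  interpret M: module R M by fact
  interpret N: module R N by fact
  from assms(4,5) show ?thesis
  proof (induction A rule: finite_induct)
    case empty
    then show ?case by (simp add: mod_hom_zero[OF assms(1-3)])
  next
    case (insert a A)
    then show ?case
      using mod_homD(1,2)[OF assms(1)]
      by (subst M.finsum_insert, auto, subst N.finsum_insert, auto simp: Pi_def)
  qed
qed

definition free_module :: "('a, 'r) ring_scheme \<Rightarrow> 'b set \<Rightarrow> ('a, 'b \<Rightarrow> 'a) module"
  where "free_module R V =
    \<lparr>carrier = {c. finite {x. c x \<noteq> \<zero>\<^bsub>R\<^esub>} \<and> (\<forall>x. c x \<in> carrier R) \<and> (\<forall>x. x \<notin> V \<longrightarrow> c x = \<zero>\<^bsub>R\<^esub>)},
     monoid.mult = undefined, one = undefined, ring.zero = (\<lambda>_. \<zero>\<^bsub>R\<^esub>),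
     add = (\<lambda>c c' x. c x \<oplus>\<^bsub>R\<^esub> c' x), smult = (\<lambda>r c x. r \<otimes>\<^bsub>R\<^esub> c x)\<rparr>"

lemma (in cring) free_module_is_module: "module R (free_module R V)"
proof -
  have fin_add: "finite {x. c x \<oplus> c' x \<noteq> \<zero>}"
    if "finite {x. c x \<noteq> \<zero>}" "finite {x. c' x \<noteq> \<zero>}" for c c'
    by (rule finite_subset[OF _ finite_UnI[OF that]]) auto
  have fin_smult: "finite {x. r \<otimes> c x \<noteq> \<zero>}" if "finite {x. c x \<noteq> \<zero>}" "r \<in> carrier R" for r c
    by (rule finite_subset[OF _ that(1)]) (use that in auto)
  have neg: "\<exists>y\<in>carrier (free_module R V). (\<lambda>x. y x \<oplus> c x) = (\<lambda>_. \<zero>)"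
    if "c \<in> carrier (free_module R V)" for c
  proof (rule bexI[of _ "\<lambda>x. \<ominus> c x"])
    show "(\<lambda>x. \<ominus> c x \<oplus> c x) = (\<lambda>_. \<zero>)" using that by (auto simp: free_module_def l_neg)
    have "finite {x. \<ominus> c x \<noteq> \<zero>}"
      by (rule finite_subset[of _ "{x. c x \<noteq> \<zero>}"]) (use that in \<open>auto simp: free_module_def\<close>)
    then show "(\<lambda>x. \<ominus> c x) \<in> carrier (free_module R V)"
      using that by (auto simp: free_module_def)
  qed
  have "abelian_group (free_module R V)"
    by (rule abelian_groupI)
      (use neg in \<open>auto simp: free_module_def a_ac fin_add\<close>)
  then show ?thesis
    by (intro moduleI is_cring) (auto simp: free_module_def l_distr r_distr m_assoc fin_smult)
qed

definition lin_comb :: "('a, 'r) ring_scheme \<Rightarrow> ('a, 'c, 'm) module_scheme \<Rightarrow> ('b \<Rightarrow> 'c) \<Rightarrow> ('b \<Rightarrow> 'a) \<Rightarrow> 'c"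
  where "lin_comb R M v c = finsum M (\<lambda>x. c x \<odot>\<^bsub>M\<^esub> v x) {x. c x \<noteq> \<zero>\<^bsub>R\<^esub>}"

lemma (in module) lin_comb_superset:
  assumes "c \<in> carrier (free_module R V)" "v \<in> V \<rightarrow> carrier M"
    "finite B" "{x. c x \<noteq> \<zero>} \<subseteq> B" "B \<subseteq> V"
  shows "lin_comb R M v c = finsum M (\<lambda>x. c x \<odot>\<^bsub>M\<^esub> v x) B"
  unfolding lin_comb_def
  by (rule M.add.finprod_mono_neutral_cong_left) (use assms in \<open>auto simp: free_module_def Pi_def\<close>)

lemma (in module) lin_comb_hom:
  assumes v: "v \<in> V \<rightarrow> carrier M"
  shows "lin_comb R M v \<in> mod_hom R (free_module R V) M"
proof (rule mod_homI)
  interpret F: module R "free_module R V" by (rule free_module_is_module)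
  fix c assume c: "c \<in> carrier (free_module R V)"
  let ?s = "\<lambda>c. {x. c x \<noteq> \<zero>}"
  have val: "c x \<odot>\<^bsub>M\<^esub> v x \<in> carrier M" if "c \<in> carrier (free_module R V)" "x \<in> V" for c x
    using v that by (auto simp: free_module_def)
  have s: "finite (?s c)" "?s c \<subseteq> V" if "c \<in> carrier (free_module R V)" for c
    using that by (auto simp: free_module_def)
  show "lin_comb R M v c \<in> carrier M"
    unfolding lin_comb_def by (rule M.finsum_closed) (use s[OF c] val[OF c] in auto)
  {
    fix r assume r: "r \<in> carrier R"
    have rc: "r \<odot>\<^bsub>free_module R V\<^esub> c \<in> carrier (free_module R V)" using F.smult_closed[OF r c] .
    have cc: "c x \<in> carrier R" for x using c by (auto simp: free_module_def)
    have "lin_comb R M v (r \<odot>\<^bsub>free_module R V\<^esub> c)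
        = finsum M (\<lambda>x. (r \<odot>\<^bsub>free_module R V\<^esub> c) x \<odot>\<^bsub>M\<^esub> v x) (?s c)"
      by (rule lin_comb_superset[OF rc v s(1)[OF c] _ s(2)[OF c]])
        (use r in \<open>auto simp: free_module_def\<close>)
    also have "\<dots> = finsum M (\<lambda>x. r \<odot>\<^bsub>M\<^esub> (c x \<odot>\<^bsub>M\<^esub> v x)) (?s c)"
      by (rule M.finsum_cong')
        (use r v s(2)[OF c] cc in \<open>auto simp: free_module_def smult_assoc1 Pi_def subset_iff\<close>)
    also have "\<dots> = r \<odot>\<^bsub>M\<^esub> lin_comb R M v c"
      unfolding lin_comb_def
      by (rule finsum_smult_ldistr[symmetric]) (use s[OF c] val[OF c] r in auto)
    finally show "lin_comb R M v (r \<odot>\<^bsub>free_module R V\<^esub> c) = r \<odot>\<^bsub>M\<^esub> lin_comb R M v c" .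
  }
  fix c' assume c': "c' \<in> carrier (free_module R V)"
  have sum: "c \<oplus>\<^bsub>free_module R V\<^esub> c' \<in> carrier (free_module R V)" using c c' by simp
  let ?B = "?s c \<union> ?s c'"
  have B: "finite ?B" "?B \<subseteq> V" using s[OF c] s[OF c'] by auto
  have "lin_comb R M v (c \<oplus>\<^bsub>free_module R V\<^esub> c')
      = finsum M (\<lambda>x. (c \<oplus>\<^bsub>free_module R V\<^esub> c') x \<odot>\<^bsub>M\<^esub> v x) ?B"
    by (rule lin_comb_superset[OF sum v B(1) _ B(2)]) (auto simp: free_module_def)
  also have "\<dots> = finsum M (\<lambda>x. c x \<odot>\<^bsub>M\<^esub> v x \<oplus>\<^bsub>M\<^esub> c' x \<odot>\<^bsub>M\<^esub> v x) ?B"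
    by (rule M.finsum_cong')
      (use v B(2) c c' in \<open>auto simp: free_module_def smult_l_distr Pi_def subset_iff\<close>)
  also have "\<dots> = finsum M (\<lambda>x. c x \<odot>\<^bsub>M\<^esub> v x) ?B \<oplus>\<^bsub>M\<^esub> finsum M (\<lambda>x. c' x \<odot>\<^bsub>M\<^esub> v x) ?B"
    by (rule M.finsum_addf) (use val[OF c] val[OF c'] B(2) in auto)
  also have "\<dots> = lin_comb R M v c \<oplus>\<^bsub>M\<^esub> lin_comb R M v c'"
    using lin_comb_superset[OF c v B(1) _ B(2)] lin_comb_superset[OF c' v B(1) _ B(2)] by auto
  finally show "lin_comb R M v (c \<oplus>\<^bsub>free_module R V\<^esub> c') = lin_comb R M v c \<oplus>\<^bsub>M\<^esub> lin_comb R M v c'" .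
qed

theorem projective_module_lift:
  fixes R :: "('a, 'r) ring_scheme" and P :: "('a, 'b) module"
    and M :: "('a, 'c) module" and N :: "('a, 'd) module"
  assumes P: "projective_module R P" and M: "module R M" and N: "module R N"
    and g: "g \<in> mod_hom R M N" "g ` carrier M = carrier N" and f: "f \<in> mod_hom R P N"
  shows "\<exists>h \<in> mod_hom R P M. \<forall>x\<in>carrier P. g (h x) = f x"
proof -
  interpret M: module R M by fact
  interpret N: module R N by fact
  interpret P: module R P using P by (simp add: projective_module_def)
  let ?F = "free_module R (carrier P)"
  have modF: "module R ?F" by (rule cring.free_module_is_module[OF module.axioms(1)[OF P.module_axioms]])
  define p where "p = lin_comb R P (\<lambda>x. x)"
  have p: "p \<in> mod_hom R ?F P"
    unfolding p_def by (rule P.lin_comb_hom) auto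
  have "p ` carrier ?F = carrier P"
  proof (intro equalityI subsetI)
    fix y assume y: "y \<in> carrier P"
    define c where "c = (\<lambda>x. if x = y then \<one>\<^bsub>R\<^esub> else \<zero>\<^bsub>R\<^esub>)"
    have c: "c \<in> carrier ?F"
      using y by (auto simp: c_def free_module_def intro: finite_subset[of _ "{y}"])
    have "p c = finsum P (\<lambda>x. c x \<odot>\<^bsub>P\<^esub> x) {y}"
      unfolding p_def by (rule P.lin_comb_superset[OF c]) (use y in \<open>auto simp: c_def\<close>)
    also have "\<dots> = y" using y by (simp add: c_def)
    finally show "y \<in> p ` carrier ?F" using c by blast
  qed (use mod_homD(1)[OF p] in auto)
  moreover have "(\<lambda>x. x) \<in> mod_hom R P P" by (rule mod_homI) auto
  ultimately obtain s where s: "s \<in> mod_hom R P ?F" "\<And>x. x \<in> carrier P \<Longrightarrow> p (s x) = x"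
    using P modF p P.module_axioms unfolding projective_module_def
    by (metis (no_types, lifting) P)
  have "\<forall>x\<in>carrier P. \<exists>y\<in>carrier M. g y = f x"
    using g(2) mod_homD(1)[OF f] by (metis imageE)
  then obtain v where v: "\<And>x. x \<in> carrier P \<Longrightarrow> v x \<in> carrier M \<and> g (v x) = f x" by metis
  define q where "q = lin_comb R M v"
  have q: "q \<in> mod_hom R ?F M" unfolding q_def by (rule M.lin_comb_hom) (use v in auto)
  have gq: "g (q c) = f (p c)" if c: "c \<in> carrier ?F" for c
  proof -
    let ?s = "{x. c x \<noteq> \<zero>\<^bsub>R\<^esub>}"
    have s: "finite ?s" "?s \<subseteq> carrier P" and cc: "\<And>x. c x \<in> carrier R"
      using c by (auto simp: free_module_def)
    have "g (q c) = finsum N (\<lambda>x. g (c x \<odot>\<^bsub>M\<^esub> v x)) ?s"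
      unfolding q_def lin_comb_def
      by (rule mod_hom_finsum[OF g(1) M N s(1)]) (use s cc v in auto)
    also have "\<dots> = finsum N (\<lambda>x. f (c x \<odot>\<^bsub>P\<^esub> x)) ?s"
      by (rule N.finsum_cong')
        (use s cc v mod_homD(3)[OF g(1)] mod_homD(3)[OF f] mod_homD(1)[OF f] in
          \<open>auto simp: subset_iff\<close>)
    also have "\<dots> = f (p c)"
      unfolding p_def lin_comb_def
      by (rule mod_hom_finsum[OF f P.module_axioms N s(1), symmetric]) (use s cc in auto)
    finally show ?thesis .
  qed
  show ?thesis
  proof (intro bexI[where x = "\<lambda>x. q (s x)"] ballI)
    show "g (q (s x)) = f x" if "x \<in> carrier P" for x
      using gq s(2) mod_homD(1)[OF s(1)] that by auto
    show "(\<lambda>x. q (s x)) \<in> mod_hom R P M"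
      by (rule mod_homI) (use mod_homD[OF q] mod_homD[OF s(1)] in auto)
  qed
qed

end

theory Submission
  imports Defs
begin

text \<open>
  Exponent vectors of monomials in \<open>I\<^sub>n\<^sub>,\<^sub>m\<^sup>t\<close> are described by the number \<open>c i\<close> of factors starting at \<open>i\<close>.

  Upper bound.  Let \<open>g\<close> be the last path.  Dropping the path with the largest starting point gives
  \<open>I\<^sub>n\<^sup>t : g = I\<^sub>n\<^sup>t\<^sup>-\<^sup>1\<close>, and \<open>I\<^sub>n\<^sup>t + (g) = I\<^sub>n\<^sub>-\<^sub>1\<^sup>t + (g)\<close>.  For \<open>L = I\<^sub>n\<^sub>-\<^sub>1\<^sup>t : g\<close> and the variable \<open>x\<close> with index \<open>n - m\<close>
  one finds \<open>L : x = I\<^sub>n\<^sub>-\<^sub>1\<^sup>t\<^sup>-\<^sup>1\<close> and \<open>L + (x) = I\<^sub>n\<^sub>-\<^sub>m\<^sub>-\<^sub>1\<^sup>t + (x)\<close>.  The exact sequences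
  \<open>0 \<rightarrow> S/(J : f) \<rightarrow> S/J \<rightarrow> S/(J + (f)) \<rightarrow> 0\<close> turn this into a recursion for the length of finite free resolutions.

  Lower bound.  A module with a projective resolution of length \<open>l\<close> has no Koszul homology above degree \<open>l\<close>,
  for any sequence of distinct variables.  Let a set \<open>W\<close> of variables be coloured with \<open>c\<close> colours, and let \<open>u\<close> be a
  monomial such that \<open>u x\<^sup>T \<in> J\<close> for every transversal \<open>T\<close> of the colour classes, while for one transversal none
  of the \<open>u x\<^sup>T / x\<^sub>i\<close> with \<open>i \<in> T\<close> lies in \<open>J\<close>.  The join of the boundaries of the simplices on the colour classes then
  gives a nonzero Koszul homology class of \<open>S/J\<close> in degree \<open>|W| - c + 1\<close>.  For \<open>J = I\<^sub>n\<^sup>t\<close> with \<open>t \<le> n - m\<close> one takes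
  for \<open>W\<close> the first \<open>N = t + m\<close> variables, coloured by their residue modulo \<open>m\<close>, and the first and last variable of
  each block of \<open>m + 1\<close> variables behind them (with an arbitrary colour); \<open>u\<close> is the product of \<open>t - 1\<close> paths
  starting at \<open>2, \<dots>, t\<close> and of the inner variables of these blocks.
  For \<open>t > n - m\<close> one takes the set \<open>W\<close> of \<open>t = n - m\<close> and multiplies \<open>u\<close> by a power of the first path.
\<close>

section \<open>Finite free resolutions\<close>

text \<open>The period \<open>m + 1\<close> has the same source in both bounds. In the recursion,
  passing from \<open>n\<close> to \<open>n - m - 1\<close> costs two extra steps of the resolution,
  one for adjoining \<open>x\<close> and one for adjoining \<open>g\<close>. In the Koszul class, a
  full block of \<open>m + 1\<close> variables contributes its first and its last one to
  \<open>W\<close>: the inner variables form a run of length \<open>m - 1\<close>, too short for a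
  path, and either end completes it to one. The first variable of a block already counts if only the
  last one is lacking. With \<open>k = n - N + 1\<close>, the firsts are counted by the floor of
  \<open>k / (m + 1)\<close> and the lasts by its ceiling minus one. Residues modulo
  \<open>m\<close> are the right colours because every path meets each class exactly once. The total
  exponent in a class bounds the number of factors, so a class with total \<open>t - 1\<close>
  excludes membership in the \<open>t\<close>-th power. Lengths of resolutions are shifted by one in
  the upper bound: for \<open>t = 1\<close> the ideal quotient by \<open>g\<close> is the whole
  ring, and the zero module must count for less than a free one.\<close>

lemma mod_hom_compose:
  assumes "f \<in> mod_hom R M N" "g \<in> mod_hom R N P"
  shows "(\<lambda>x. g (f x)) \<in> mod_hom R M P"
  by (rule mod_homI) (use mod_homD[OF assms(1)] mod_homD[OF assms(2)] in auto)

lemma mod_hom_minus: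
  assumes f: "f \<in> mod_hom R M N" and M: "module R M" and N: "module R N"
    and x: "x \<in> carrier M" and y: "y \<in> carrier M"
  shows "f (x \<ominus>\<^bsub>M\<^esub> y) = f x \<ominus>\<^bsub>N\<^esub> f y" "f (\<ominus>\<^bsub>M\<^esub> y) = \<ominus>\<^bsub>N\<^esub> f y"
proof -
  interpret M: module R M by fact
  interpret N: module R N by fact
  note h = mod_homD[OF f]
  have "f (\<ominus>\<^bsub>M\<^esub> y) \<oplus>\<^bsub>N\<^esub> f y = \<zero>\<^bsub>N\<^esub>"
    using h(2)[of "\<ominus>\<^bsub>M\<^esub> y" y] y by (simp add: M.l_neg mod_hom_zero[OF f M N])
  then show *: "f (\<ominus>\<^bsub>M\<^esub> y) = \<ominus>\<^bsub>N\<^esub> f y"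
    using h(1) y by (simp add: N.minus_equality)
  show "f (x \<ominus>\<^bsub>M\<^esub> y) = f x \<ominus>\<^bsub>N\<^esub> f y"
    using h(2)[of x "\<ominus>\<^bsub>M\<^esub> y"] x y by (simp add: M.minus_eq N.minus_eq *)
qed

definition ker_module :: "('a, 'b) module \<Rightarrow> ('a, 'c) module \<Rightarrow> ('b \<Rightarrow> 'c) \<Rightarrow> ('a, 'b) module"
  where "ker_module M N f = M\<lparr>carrier := a_kernel M N f\<rparr>"

lemma ker_module_simps [simp]:
  "carrier (ker_module M N f) = {x \<in> carrier M. f x = \<zero>\<^bsub>N\<^esub>}"
  "add (ker_module M N f) = add M" "ring.zero (ker_module M N f) = ring.zero M"
  "smult (ker_module M N f) = smult M"
  by (simp_all add: ker_module_def a_kernel_def')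

lemma ker_module_is_module:
  assumes f: "f \<in> mod_hom R M N" and M: "module R M" and N: "module R N"
  shows "module R (ker_module M N f)"
proof -
  interpret M: module R M by fact
  interpret N: module R N by fact
  note h = mod_homD[OF f]
  have "submodule (a_kernel M N f) R M"
    by (rule M.submoduleI)
      (auto simp: a_kernel_def' h mod_hom_zero[OF f M N] mod_hom_minus(2)[OF f M N])
  from submodule.submodule_is_module[OF this M] show ?thesis by (simp add: ker_module_def)
qed

section \<open>Maps out of free modules\<close>

abbreviation fin_free :: "('a, 'r) ring_scheme \<Rightarrow> nat \<Rightarrow> ('a, nat \<Rightarrow> 'a) module"
  where "fin_free R k \<equiv> free_module R {..<k}"

definition unit_vec :: "('a, 'r) ring_scheme \<Rightarrow> 'b \<Rightarrow> 'b \<Rightarrow> 'a"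
  where "unit_vec R x = (\<lambda>y. if y = x then \<one>\<^bsub>R\<^esub> else \<zero>\<^bsub>R\<^esub>)"

context cring
begin

lemma unit_vec_closed: "x \<in> V \<Longrightarrow> unit_vec R x \<in> carrier (free_module R V)"
  by (auto simp: unit_vec_def free_module_def intro: finite_subset[of _ "{x}"])

lemma lin_comb_unit_vec:
  assumes "module R M" "v \<in> V \<rightarrow> carrier M" "x \<in> V"
  shows "lin_comb R M v (unit_vec R x) = v x"
proof -
  interpret M: module R M by fact
  have "lin_comb R M v (unit_vec R x) = finsum M (\<lambda>y. unit_vec R x y \<odot>\<^bsub>M\<^esub> v y) {x}"
    by (rule M.lin_comb_superset[OF unit_vec_closed[OF assms(3)] assms(2)])
      (use assms(3) in \<open>auto simp: unit_vec_def\<close>)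
  also have "\<dots> = v x"
  proof -
    have "v x \<in> carrier M" using assms by auto
    then show ?thesis by (subst M.finsum_insert) (auto simp: unit_vec_def)
  qed
  finally show ?thesis .
qed

lemma lin_comb_eval:
  assumes M: "module R M" and f: "f \<in> mod_hom R (free_module R V) M"
    and c: "c \<in> carrier (free_module R V)"
  shows "f c = lin_comb R M (\<lambda>x. f (unit_vec R x)) c"
proof -
  let ?F = "free_module R V"
  interpret F: module R ?F by (rule free_module_is_module)
  let ?s = "{x. c x \<noteq> \<zero>}"
  have s: "finite ?s" "?s \<subseteq> V" and cc: "\<And>x. c x \<in> carrier R"
    using c by (auto simp: free_module_def)
  define g where "g = (\<lambda>x. c x \<odot>\<^bsub>?F\<^esub> unit_vec R x)"
  have gc: "g x \<in> carrier ?F" if "x \<in> V" for x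
    unfolding g_def using unit_vec_closed[OF that] cc by simp
  have val: "finsum ?F g A = (\<lambda>y. if y \<in> A then c y else \<zero>)" if "finite A" "A \<subseteq> V" for A
    using that
  proof (induction A rule: finite_induct)
    case empty
    show ?case unfolding F.finsum_empty by (simp add: free_module_def)
  next
    case (insert a A)
    then have "finsum ?F g (insert a A) = g a \<oplus>\<^bsub>?F\<^esub> finsum ?F g A"
      using gc by (intro F.finsum_insert) auto
    then show ?case
      using insert by (auto simp: g_def free_module_def unit_vec_def fun_eq_iff cc)
  qed
  have "c = finsum ?F g ?s" using val[OF s] by auto
  then have "f c = f (finsum ?F g ?s)" by simp
  also have "\<dots> = finsum M (\<lambda>x. f (g x)) ?s"
    using s gc by (intro mod_hom_finsum[OF f F.module_axioms M]) auto
  also have "\<dots> = lin_comb R M (\<lambda>x. f (unit_vec R x)) c"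
  proof -
    interpret M: module R M by fact
    show ?thesis
      unfolding lin_comb_def g_def
      by (rule M.finsum_cong')
        (use s cc mod_homD(1,3)[OF f] unit_vec_closed[of _ V] in \<open>auto simp: subset_iff\<close>)
  qed
  finally show ?thesis .
qed

lemma free_hom_eqI:
  assumes M: "module R M" and f: "f \<in> mod_hom R (free_module R V) M" and g: "g \<in> mod_hom R (free_module R V) M"
    and eq: "\<And>x. x \<in> V \<Longrightarrow> f (unit_vec R x) = g (unit_vec R x)"
    and c: "c \<in> carrier (free_module R V)"
  shows "f c = g c"
proof -
  interpret M: module R M by fact
  have "lin_comb R M (\<lambda>x. f (unit_vec R x)) c = lin_comb R M (\<lambda>x. g (unit_vec R x)) c"
    unfolding lin_comb_def
  proof (rule M.finsum_cong')
    have *: "c x \<in> carrier R" "c x \<noteq> \<zero> \<Longrightarrow> x \<in> V" for x using c by (auto simp: free_module_def)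
    then show "(\<lambda>x. c x \<odot>\<^bsub>M\<^esub> g (unit_vec R x)) \<in> {x. c x \<noteq> \<zero>} \<rightarrow> carrier M"
      using mod_homD(1)[OF g] unit_vec_closed[of _ V] by auto
    show "c x \<odot>\<^bsub>M\<^esub> f (unit_vec R x) = c x \<odot>\<^bsub>M\<^esub> g (unit_vec R x)" if "x \<in> {x. c x \<noteq> \<zero>}" for x
      using that *(2) eq by auto
  qed auto
  then show ?thesis using lin_comb_eval[OF M f c] lin_comb_eval[OF M g c] by simp
qed

lemma free_hom_obtain:
  assumes M: "module R M" and v: "\<And>x. x \<in> V \<Longrightarrow> v x \<in> carrier M"
  obtains f where "f \<in> mod_hom R (free_module R V) M" "\<And>x. x \<in> V \<Longrightarrow> f (unit_vec R x) = v x"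
proof -
  have "v \<in> V \<rightarrow> carrier M" using v by auto
  from module.lin_comb_hom[OF M this] lin_comb_unit_vec[OF M this]
  show thesis by (rule that)
qed

lemma free_module_lift:
  assumes M: "module R M" and N: "module R N"
    and g: "g \<in> mod_hom R M N" "g ` carrier M = carrier N" and f: "f \<in> mod_hom R (free_module R V) N"
  shows "\<exists>h \<in> mod_hom R (free_module R V) M. \<forall>x\<in>carrier (free_module R V). g (h x) = f x"
proof -
  have "\<forall>x\<in>V. \<exists>y\<in>carrier M. g y = f (unit_vec R x)"
    using g(2) mod_homD(1)[OF f] unit_vec_closed by (metis imageE)
  then obtain v where v: "\<And>x. x \<in> V \<Longrightarrow> v x \<in> carrier M \<and> g (v x) = f (unit_vec R x)" by metis
  then obtain h where h: "h \<in> mod_hom R (free_module R V) M" "\<And>x. x \<in> V \<Longrightarrow> h (unit_vec R x) = v x"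
    using free_hom_obtain[OF M, of V v] by auto
  have "g (h x) = f x" if "x \<in> carrier (free_module R V)" for x
    by (rule free_hom_eqI[OF N mod_hom_compose[OF h(1) g(1)] f _ that]) (use h v in auto)
  with h(1) show ?thesis by blast
qed

end

lemma inv_mod_hom:
  assumes f: "f \<in> mod_hom R M N" and "bij_betw f (carrier M) (carrier N)" and M: "module R M"
  shows "inv_into (carrier M) f \<in> mod_hom R N M"
proof (rule mod_homI)
  interpret M: module R M by fact
  note h = mod_homD[OF f]
  let ?g = "inv_into (carrier M) f"
  have inj: "inj_on f (carrier M)" and im: "f ` carrier M = carrier N"
    using assms(2) by (auto simp: bij_betw_def)
  show c: "?g x \<in> carrier M" if "x \<in> carrier N" for x using that im by (auto intro: inv_into_into)
  have fg: "f (?g x) = x" if "x \<in> carrier N" for x using that im by (auto intro: f_inv_into_f)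
  show "?g (x \<oplus>\<^bsub>N\<^esub> y) = ?g x \<oplus>\<^bsub>M\<^esub> ?g y" if "x \<in> carrier N" "y \<in> carrier N" for x y
    using c fg h(2)[of "?g x" "?g y"] that by (intro inv_into_f_eq[OF inj]) auto
  show "?g (r \<odot>\<^bsub>N\<^esub> x) = r \<odot>\<^bsub>M\<^esub> ?g x" if "x \<in> carrier N" "r \<in> carrier R" for x r
    using c fg h(3)[of r "?g x"] that by (intro inv_into_f_eq[OF inj]) auto
qed

text \<open>Stated for isomorphic copies of free modules, because the members of a resolution must
  live in the carrier type that \<open>projective_dimension\<close> prescribes.\<close>

lemma (in cring) projective_moduleI:
  fixes P :: "('a, 'c) module"
  assumes P: "module R P" and i: "\<iota> \<in> mod_hom R (free_module R V) P"
    and b: "bij_betw \<iota> (carrier (free_module R V)) (carrier P)"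
  shows "projective_module R P"
  unfolding projective_module_def
proof (intro conjI allI impI P)
  fix M :: "('a, 'c \<Rightarrow> 'a) module" and N :: "('a, 'c) module" and g f
  assume "module R M \<and> module R N \<and> g \<in> mod_hom R M N \<and> g ` carrier M = carrier N \<and> f \<in> mod_hom R P N"
  then have M: "module R M" and N: "module R N"
    and g: "g \<in> mod_hom R M N" "g ` carrier M = carrier N" and f: "f \<in> mod_hom R P N" by auto
  from free_module_lift[OF M N g mod_hom_compose[OF i f]] obtain h
    where h: "h \<in> mod_hom R (free_module R V) M" "\<And>x. x \<in> carrier (free_module R V) \<Longrightarrow> g (h x) = f (\<iota> x)"
    by blast
  let ?j = "inv_into (carrier (free_module R V)) \<iota>"
  have j: "?j \<in> mod_hom R P (free_module R V)" by (rule inv_mod_hom[OF i b free_module_is_module])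
  show "\<exists>h\<in>mod_hom R P M. \<forall>x\<in>carrier P. g (h x) = f x"
    using mod_hom_compose[OF j h(1)] h(2) mod_homD(1)[OF j] b
    by (intro bexI[where x = "\<lambda>x. h (?j x)"]) (auto simp: bij_betw_inv_into_right)
qed

section \<open>Short exact sequences and the horseshoe construction\<close>

definition short_exact ::
  "('a, 'r) ring_scheme \<Rightarrow> ('a, 'b) module \<Rightarrow> ('a, 'c) module \<Rightarrow> ('a, 'd) module \<Rightarrow> ('b \<Rightarrow> 'c) \<Rightarrow> ('c \<Rightarrow> 'd) \<Rightarrow> bool"
  where "short_exact R A B C \<alpha> \<beta> \<longleftrightarrow>
    module R A \<and> module R B \<and> module R C \<and> \<alpha> \<in> mod_hom R A B \<and> \<beta> \<in> mod_hom R B C \<and>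
    inj_on \<alpha> (carrier A) \<and> \<beta> ` carrier B = carrier C \<and> a_kernel B C \<beta> = \<alpha> ` carrier A"

lemma short_exactD:
  assumes "short_exact R A B C \<alpha> \<beta>"
  shows "module R A" "module R B" "module R C" "\<alpha> \<in> mod_hom R A B" "\<beta> \<in> mod_hom R B C"
    "inj_on \<alpha> (carrier A)" "\<beta> ` carrier B = carrier C"
    "\<And>x. x \<in> carrier A \<Longrightarrow> \<beta> (\<alpha> x) = \<zero>\<^bsub>C\<^esub>"
    "\<And>y. y \<in> carrier B \<Longrightarrow> \<beta> y = \<zero>\<^bsub>C\<^esub> \<Longrightarrow> \<exists>x\<in>carrier A. y = \<alpha> x"
  using assms unfolding short_exact_def a_kernel_def' by auto

lemma short_exactI:
  assumes "module R A" "module R B" "module R C" "\<alpha> \<in> mod_hom R A B" "\<beta> \<in> mod_hom R B C"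
    "inj_on \<alpha> (carrier A)" "\<And>z. z \<in> carrier C \<Longrightarrow> \<exists>y\<in>carrier B. \<beta> y = z"
    "\<And>x. x \<in> carrier A \<Longrightarrow> \<beta> (\<alpha> x) = \<zero>\<^bsub>C\<^esub>"
    "\<And>y. y \<in> carrier B \<Longrightarrow> \<beta> y = \<zero>\<^bsub>C\<^esub> \<Longrightarrow> \<exists>x\<in>carrier A. y = \<alpha> x"
  shows "short_exact R A B C \<alpha> \<beta>"
  unfolding short_exact_def a_kernel_def'
  using assms mod_homD(1)[OF assms(4)] mod_homD(1)[OF assms(5)] by (auto simp: image_iff)

definition cover :: "('a, 'r) ring_scheme \<Rightarrow> nat \<Rightarrow> ('a, 'b) module \<Rightarrow> ((nat \<Rightarrow> 'a) \<Rightarrow> 'b) \<Rightarrow> bool"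
  where "cover R k M f \<longleftrightarrow> f \<in> mod_hom R (fin_free R k) M \<and> f ` carrier (fin_free R k) = carrier M"

text \<open>\<open>free_res R (d + 1) M\<close> says that \<open>M\<close> has a resolution of length at most \<open>d\<close> by free modules of finite
  rank; \<open>free_res R 0 M\<close> says that \<open>M\<close> is zero.  The recursion changes the carrier type of the module
  once, hence two constants.\<close>

primrec syz_free_res :: "('a, 'r) ring_scheme \<Rightarrow> nat \<Rightarrow> ('a, nat \<Rightarrow> 'a) module \<Rightarrow> bool"
  where
    "syz_free_res R 0 M \<longleftrightarrow> carrier M = {\<zero>\<^bsub>M\<^esub>}"
  | "syz_free_res R (Suc l) M \<longleftrightarrow> (\<exists>k f. cover R k M f \<and> syz_free_res R l (ker_module (fin_free R k) M f))"

definition free_res :: "('a, 'r) ring_scheme \<Rightarrow> nat \<Rightarrow> ('a, 'b) module \<Rightarrow> bool"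
  where "free_res R l M \<longleftrightarrow> (case l of 0 \<Rightarrow> carrier M = {\<zero>\<^bsub>M\<^esub>}
     | Suc l \<Rightarrow> \<exists>k f. cover R k M f \<and> syz_free_res R l (ker_module (fin_free R k) M f))"

lemma free_res_syz: "free_res R l (M :: ('a, nat \<Rightarrow> 'a) module) \<longleftrightarrow> syz_free_res R l M"
  by (cases l) (auto simp: free_res_def)

lemma free_res_0: "free_res R 0 M \<longleftrightarrow> carrier M = {\<zero>\<^bsub>M\<^esub>}"
  by (simp add: free_res_def)

lemma free_res_Suc:
  "free_res R (Suc l) M \<longleftrightarrow> (\<exists>k f. cover R k M f \<and> free_res R l (ker_module (fin_free R k) M f))"
  by (simp add: free_res_def[of R "Suc l" M] free_res_syz)

context cring
begin

text \<open>The first \<open>k\<close> unit vectors are sent to the middle through \<open>a\<close>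
  and \<alpha>, the other \<open>l\<close> to lifts along \<beta> of their images under
  \<open>c\<close>. The kernels form a short exact sequence again, so the construction can be
  iterated.\<close>

lemma horseshoe_step:
  assumes s: "short_exact R A B C \<alpha> \<beta>" and a: "cover R k A a" and c: "cover R l C c"
  obtains f \<alpha>' \<beta>' where "cover R (k + l) B f"
    "short_exact R (ker_module (fin_free R k) A a) (ker_module (fin_free R (k + l)) B f)
       (ker_module (fin_free R l) C c) \<alpha>' \<beta>'"
proof -
  note S = short_exactD[OF s]
  interpret A: module R A by (fact S)
  interpret B: module R B by (fact S)
  interpret C: module R C by (fact S)
  let ?K = "fin_free R k" and ?L = "fin_free R l" and ?KL = "fin_free R (k + l)"
  interpret K: module R ?K by (rule free_module_is_module)
  interpret L: module R ?L by (rule free_module_is_module)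
  interpret KL: module R ?KL by (rule free_module_is_module)
  have a1: "a \<in> mod_hom R ?K A" "a ` carrier ?K = carrier A" using a by (auto simp: cover_def)
  have c1: "c \<in> mod_hom R ?L C" "c ` carrier ?L = carrier C" using c by (auto simp: cover_def)
  note ah = mod_homD[OF a1(1)] and ch = mod_homD[OF c1(1)] and \<alpha>h = mod_homD[OF S(4)] and \<beta>h = mod_homD[OF S(5)]
  have "\<forall>y\<in>{..<l}. \<exists>b\<in>carrier B. \<beta> b = c (unit_vec R y)"
    using S(7) ch(1)[OF unit_vec_closed] by (metis imageE)
  then obtain b where b: "\<And>y. y < l \<Longrightarrow> b y \<in> carrier B \<and> \<beta> (b y) = c (unit_vec R y)" by (metis lessThan_iff)
  define v where "v = (\<lambda>x. if x < k then \<alpha> (a (unit_vec R x)) else b (x - k))"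
  have "v x \<in> carrier B" if "x \<in> {..<k + l}" for x
    using that b[of "x - k"] \<alpha>h(1) ah(1) unit_vec_closed[of x "{..<k}"] by (auto simp: v_def)
  then obtain f where f: "f \<in> mod_hom R ?KL B" "\<And>x. x \<in> {..<k + l} \<Longrightarrow> f (unit_vec R x) = v x"
    using free_hom_obtain[OF S(2)] by metis
  note fh = mod_homD[OF f(1)]
  define i :: "(nat \<Rightarrow> 'a) \<Rightarrow> (nat \<Rightarrow> 'a)" where "i = (\<lambda>w. w)"
  define j :: "(nat \<Rightarrow> 'a) \<Rightarrow> (nat \<Rightarrow> 'a)" where "j = (\<lambda>w x. w (x + k))"
  define sh :: "(nat \<Rightarrow> 'a) \<Rightarrow> (nat \<Rightarrow> 'a)" where "sh = (\<lambda>w x. if x < k then \<zero> else w (x - k))"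
  have i: "i \<in> mod_hom R ?K ?KL"
    by (rule mod_homI) (auto simp: i_def free_module_def)
  have jc: "j w \<in> carrier ?L" if "w \<in> carrier ?KL" for w
  proof -
    have "finite {x. w x \<noteq> \<zero>}" using that by (simp add: free_module_def)
    then have "finite ((\<lambda>x. x - k) ` {x. w x \<noteq> \<zero>})" by simp
    then have "finite {x. j w x \<noteq> \<zero>}"
      by (rule finite_subset[rotated]) (auto simp: j_def image_iff intro!: exI[of _ "_ + k"])
    then show ?thesis using that by (auto simp: free_module_def j_def)
  qed
  have j: "j \<in> mod_hom R ?KL ?L"
    by (rule mod_homI[OF jc]) (auto simp: j_def free_module_def)
  have shc: "sh w \<in> carrier ?KL" if "w \<in> carrier ?L" for w
  proof -
    have "finite {x. w x \<noteq> \<zero>}" using that by (simp add: free_module_def)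
    then have "finite ((\<lambda>x. x + k) ` {x. w x \<noteq> \<zero>})" by simp
    then have "finite {x. sh w x \<noteq> \<zero>}"
      by (rule finite_subset[rotated]) (auto simp: sh_def image_iff intro!: exI[of _ "_ - k"] split: if_splits)
    then show ?thesis using that by (auto simp: free_module_def sh_def)
  qed
  have jsh: "j (sh w) = w" for w by (simp add: j_def sh_def)
  have fi: "f (i w) = \<alpha> (a w)" if "w \<in> carrier ?K" for w
  proof (rule free_hom_eqI[OF S(2) mod_hom_compose[OF i f(1)] mod_hom_compose[OF a1(1) S(4)] _ that])
    show "f (i (unit_vec R x)) = \<alpha> (a (unit_vec R x))" if "x \<in> {..<k}" for x
      using that by (simp add: i_def f(2) v_def)
  qed
  have \<beta>f: "\<beta> (f w) = c (j w)" if "w \<in> carrier ?KL" for w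
  proof (rule free_hom_eqI[OF S(3) mod_hom_compose[OF f(1) S(5)] mod_hom_compose[OF j c1(1)] _ that])
    show "\<beta> (f (unit_vec R x)) = c (j (unit_vec R x))" if x: "x \<in> {..<k + l}" for x
    proof (cases "x < k")
      case True
      then have "j (unit_vec R x) = \<zero>\<^bsub>?L\<^esub>" by (auto simp: j_def unit_vec_def free_module_def)
      then have "c (j (unit_vec R x)) = \<zero>\<^bsub>C\<^esub>"
        by (simp add: mod_hom_zero[OF c1(1) L.module_axioms S(3)])
      then show ?thesis
        using True x S(8) ah(1) unit_vec_closed[of x "{..<k}"] by (simp add: f(2) v_def)
    next
      case False
      then have "j (unit_vec R x) = unit_vec R (x - k)"
        by (auto simp: j_def unit_vec_def fun_eq_iff)
      then show ?thesis using False x b[of "x - k"] by (simp add: f(2) v_def)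
    qed
  qed
  \<comment> \<open>This serves two purposes: for arbitrary \<open>y\<close> it gives surjectivity
    of \<open>f\<close>, and for \<open>y\<close> zero surjectivity of \<open>j\<close> between the
    kernels. The shifted vector \<open>sh z\<close> is mapped to \<open>y\<close> up to an element
    of the image of \<alpha>, which a vector in the first \<open>k\<close> coordinates
    corrects.\<close>
  have lift: "\<exists>w\<in>carrier ?KL. f w = y \<and> j w = z"
    if y: "y \<in> carrier B" and z: "z \<in> carrier ?L" and yz: "\<beta> y = c z" for y z
  proof -
    let ?d = "f (sh z) \<ominus>\<^bsub>B\<^esub> y"
    have d: "?d \<in> carrier B" using fh(1)[OF shc[OF z]] y by simp
    have "\<beta> ?d = \<zero>\<^bsub>C\<^esub>"
      using mod_hom_minus(1)[OF S(5,2,3) fh(1)[OF shc[OF z]] y] \<beta>f[OF shc[OF z]] yz ch(1)[OF z]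
      by (simp add: jsh C.r_neg C.minus_eq)
    then obtain x where x: "x \<in> carrier A" "?d = \<alpha> x" using S(9)[OF d] by auto
    obtain w where w: "w \<in> carrier ?K" "a w = x" using a1(2) x(1) by (metis imageE)
    let ?w = "sh z \<ominus>\<^bsub>?KL\<^esub> i w"
    have iw: "i w \<in> carrier ?KL" using mod_homD(1)[OF i w(1)] .
    have "?w \<in> carrier ?KL" using shc[OF z] iw by simp
    moreover have "f ?w = y"
    proof -
      have "f ?w = f (sh z) \<ominus>\<^bsub>B\<^esub> ?d"
        using mod_hom_minus(1)[OF f(1) KL.module_axioms S(2) shc[OF z] iw] fi[OF w(1)] w(2) x(2) by simp
      also have "\<dots> = y"
        using fh(1)[OF shc[OF z]] y
        by (simp add: B.minus_eq B.minus_add B.minus_minus B.a_assoc[symmetric] B.r_neg)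
      finally show ?thesis .
    qed
    moreover have "j ?w = z"
    proof -
      have "j (i w) = \<zero>\<^bsub>?L\<^esub>" using w(1) by (auto simp: i_def j_def free_module_def)
      then show ?thesis
        using mod_hom_minus(1)[OF j KL.module_axioms L.module_axioms shc[OF z] iw] z
        by (simp add: jsh L.minus_eq)
    qed
    ultimately show ?thesis by blast
  qed
  have surj: "f ` carrier ?KL = carrier B"
  proof (intro equalityI subsetI)
    fix y assume y: "y \<in> carrier B"
    then obtain z where "z \<in> carrier ?L" "\<beta> y = c z" using \<beta>h(1)[OF y] c1(2) by (metis imageE)
    with lift[OF y] show "y \<in> f ` carrier ?KL" by blast
  qed (use fh(1) in auto)
  have zB: "\<beta> \<zero>\<^bsub>B\<^esub> = \<zero>\<^bsub>C\<^esub>" by (rule mod_hom_zero[OF S(5,2,3)])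
  have zA: "\<alpha> \<zero>\<^bsub>A\<^esub> = \<zero>\<^bsub>B\<^esub>" by (rule mod_hom_zero[OF S(4,1,2)])
  have cj: "c (j w) = \<zero>\<^bsub>C\<^esub>" if "w \<in> carrier ?KL" "f w = \<zero>\<^bsub>B\<^esub>" for w
    using \<beta>f[OF that(1)] that(2) zB by simp
  show thesis
  proof (rule that[of f i j])
    show "cover R (k + l) B f" using f(1) surj by (simp add: cover_def)
    show "short_exact R (ker_module ?K A a) (ker_module ?KL B f) (ker_module ?L C c) i j"
    proof (rule short_exactI)
      show "module R (ker_module ?K A a)" "module R (ker_module ?KL B f)" "module R (ker_module ?L C c)"
        by (auto intro!: ker_module_is_module a1 c1 f S free_module_is_module)
      show "i \<in> mod_hom R (ker_module ?K A a) (ker_module ?KL B f)"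
        by (rule mod_homI) (use mod_homD[OF i] fi zA in auto)
      show "j \<in> mod_hom R (ker_module ?KL B f) (ker_module ?L C c)"
        by (rule mod_homI) (use mod_homD[OF j] cj in auto)
      show "inj_on i (carrier (ker_module ?K A a))" by (simp add: i_def)
      show "\<exists>y\<in>carrier (ker_module ?KL B f). j y = z" if "z \<in> carrier (ker_module ?L C c)" for z
        using lift[of "\<zero>\<^bsub>B\<^esub>" z] that zB by auto
      show "j (i x) = \<zero>\<^bsub>ker_module ?L C c\<^esub>" if "x \<in> carrier (ker_module ?K A a)" for x
        using that by (auto simp: i_def j_def free_module_def)
      show "\<exists>x\<in>carrier (ker_module ?K A a). w = i x"
        if w: "w \<in> carrier (ker_module ?KL B f)" and jw: "j w = \<zero>\<^bsub>ker_module ?L C c\<^esub>" for w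
      proof -
        have w0: "w (x + k) = \<zero>" for x using jw by (auto simp: j_def free_module_def dest: fun_cong)
        have "w x = \<zero>" if "\<not> x < k" for x using w0[of "x - k"] that by simp
        then have wk: "w \<in> carrier ?K" using w by (auto simp: free_module_def)
        moreover have "a w = \<zero>\<^bsub>A\<^esub>"
        proof (rule inj_onD[OF S(6)])
          show "\<alpha> (a w) = \<alpha> \<zero>\<^bsub>A\<^esub>" using fi[OF wk] w by (simp add: zA i_def)
        qed (use ah(1)[OF wk] in auto)
        ultimately show ?thesis by (auto simp: i_def)
      qed
    qed
  qed
qed

lemma zero_middle:
  assumes "short_exact R A B C \<alpha> \<beta>" "carrier A = {\<zero>\<^bsub>A\<^esub>}" "carrier C = {\<zero>\<^bsub>C\<^esub>}"
  shows "carrier B = {\<zero>\<^bsub>B\<^esub>}"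
proof -
  note S = short_exactD[OF assms(1)]
  interpret B: module R B by (fact S)
  have "y = \<zero>\<^bsub>B\<^esub>" if y: "y \<in> carrier B" for y
    using S(9)[OF y] mod_homD(1)[OF S(5) y] assms(2,3) mod_hom_zero[OF S(4,1,2)] by auto
  then show ?thesis by auto
qed

text \<open>The induction is confined to modules whose elements are functions on \<open>nat\<close>,
  the carrier type of kernels of covers. For other carriers, \<open>free_res_middle\<close> reaches
  this type after one step.\<close>

lemma horseshoe_syz:
  assumes "short_exact R A B C \<alpha> \<beta>" "syz_free_res R l A" "syz_free_res R l C"
  shows "syz_free_res R l B"
  using assms
proof (induction l arbitrary: A B C \<alpha> \<beta>)
  case 0
  then show ?case using zero_middle by simp
next
  case (Suc l)
  from Suc.prems(2,3) obtain k a k' c where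
    "cover R k A a" "syz_free_res R l (ker_module (fin_free R k) A a)"
    "cover R k' C c" "syz_free_res R l (ker_module (fin_free R k') C c)" by auto
  note * = this
  from horseshoe_step[OF Suc.prems(1) *(1,3)] obtain f \<alpha>' \<beta>' where f: "cover R (k + k') B f"
    "short_exact R (ker_module (fin_free R k) A a) (ker_module (fin_free R (k + k')) B f)
       (ker_module (fin_free R k') C c) \<alpha>' \<beta>'" .
  from Suc.IH[OF f(2) *(2,4)] f(1) show ?case unfolding syz_free_res.simps by blast
qed

lemma free_res_middle:
  assumes s: "short_exact R A B C \<alpha> \<beta>" and "free_res R l A" "free_res R l C"
  shows "free_res R l B"
proof (cases l)
  case 0
  then show ?thesis using zero_middle assms by (simp add: free_res_def)
next
  case (Suc l')
  with assms(2,3) obtain k a k' c where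
    "cover R k A a" "free_res R l' (ker_module (fin_free R k) A a)"
    "cover R k' C c" "free_res R l' (ker_module (fin_free R k') C c)" by (auto simp: free_res_Suc)
  note * = this
  from horseshoe_step[OF s *(1,3)] obtain f \<alpha>' \<beta>' where f: "cover R (k + k') B f"
    "short_exact R (ker_module (fin_free R k) A a) (ker_module (fin_free R (k + k')) B f)
       (ker_module (fin_free R k') C c) \<alpha>' \<beta>'" .
  from horseshoe_syz[OF f(2) *(2,4)[unfolded free_res_syz]] f(1) show ?thesis
    unfolding Suc free_res_Suc free_res_syz by blast
qed

text \<open>The composite of \<open>f\<close> and \<beta> is a cover of \<open>C\<close>. Its kernel
  contains the kernel of \<open>f\<close>, and the quotient is \<open>A\<close>, since
  \<open>f\<close> maps it onto the image of \<alpha>. So the new kernel is the middle of a short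
  exact sequence whose ends have the shorter length, and \<open>free_res_middle\<close> applies.
  This takes the place of the mapping cone.\<close>

lemma free_res_quotient:
  assumes s: "short_exact R A B C \<alpha> \<beta>" and "free_res R l A" and "free_res R (Suc l) B"
  shows "free_res R (Suc l) C"
proof -
  note S = short_exactD[OF s]
  from assms(3) obtain k f where f: "cover R k B f" and K: "free_res R l (ker_module (fin_free R k) B f)"
    by (auto simp: free_res_Suc)
  let ?F = "fin_free R k"
  have F: "module R ?F" by (rule free_module_is_module)
  interpret A: module R A by (fact S)
  interpret B: module R B by (fact S)
  have f1: "f \<in> mod_hom R ?F B" "f ` carrier ?F = carrier B" using f by (auto simp: cover_def)
  have g: "(\<lambda>x. \<beta> (f x)) \<in> mod_hom R ?F C" by (rule mod_hom_compose[OF f1(1) S(5)])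
  have cov: "cover R k C (\<lambda>x. \<beta> (f x))"
    unfolding cover_def using g S(7) f1(2) by (simp flip: image_image)
  define h where "h = (\<lambda>x. inv_into (carrier A) \<alpha> (f x))"
  let ?KB = "ker_module ?F B f" and ?KC = "ker_module ?F C (\<lambda>x. \<beta> (f x))"
  have h: "h x \<in> carrier A" "\<alpha> (h x) = f x" if "x \<in> carrier ?KC" for x
  proof -
    have "f x \<in> \<alpha> ` carrier A" using S(9)[of "f x"] that mod_homD(1)[OF f1(1)] by auto
    then show "h x \<in> carrier A" "\<alpha> (h x) = f x" by (auto simp: h_def inv_into_into f_inv_into_f)
  qed
  have hI: "h x = a" if "a \<in> carrier A" "f x = \<alpha> a" for x a
    unfolding h_def using that S(6) by (simp add: inv_into_f_f)
  note \<alpha>h = mod_homD[OF S(4)] and fh = mod_homD[OF f1(1)]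
  have zB: "\<beta> \<zero>\<^bsub>B\<^esub> = \<zero>\<^bsub>C\<^esub>" by (rule mod_hom_zero[OF S(5,2,3)])
  have zA: "\<alpha> \<zero>\<^bsub>A\<^esub> = \<zero>\<^bsub>B\<^esub>" by (rule mod_hom_zero[OF S(4,1,2)])
  have "short_exact R ?KB ?KC A (\<lambda>x. x) h"
  proof (rule short_exactI)
    show "module R ?KB" "module R ?KC" by (auto intro!: ker_module_is_module f1 g F S)
    show "module R A" by (fact S)
    show "(\<lambda>x. x) \<in> mod_hom R ?KB ?KC" by (rule mod_homI) (auto simp: zB)
    show "h \<in> mod_hom R ?KC A"
    proof (rule mod_homI)
      show "h (x \<oplus>\<^bsub>?KC\<^esub> y) = h x \<oplus>\<^bsub>A\<^esub> h y" if "x \<in> carrier ?KC" "y \<in> carrier ?KC" for x y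
        using that h[of x] h[of y] \<alpha>h(2)[of "h x" "h y"] fh(2)[of x y] by (intro hI) auto
      show "h (r \<odot>\<^bsub>?KC\<^esub> x) = r \<odot>\<^bsub>A\<^esub> h x" if "r \<in> carrier R" "x \<in> carrier ?KC" for r x
        using that h[of x] \<alpha>h(3)[of r "h x"] fh(3)[of r x] by (intro hI) auto
    qed (rule h)
    show "\<exists>y\<in>carrier ?KC. h y = z" if z: "z \<in> carrier A" for z
    proof -
      obtain x where "x \<in> carrier ?F" "f x = \<alpha> z" using f1(2) \<alpha>h(1)[OF z] by (metis imageE)
      then show ?thesis using S(8)[OF z] hI[OF z] by auto
    qed
    show "h x = \<zero>\<^bsub>A\<^esub>" if "x \<in> carrier ?KB" for x using that zA by (intro hI) auto
    show "\<exists>y\<in>carrier ?KB. x = y" if "x \<in> carrier ?KC" "h x = \<zero>\<^bsub>A\<^esub>" for x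
      using h(2)[OF that(1)] that zA by auto
  qed simp
  from free_res_middle[OF this K assms(2)] cov show ?thesis by (auto simp: free_res_Suc)
qed

lemma cover_zero:
  assumes M: "module R M" and "carrier M = {\<zero>\<^bsub>M\<^esub>}"
  shows "cover R 0 M (\<lambda>_. \<zero>\<^bsub>M\<^esub>)"
proof -
  interpret M: module R M by fact
  have "carrier (fin_free R 0) = {\<lambda>_. \<zero>}" by (auto simp: free_module_def)
  then show ?thesis unfolding cover_def by (auto intro!: mod_homI simp: assms(2))
qed

lemma syz_free_res_mono: "module R M \<Longrightarrow> syz_free_res R l M \<Longrightarrow> syz_free_res R (Suc l) M"
proof (induction l arbitrary: M)
  case 0
  then have "cover R 0 M (\<lambda>_. \<zero>\<^bsub>M\<^esub>)" using cover_zero by auto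
  moreover have "carrier (fin_free R 0) = {\<lambda>_. \<zero>}" "\<zero>\<^bsub>fin_free R 0\<^esub> = (\<lambda>_. \<zero>)" by (auto simp: free_module_def)
  ultimately show ?case by (auto intro!: exI[of _ 0] exI[of _ "\<lambda>_. \<zero>\<^bsub>M\<^esub>"])
next
  case (Suc l)
  then obtain k f where *: "cover R k M f" "syz_free_res R l (ker_module (fin_free R k) M f)" by auto
  moreover from this(1) have "module R (ker_module (fin_free R k) M f)"
    by (intro ker_module_is_module) (auto simp: cover_def Suc.prems free_module_is_module)
  ultimately show ?case using Suc.IH by (subst syz_free_res.simps) blast
qed

lemma free_res_mono:
  assumes M: "module R M" and "free_res R l M" and "l \<le> l'"
  shows "free_res R l' M"
proof -
  have step: "free_res R (Suc l) M" if "free_res R l M" for l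
  proof (cases l)
    case 0
    then have "cover R 0 M (\<lambda>_. \<zero>\<^bsub>M\<^esub>)" using cover_zero that M by (auto simp: free_res_0)
    moreover have "carrier (fin_free R 0) = {\<lambda>_. \<zero>}" "\<zero>\<^bsub>fin_free R 0\<^esub> = (\<lambda>_. \<zero>)" by (auto simp: free_module_def)
    ultimately show ?thesis using 0 by (auto simp: free_res_def intro!: exI[of _ 0] exI[of _ "\<lambda>_. \<zero>\<^bsub>M\<^esub>"])
  next
    case (Suc l0)
    with that obtain k f where *: "cover R k M f" "syz_free_res R l0 (ker_module (fin_free R k) M f)"
      by (auto simp: free_res_Suc free_res_syz)
    moreover from this(1) have "module R (ker_module (fin_free R k) M f)"
      by (intro ker_module_is_module) (auto simp: cover_def M free_module_is_module)
    ultimately show ?thesis using syz_free_res_mono Suc unfolding free_res_Suc free_res_syz by blast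
  qed
  from assms(3,2) show ?thesis by (induction rule: dec_induct) (auto intro: step)
qed

end

section \<open>From iterated covers to a projective resolution\<close>

definition free_resolution ::
  "('a, 'r) ring_scheme \<Rightarrow> ('a, 'b) module \<Rightarrow> (nat \<Rightarrow> nat) \<Rightarrow> (nat \<Rightarrow> (nat \<Rightarrow> 'a) \<Rightarrow> nat \<Rightarrow> 'a) \<Rightarrow>
    ((nat \<Rightarrow> 'a) \<Rightarrow> 'b) \<Rightarrow> bool"
  where "free_resolution R M k \<phi> e \<longleftrightarrow> cover R (k 0) M e \<and>
    (\<forall>i. \<phi> i \<in> mod_hom R (fin_free R (k (Suc i))) (fin_free R (k i))) \<and>
    a_kernel (fin_free R (k 0)) M e = \<phi> 0 ` carrier (fin_free R (k 1)) \<and>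
    (\<forall>i. a_kernel (fin_free R (k (Suc i))) (fin_free R (k i)) (\<phi> i) =
       \<phi> (Suc i) ` carrier (fin_free R (k (Suc (Suc i)))))"

lemma free_resolution_extend:
  assumes f: "cover R k0 M f" and K: "free_resolution R (ker_module (fin_free R k0) M f) k \<phi> e"
  shows "free_resolution R M (case_nat k0 k) (case_nat e \<phi>) f"
proof -
  let ?F = "fin_free R" and ?K = "ker_module (fin_free R k0) M f"
  have e: "e \<in> mod_hom R (?F (k 0)) ?K" and im: "e ` carrier (?F (k 0)) = carrier ?K"
    and \<phi>: "\<And>i. \<phi> i \<in> mod_hom R (?F (k (Suc i))) (?F (k i))"
    and k0: "a_kernel (?F (k 0)) ?K e = \<phi> 0 ` carrier (?F (k 1))"
    and ki: "\<And>i. a_kernel (?F (k (Suc i))) (?F (k i)) (\<phi> i) = \<phi> (Suc i) ` carrier (?F (k (Suc (Suc i))))"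
    using K by (auto simp: free_resolution_def cover_def)
  have e': "e \<in> mod_hom R (?F (k 0)) (?F k0)"
    by (rule mod_homI) (use mod_homD[OF e] in auto)
  show ?thesis unfolding free_resolution_def
  proof (intro conjI allI)
    show "cover R (case_nat k0 k 0) M f" using f by simp
    show "case_nat e \<phi> i \<in> mod_hom R (?F (case_nat k0 k (Suc i))) (?F (case_nat k0 k i))" for i
      using e' \<phi> by (cases i) auto
    show "a_kernel (?F (case_nat k0 k 0)) M f = case_nat e \<phi> 0 ` carrier (?F (case_nat k0 k 1))"
      using im by (simp add: a_kernel_def')
    show "a_kernel (?F (case_nat k0 k (Suc i))) (?F (case_nat k0 k i)) (case_nat e \<phi> i) =
       case_nat e \<phi> (Suc i) ` carrier (?F (case_nat k0 k (Suc (Suc i))))" for i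
      using k0 ki by (cases i) (auto simp: a_kernel_def')
  qed
qed

context cring
begin

lemma carrier_free_module_empty: "carrier (free_module R {}) = {\<zero>\<^bsub>free_module R {}\<^esub>}"
  by (auto simp: free_module_def)

lemma syz_free_res_resolution:
  assumes "module R M" "syz_free_res R l M"
  shows "\<exists>k \<phi> e. free_resolution R M k \<phi> e \<and> (\<forall>i\<ge>l. k i = 0)"
  using assms
proof (induction l arbitrary: M)
  case 0
  let ?\<phi> = "\<lambda>_ _. \<zero>\<^bsub>fin_free R 0\<^esub>" and ?e = "\<lambda>_. \<zero>\<^bsub>M\<^esub>"
  interpret F: module R "free_module R {}" by (rule free_module_is_module)
  have "free_resolution R M (\<lambda>_. 0) ?\<phi> ?e"
    unfolding free_resolution_def using cover_zero[of M] 0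
    by (auto simp: a_kernel_def' carrier_free_module_empty intro!: mod_homI)
  then show ?case by blast
next
  case (Suc l)
  from Suc.prems(2) obtain k0 f where f: "cover R k0 M f" "syz_free_res R l (ker_module (fin_free R k0) M f)"
    by auto
  have "module R (ker_module (fin_free R k0) M f)"
    using f(1) Suc.prems(1) by (intro ker_module_is_module) (auto simp: cover_def free_module_is_module)
  from Suc.IH[OF this f(2)] obtain k \<phi> e where
    *: "free_resolution R (ker_module (fin_free R k0) M f) k \<phi> e" "\<forall>i\<ge>l. k i = 0" by auto
  have "\<forall>i\<ge>Suc l. case_nat k0 k i = 0" using *(2) by (auto split: nat.split)
  with free_resolution_extend[OF f(1) *(1)] show ?case by blast
qed

lemma free_res_resolution:
  assumes "module R M" "free_res R (Suc d) M"
  shows "\<exists>k \<phi> e. free_resolution R M k \<phi> e \<and> (\<forall>i>d. k i = 0)"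
proof -
  from assms(2) obtain k0 f where f: "cover R k0 M f" "syz_free_res R d (ker_module (fin_free R k0) M f)"
    by (auto simp: free_res_Suc free_res_syz)
  have "module R (ker_module (fin_free R k0) M f)"
    using f(1) assms(1) by (intro ker_module_is_module) (auto simp: cover_def free_module_is_module)
  from syz_free_res_resolution[OF this f(2)] obtain k \<phi> e where
    *: "free_resolution R (ker_module (fin_free R k0) M f) k \<phi> e" "\<forall>i\<ge>d. k i = 0" by auto
  have "\<forall>i>d. case_nat k0 k i = 0" using *(2) by (auto split: nat.split)
  with free_resolution_extend[OF f(1) *(1)] show ?thesis by blast
qed

end

text \<open>A copy of the module with a constant second component. It moves the free modules into
  the type of pairs over which \<open>projective_dimension\<close> takes its infimum.\<close>

definition tag_module :: "'c \<Rightarrow> ('a, 'b) module \<Rightarrow> ('a, 'b \<times> 'c) module"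
  where "tag_module y M = \<lparr>carrier = (\<lambda>x. (x, y)) ` carrier M, monoid.mult = undefined, one = undefined,
     ring.zero = (\<zero>\<^bsub>M\<^esub>, y), add = (\<lambda>p q. (fst p \<oplus>\<^bsub>M\<^esub> fst q, y)), smult = (\<lambda>r p. (r \<odot>\<^bsub>M\<^esub> fst p, y))\<rparr>"

lemma tag_module_simps [simp]:
  "carrier (tag_module y M) = (\<lambda>x. (x, y)) ` carrier M" "\<zero>\<^bsub>tag_module y M\<^esub> = (\<zero>\<^bsub>M\<^esub>, y)"
  "p \<oplus>\<^bsub>tag_module y M\<^esub> p' = (fst p \<oplus>\<^bsub>M\<^esub> fst p', y)" "r \<odot>\<^bsub>tag_module y M\<^esub> p = (r \<odot>\<^bsub>M\<^esub> fst p, y)"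
  by (simp_all add: tag_module_def)

lemma tag_module_is_module:
  assumes "module R M"
  shows "module R (tag_module y M)"
proof -
  interpret M: module R M by fact
  have "abelian_group (tag_module y M)"
  proof (rule abelian_groupI)
    fix p assume "p \<in> carrier (tag_module y M)"
    then show "\<exists>p'\<in>carrier (tag_module y M). p' \<oplus>\<^bsub>tag_module y M\<^esub> p = \<zero>\<^bsub>tag_module y M\<^esub>"
      by (auto intro!: bexI[where x = "(\<ominus>\<^bsub>M\<^esub> fst p, y)"] simp: M.l_neg)
  qed (auto simp: M.a_ac)
  then show ?thesis
    by (intro moduleI M.is_cring) (auto simp: M.smult_l_distr M.smult_r_distr M.smult_assoc1)
qed

theorem (in cring) projective_dimension_le:
  fixes M :: "('a, 'm) module"
  assumes M: "module R M" and "free_res R (Suc d) M"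
  shows "projective_dimension R M \<le> enat d"
proof -
  from free_res_resolution[OF assms] obtain k \<phi> e where res: "free_resolution R M k \<phi> e" "\<forall>i>d. k i = 0"
    by auto
  define y where "y = \<zero>\<^bsub>M\<^esub>"
  let ?F = "\<lambda>i. fin_free R (k i)"
  define P where "P = (\<lambda>i. tag_module y (?F i))"
  define D where "D = (\<lambda>i (p :: (nat \<Rightarrow> 'a) \<times> 'm). (\<phi> i (fst p), y))"
  define E where "E = (\<lambda>p :: (nat \<Rightarrow> 'a) \<times> 'm. e (fst p))"
  have e: "e \<in> mod_hom R (?F 0) M" and im: "e ` carrier (?F 0) = carrier M"
    and \<phi>: "\<And>i. \<phi> i \<in> mod_hom R (?F (Suc i)) (?F i)"
    and k0: "a_kernel (?F 0) M e = \<phi> 0 ` carrier (?F 1)"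
    and ki: "\<And>i. a_kernel (?F (Suc i)) (?F i) (\<phi> i) = \<phi> (Suc i) ` carrier (?F (Suc (Suc i)))"
    using res(1) by (auto simp: free_resolution_def cover_def)
  have "projective_resolution R M P D E"
    unfolding projective_resolution_def
  proof (intro conjI allI)
    show "projective_module R (P i)" for i
      unfolding P_def
      by (rule projective_moduleI[where \<iota> = "\<lambda>v. (v, y)", OF tag_module_is_module[OF free_module_is_module]])
        (auto intro!: mod_homI bij_betw_imageI inj_onI)
    show "D i \<in> mod_hom R (P (Suc i)) (P i)" for i
      by (rule mod_homI) (use mod_homD[OF \<phi>[of i]] in \<open>auto simp: P_def D_def\<close>)
    show "E \<in> mod_hom R (P 0) M"
      by (rule mod_homI) (use mod_homD[OF e] in \<open>auto simp: P_def E_def\<close>)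
    show "E ` carrier (P 0) = carrier M" using im by (auto simp: P_def E_def image_image)
    have ker0: "a_kernel (P 0) M E = (\<lambda>v. (v, y)) ` a_kernel (?F 0) M e"
      by (auto simp: P_def E_def a_kernel_def')
    show "a_kernel (P 0) M E = D 0 ` carrier (P 1)"
      unfolding ker0 k0 by (simp add: P_def D_def image_image)
    fix i
    have ker: "a_kernel (P (Suc i)) (P i) (D i) = (\<lambda>v. (v, y)) ` a_kernel (?F (Suc i)) (?F i) (\<phi> i)"
      by (auto simp: P_def D_def a_kernel_def')
    show "a_kernel (P (Suc i)) (P i) (D i) = D (Suc i) ` carrier (P (Suc (Suc i)))"
      unfolding ker ki by (simp add: P_def D_def image_image)
  qed
  moreover have "\<forall>i>d. carrier (P i) = {\<zero>\<^bsub>P i\<^esub>}"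
    using res(2) by (auto simp: P_def carrier_free_module_empty)
  ultimately have res': "projective_resolution R M P D E \<and> (\<forall>i>d. carrier (P i) = {\<zero>\<^bsub>P i\<^esub>})" ..
  show ?thesis
    unfolding projective_dimension_def
    by (rule Inf_lower, rule CollectI, rule exI[of _ d], rule conjI, rule refl,
        rule exI[of _ P], rule exI[of _ D], rule exI[of _ E], rule res')
qed

section \<open>The Koszul complex\<close>

text \<open>The differential of the Koszul complex of \<open>q 0, \<dots>, q (r - 1)\<close> on \<open>M\<close>, as the iterated mapping cone of the
  multiplications by the \<open>q i\<close>.  A chain is a function \<open>c\<close> on the subsets of \<open>{..<r}\<close>, where \<open>c U\<close> is the
  coefficient of the wedge product of the basis elements in \<open>U\<close>.\<close>

primrec koszul :: "('a, 'r) ring_scheme \<Rightarrow> (nat \<Rightarrow> 'a) \<Rightarrow> ('a, 'b, 'm) module_scheme \<Rightarrow> nat \<Rightarrow> (nat set \<Rightarrow> 'b) \<Rightarrow> nat set \<Rightarrow> 'b"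
  where
    "koszul R q M 0 c T = \<zero>\<^bsub>M\<^esub>"
  | "koszul R q M (Suc r) c T = (if r \<in> T then \<ominus>\<^bsub>M\<^esub> koszul R q M r (\<lambda>U. c (insert r U)) (T - {r})
       else koszul R q M r c T \<oplus>\<^bsub>M\<^esub> q r \<odot>\<^bsub>M\<^esub> c (insert r T))"

text \<open>Exactness at the chains of degree \<open>i\<close>; only the values on subsets of \<open>{..<r}\<close> matter.\<close>

definition koszul_exact :: "('a, 'r) ring_scheme \<Rightarrow> (nat \<Rightarrow> 'a) \<Rightarrow> ('a, 'b, 'm) module_scheme \<Rightarrow> nat \<Rightarrow> nat \<Rightarrow> bool"
  where "koszul_exact R q M r i \<longleftrightarrow>
    (\<forall>c. (\<forall>U. c U \<in> carrier M) \<and> (\<forall>T\<subseteq>{..<r}. Suc (card T) = i \<longrightarrow> koszul R q M r c T = \<zero>\<^bsub>M\<^esub>) \<longrightarrow>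
      (\<exists>w. (\<forall>U. w U \<in> carrier M) \<and> (\<forall>T\<subseteq>{..<r}. card T = i \<longrightarrow> koszul R q M r w T = c T)))"

lemma koszul_exactE:
  assumes "koszul_exact R q M r i" "\<And>U. c U \<in> carrier M"
    "\<And>T. T \<subseteq> {..<r} \<Longrightarrow> Suc (card T) = i \<Longrightarrow> koszul R q M r c T = \<zero>\<^bsub>M\<^esub>"
  obtains w where "\<And>U. w U \<in> carrier M" "\<And>T. T \<subseteq> {..<r} \<Longrightarrow> card T = i \<Longrightarrow> koszul R q M r w T = c T"
proof -
  from assms(1)[unfolded koszul_exact_def, rule_format, of c] assms(2,3)
  have "\<exists>w. (\<forall>U. w U \<in> carrier M) \<and> (\<forall>T\<subseteq>{..<r}. card T = i \<longrightarrow> koszul R q M r w T = c T)"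
    by simp
  then obtain w where "\<forall>U. w U \<in> carrier M" "\<forall>T\<subseteq>{..<r}. card T = i \<longrightarrow> koszul R q M r w T = c T" by blast
  then show thesis by (intro that[of w]) simp_all
qed

lemma koszul_cong:
  assumes "\<And>i. i < r \<Longrightarrow> i \<notin> T \<Longrightarrow> c (insert i T) = c' (insert i T)"
  shows "koszul R q M r c T = koszul R q M r c' T"
  using assms
proof (induction r arbitrary: c c' T)
  case (Suc r)
  show ?case
  proof (cases "r \<in> T")
    case True
    have "koszul R q M r (\<lambda>U. c (insert r U)) (T - {r}) = koszul R q M r (\<lambda>U. c' (insert r U)) (T - {r})"
    proof (rule Suc.IH)
      fix i assume "i < r" "i \<notin> T - {r}"
      then show "c (insert r (insert i (T - {r}))) = c' (insert r (insert i (T - {r})))"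
        using Suc.prems[of i] True by (simp add: insert_commute[of r i] insert_absorb)
    qed
    then show ?thesis using True by simp
  next
    case False
    have "koszul R q M r c T = koszul R q M r c' T"
      by (rule Suc.IH) (simp add: Suc.prems)
    then show ?thesis using False Suc.prems[of r] by simp
  qed
qed simp

locale koszul_module = module R M for R (structure) and M (structure) +
  fixes q :: "nat \<Rightarrow> 'a"
  assumes q: "q i \<in> carrier R"
begin

abbreviation "kz \<equiv> koszul R q M"

lemma kz_closed [simp]:
  assumes "\<And>U. c U \<in> carrier M"
  shows "kz r c T \<in> carrier M"
  using assms by (induction r arbitrary: c T) (auto simp: q)

lemma kz_add:
  assumes "\<And>U. c U \<in> carrier M" "\<And>U. c' U \<in> carrier M"
  shows "kz r (\<lambda>U. c U \<oplus>\<^bsub>M\<^esub> c' U) T = kz r c T \<oplus>\<^bsub>M\<^esub> kz r c' T"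
  using assms
  by (induction r arbitrary: c c' T) (simp_all add: M.minus_add smult_r_distr q M.a_ac)

lemma neg_zero: "\<ominus>\<^bsub>M\<^esub> \<zero>\<^bsub>M\<^esub> = \<zero>\<^bsub>M\<^esub>"
  using M.add.inv_one by (simp add: a_inv_def)

lemma kz_neg:
  assumes "\<And>U. c U \<in> carrier M"
  shows "kz r (\<lambda>U. \<ominus>\<^bsub>M\<^esub> c U) T = \<ominus>\<^bsub>M\<^esub> kz r c T"
  using assms
  by (induction r arbitrary: c T) (simp_all add: M.minus_add smult_r_minus q neg_zero)

lemma kz_smult:
  assumes "\<And>U. c U \<in> carrier M" "a \<in> carrier R"
  shows "kz r (\<lambda>U. a \<odot>\<^bsub>M\<^esub> c U) T = a \<odot>\<^bsub>M\<^esub> kz r c T"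
  using assms
  by (induction r arbitrary: c T)
    (simp_all add: smult_r_minus smult_r_distr q smult_assoc1[symmetric] m_comm)

lemma kz_zero: "kz r (\<lambda>U. \<zero>\<^bsub>M\<^esub>) T = \<zero>\<^bsub>M\<^esub>"
  by (induction r arbitrary: T) (simp_all add: q)

lemma kz_kz:
  assumes c: "\<And>U. c U \<in> carrier M"
  shows "kz r (kz r c) T = \<zero>\<^bsub>M\<^esub>"
  using assms
proof (induction r arbitrary: c T)
  case (Suc r)
  show ?case
  proof (cases "r \<in> T")
    case True
    let ?b = "\<lambda>U. c (insert r U)"
    have "kz r (\<lambda>U. kz (Suc r) c (insert r U)) (T - {r}) = kz r (\<lambda>U. \<ominus>\<^bsub>M\<^esub> kz r ?b U) (T - {r})"
      by (rule koszul_cong) auto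
    also have "\<dots> = \<zero>\<^bsub>M\<^esub>" using Suc by (simp add: kz_neg)
    finally show ?thesis using True by simp
  next
    case False
    have "kz r (kz (Suc r) c) T = kz r (\<lambda>U. kz r c U \<oplus>\<^bsub>M\<^esub> q r \<odot>\<^bsub>M\<^esub> c (insert r U)) T"
      by (rule koszul_cong) (use False in auto)
    also have "\<dots> = q r \<odot>\<^bsub>M\<^esub> kz r (\<lambda>U. c (insert r U)) T"
      using Suc by (simp add: kz_add kz_smult q)
    finally have "kz r (kz (Suc r) c) T = q r \<odot>\<^bsub>M\<^esub> kz r (\<lambda>U. c (insert r U)) T" .
    moreover have "kz (Suc r) c (insert r T) = \<ominus>\<^bsub>M\<^esub> kz r (\<lambda>U. c (insert r U)) T" using False by simp
    moreover have "kz (Suc r) (kz (Suc r) c) T = kz r (kz (Suc r) c) T \<oplus>\<^bsub>M\<^esub> q r \<odot>\<^bsub>M\<^esub> kz (Suc r) c (insert r T)"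
      using False by (subst koszul.simps(2)) simp
    ultimately show ?thesis using Suc.prems by (simp only:) (simp add: q smult_r_minus M.r_neg)
  qed
qed simp

text \<open>The elements \<open>kz k c {}\<close> form the submodule generated by the
  \<open>q j\<close> times \<open>M\<close> with \<open>j < k\<close>, so the hypothesis says that
  \<open>q k\<close> is a nonzerodivisor modulo this submodule. The proof is the long exact sequence
  of the mapping cone written out with elements: a chain splits into its values on sets without
  \<open>r\<close> and its values \<open>b\<close> on sets with \<open>r\<close>.\<close>

lemma koszul_exact_regular:
  assumes "\<And>k b. k < r \<Longrightarrow> b \<in> carrier M \<Longrightarrow> \<exists>c. (\<forall>U. c U \<in> carrier M) \<and> q k \<odot>\<^bsub>M\<^esub> b = kz k c {} \<Longrightarrow>
      \<exists>c. (\<forall>U. c U \<in> carrier M) \<and> b = kz k c {}"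
  shows "koszul_exact R q M r (Suc i)"
  using assms
proof (induction r arbitrary: i)
  case 0
  have "card T \<noteq> Suc i" if "T \<subseteq> {..<0}" for T :: "nat set" using that by auto
  then show ?case unfolding koszul_exact_def by (metis M.zero_closed)
next
  case (Suc r)
  have IH: "koszul_exact R q M r (Suc i)" for i using Suc.prems by (intro Suc.IH) auto
  show ?case unfolding koszul_exact_def
  proof (intro allI impI, elim conjE)
    fix c assume c: "\<forall>U. c U \<in> carrier M"
      and cyc: "\<forall>T\<subseteq>{..<Suc r}. Suc (card T) = Suc i \<longrightarrow> kz (Suc r) c T = \<zero>\<^bsub>M\<^esub>"
    define b where "b = (\<lambda>U. c (insert r U))"
    have b: "b U \<in> carrier M" for U using c by (simp add: b_def)
    have fin: "finite T" if "T \<subseteq> {..<r}" for T using that by (rule finite_subset) simp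
    have sub: "T \<subseteq> {..<Suc r}" "insert r T \<subseteq> {..<Suc r}" "r \<notin> T" if "T \<subseteq> {..<r}" for T using that by auto
    have cycr: "kz r c T \<oplus>\<^bsub>M\<^esub> q r \<odot>\<^bsub>M\<^esub> b T = \<zero>\<^bsub>M\<^esub>" if "T \<subseteq> {..<r}" "card T = i" for T
      using cyc sub[OF that(1)] that by (auto simp: b_def)
    have bcyc: "kz r b T = \<zero>\<^bsub>M\<^esub>" if T: "T \<subseteq> {..<r}" "Suc (card T) = i" for T
    proof -
      have "kz (Suc r) c (insert r T) = \<zero>\<^bsub>M\<^esub>"
        using cyc sub[OF T(1)] T fin[OF T(1)] by (metis card_insert_disjoint)
      moreover have "insert r T - {r} = T" using sub(3)[OF T(1)] by auto
      ultimately have "\<ominus>\<^bsub>M\<^esub> kz r b T = \<zero>\<^bsub>M\<^esub>" by (simp add: b_def)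
      then show ?thesis using b by (metis M.minus_minus neg_zero kz_closed)
    qed
    \<comment> \<open>\<open>b\<close> is a cycle one degree lower. In positive degree the induction
      hypothesis bounds it, in degree zero the nonzerodivisor property does.\<close>
    obtain w1 where w1: "\<And>U. w1 U \<in> carrier M" "\<And>T. T \<subseteq> {..<r} \<Longrightarrow> card T = i \<Longrightarrow> kz r w1 T = b T"
    proof (cases i)
      case 0
      have "kz r c {} \<oplus>\<^bsub>M\<^esub> q r \<odot>\<^bsub>M\<^esub> b {} = \<zero>\<^bsub>M\<^esub>" using cycr[of "{}"] 0 by simp
      then have "q r \<odot>\<^bsub>M\<^esub> b {} = \<ominus>\<^bsub>M\<^esub> kz r c {}"
        using b c by (metis M.minus_equality M.minus_minus kz_closed q smult_closed)
      also have "\<dots> = kz r (\<lambda>U. \<ominus>\<^bsub>M\<^esub> c U) {}" using c by (simp add: kz_neg)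
      finally have "\<exists>c. (\<forall>U. c U \<in> carrier M) \<and> q r \<odot>\<^bsub>M\<^esub> b {} = kz r c {}"
        using c by (intro exI[of _ "\<lambda>U. \<ominus>\<^bsub>M\<^esub> c U"]) auto
      from Suc.prems[OF lessI b this] obtain w where w: "\<And>U. w U \<in> carrier M" "b {} = kz r w {}" by auto
      have T0: "T = {}" if "T \<subseteq> {..<r}" "card T = i" for T using fin[OF that(1)] that(2) 0 by simp
      show thesis
      proof (rule that[OF w(1)])
        show "kz r w T = b T" if "T \<subseteq> {..<r}" "card T = i" for T using T0[OF that] w(2) by simp
      qed
    next
      case (Suc i')
      from koszul_exactE[of R q M r "Suc i'" b, OF IH[of i'] b] bcyc Suc obtain w
        where "\<And>U. w U \<in> carrier M" "\<And>T. T \<subseteq> {..<r} \<Longrightarrow> card T = Suc i' \<Longrightarrow> kz r w T = b T"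
        by blast
      then show thesis using Suc by (intro that[of w]) simp_all
    qed
    \<comment> \<open>The correction by \<open>w1\<close> turns \<open>c\<close> into a cycle for
      the first \<open>r\<close> elements, and the induction hypothesis applies in the original
      degree.\<close>
    define a where "a = (\<lambda>U. c U \<oplus>\<^bsub>M\<^esub> q r \<odot>\<^bsub>M\<^esub> w1 U)"
    have a: "a U \<in> carrier M" for U using c w1(1) by (simp add: a_def q)
    have acyc: "kz r a T = \<zero>\<^bsub>M\<^esub>" if "T \<subseteq> {..<r}" "Suc (card T) = Suc i" for T
      unfolding a_def using cycr[OF that(1)] that w1 c by (simp add: kz_add kz_smult q)
    from koszul_exactE[of R q M r "Suc i" a, OF IH a acyc] obtain w2 where
      w2: "\<And>U. w2 U \<in> carrier M" "\<And>T. T \<subseteq> {..<r} \<Longrightarrow> card T = Suc i \<Longrightarrow> kz r w2 T = a T" by metis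
    define w where "w = (\<lambda>U. if r \<in> U then \<ominus>\<^bsub>M\<^esub> w1 (U - {r}) else w2 U)"
    have w: "w U \<in> carrier M" for U using w1 w2 by (simp add: w_def)
    have "kz (Suc r) w T = c T" if T: "T \<subseteq> {..<Suc r}" "card T = Suc i" for T
    proof (cases "r \<in> T")
      case True
      let ?T = "T - {r}"
      have T': "?T \<subseteq> {..<r}" "card ?T = i" using T True by (auto simp: less_Suc_eq)
      have "kz r (\<lambda>U. w (insert r U)) ?T = kz r (\<lambda>U. \<ominus>\<^bsub>M\<^esub> w1 U) ?T"
        by (rule koszul_cong) (auto simp: w_def)
      also have "\<dots> = \<ominus>\<^bsub>M\<^esub> b ?T" using w1(2)[OF T'] w1(1) by (simp add: kz_neg)
      finally show ?thesis using True b c by (simp add: b_def insert_absorb)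
    next
      case False
      then have T': "T \<subseteq> {..<r}" using T by (auto simp: less_Suc_eq)
      have "kz r w T = kz r w2 T"
        by (rule koszul_cong) (use False in \<open>auto simp: w_def\<close>)
      moreover have "w (insert r T) = \<ominus>\<^bsub>M\<^esub> w1 T" using False by (simp add: w_def)
      ultimately show ?thesis
        using False w2(2)[OF T' T(2)] w1(1)[of T] c
        by (simp add: a_def smult_r_minus q M.a_assoc M.r_neg)
    qed
    with w show "\<exists>w. (\<forall>U. w U \<in> carrier M) \<and> (\<forall>T\<subseteq>{..<Suc r}. card T = Suc i \<longrightarrow> kz (Suc r) w T = c T)"
      by blast
  qed
qed

end

lemma koszul_moduleI: "module R M \<Longrightarrow> (\<And>i. q i \<in> carrier R) \<Longrightarrow> koszul_module R M q"
  by (intro koszul_module.intro koszul_module_axioms.intro)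

lemma koszul_hom:
  assumes f: "f \<in> mod_hom R M N" and M: "koszul_module R M q" and N: "koszul_module R N q"
    and c: "\<And>U. c U \<in> carrier M"
  shows "f (koszul R q M r c T) = koszul R q N r (\<lambda>U. f (c U)) T"
proof -
  interpret M: koszul_module R M q by fact
  interpret N: koszul_module R N q by fact
  note h = mod_homD[OF f]
  show ?thesis using c
    by (induction r arbitrary: c T)
      (simp_all add: h M.q mod_hom_zero[OF f M.module_axioms N.module_axioms]
        mod_hom_minus(2)[OF f M.module_axioms N.module_axioms M.M.zero_closed])
qed

text \<open>In the long exact homology sequence, the homology of \<open>C\<close> in degree
  \<open>i + 1\<close> stands between that of \<open>B\<close> in degree \<open>i + 1\<close> and
  that of \<open>A\<close> in degree \<open>i\<close>. The diagram chase is done on chains.\<close>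

lemma koszul_exact_quotient:
  assumes s: "short_exact R A B C \<alpha> \<beta>" and q: "\<And>i. q i \<in> carrier R"
    and A: "koszul_exact R q A r i" and B: "koszul_exact R q B r (Suc i)"
  shows "koszul_exact R q C r (Suc i)"
  unfolding koszul_exact_def
proof (intro allI impI, elim conjE)
  note S = short_exactD[OF s]
  interpret A: koszul_module R A q by (rule koszul_moduleI[OF S(1) q])
  interpret B: koszul_module R B q by (rule koszul_moduleI[OF S(2) q])
  interpret C: koszul_module R C q by (rule koszul_moduleI[OF S(3) q])
  note \<alpha>h = mod_homD[OF S(4)] and \<beta>h = mod_homD[OF S(5)]
  have zA: "\<alpha> \<zero>\<^bsub>A\<^esub> = \<zero>\<^bsub>B\<^esub>" by (rule mod_hom_zero[OF S(4,1,2)])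
  note k\<alpha> = koszul_hom[OF S(4) A.koszul_module_axioms B.koszul_module_axioms]
    and k\<beta> = koszul_hom[OF S(5) B.koszul_module_axioms C.koszul_module_axioms]
  fix c assume c: "\<forall>U. c U \<in> carrier C"
    and cyc: "\<forall>T\<subseteq>{..<r}. Suc (card T) = Suc i \<longrightarrow> C.kz r c T = \<zero>\<^bsub>C\<^esub>"
  have "\<forall>U. \<exists>y\<in>carrier B. \<beta> y = c U" using c S(7) by (metis imageE)
  then obtain c' where c': "\<And>U. c' U \<in> carrier B" "\<And>U. \<beta> (c' U) = c U" by metis
  have "\<exists>x\<in>carrier A. B.kz r c' T = \<alpha> x" if "T \<subseteq> {..<r}" "card T = i" for T
    using cyc that k\<beta>[of c' r T, OF c'(1)] by (intro S(9)) (auto simp: c')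
  then obtain a where a: "\<And>T. T \<subseteq> {..<r} \<Longrightarrow> card T = i \<Longrightarrow> a T \<in> carrier A \<and> B.kz r c' T = \<alpha> (a T)" by metis
  \<comment> \<open>The preimages \<open>a\<close> are specified only on sets of size
    \<open>i\<close> inside \<open>{..<r}\<close>; elsewhere zero makes \<open>u\<close> a chain in
    \<open>A\<close>.\<close>
  define u where "u = (\<lambda>U. if U \<subseteq> {..<r} \<and> card U = i then a U else \<zero>\<^bsub>A\<^esub>)"
  have u: "u U \<in> carrier A" for U using a by (simp add: u_def)
  have ucyc: "A.kz r u T = \<zero>\<^bsub>A\<^esub>" if T: "T \<subseteq> {..<r}" "Suc (card T) = i" for T
  proof (rule inj_onD[OF S(6)])
    have fin: "finite T" using T(1) by (rule finite_subset) simp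
    have "\<alpha> (A.kz r u T) = B.kz r (\<lambda>U. \<alpha> (u U)) T" by (rule k\<alpha>[of u, OF u])
    also have "\<dots> = B.kz r (B.kz r c') T"
      by (rule koszul_cong) (use T fin a in \<open>auto simp: u_def\<close>)
    also have "\<dots> = \<alpha> \<zero>\<^bsub>A\<^esub>" using c'(1) by (simp add: B.kz_kz zA)
    finally show "\<alpha> (A.kz r u T) = \<alpha> \<zero>\<^bsub>A\<^esub>" .
  qed (use u in auto)
  from koszul_exactE[of R q A r i u, OF A u ucyc] obtain w1 where
    w1: "\<And>U. w1 U \<in> carrier A" "\<And>T. T \<subseteq> {..<r} \<Longrightarrow> card T = i \<Longrightarrow> A.kz r w1 T = u T" by metis
  define c2 where "c2 = (\<lambda>U. c' U \<oplus>\<^bsub>B\<^esub> \<ominus>\<^bsub>B\<^esub> \<alpha> (w1 U))"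
  have \<alpha>w: "\<alpha> (w1 U) \<in> carrier B" for U using \<alpha>h(1) w1(1) by simp
  have c2: "c2 U \<in> carrier B" for U using c'(1) \<alpha>w by (simp add: c2_def)
  have c2cyc: "B.kz r c2 T = \<zero>\<^bsub>B\<^esub>" if T: "T \<subseteq> {..<r}" "Suc (card T) = Suc i" for T
  proof -
    have "B.kz r c2 T = B.kz r c' T \<oplus>\<^bsub>B\<^esub> \<ominus>\<^bsub>B\<^esub> \<alpha> (A.kz r w1 T)"
      unfolding c2_def using c'(1) \<alpha>w by (simp add: B.kz_add B.kz_neg k\<alpha> w1)
    then show ?thesis using a[of T] T w1(2)[of T] \<alpha>h(1) by (simp add: u_def B.M.r_neg)
  qed
  from koszul_exactE[of R q B r "Suc i" c2, OF B c2 c2cyc] obtain w2 where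
    w2: "\<And>U. w2 U \<in> carrier B" "\<And>T. T \<subseteq> {..<r} \<Longrightarrow> card T = Suc i \<Longrightarrow> B.kz r w2 T = c2 T" by metis
  have "C.kz r (\<lambda>U. \<beta> (w2 U)) T = c T" if T: "T \<subseteq> {..<r}" "card T = Suc i" for T
  proof -
    have "C.kz r (\<lambda>U. \<beta> (w2 U)) T = \<beta> (c2 T)" using k\<beta>[of w2 r T, OF w2(1)] w2(2)[OF T] by simp
    also have "\<dots> = c T"
      using \<beta>h(2)[OF c'(1), of "\<ominus>\<^bsub>B\<^esub> \<alpha> (w1 T)"] mod_hom_minus(2)[OF S(5,2,3) \<alpha>w \<alpha>w] c \<alpha>w w1(1)
      by (simp add: c2_def c' S(8))
    finally show ?thesis .
  qed
  then show "\<exists>w. (\<forall>U. w U \<in> carrier C) \<and> (\<forall>T\<subseteq>{..<r}. card T = Suc i \<longrightarrow> C.kz r w T = c T)"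
    using w2(1) \<beta>h(1) by (intro exI[of _ "\<lambda>U. \<beta> (w2 U)"]) auto
qed

section \<open>Koszul exactness of modules with a finite projective resolution\<close>

definition self_module :: "('a, 'r) ring_scheme \<Rightarrow> ('a, 'a) module"
  where "self_module R = \<lparr>carrier = carrier R, monoid.mult = undefined, one = undefined,
     ring.zero = \<zero>\<^bsub>R\<^esub>, add = (\<oplus>\<^bsub>R\<^esub>), smult = (\<otimes>\<^bsub>R\<^esub>)\<rparr>"

lemma self_module_simps [simp]:
  "carrier (self_module R) = carrier R" "\<zero>\<^bsub>self_module R\<^esub> = \<zero>\<^bsub>R\<^esub>"
  "x \<oplus>\<^bsub>self_module R\<^esub> y = x \<oplus>\<^bsub>R\<^esub> y" "x \<odot>\<^bsub>self_module R\<^esub> y = x \<otimes>\<^bsub>R\<^esub> y"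
  by (simp_all add: self_module_def)

context cring
begin

lemma self_module_is_module: "module R (self_module R)"
proof -
  have "abelian_group (self_module R)"
    by (rule abelian_groupI) (auto simp: a_ac intro: bexI[of _ "\<ominus> _"] l_neg)
  then show ?thesis by (intro moduleI is_cring) (auto simp: l_distr r_distr m_assoc)
qed

lemma koszul_exact_free:
  assumes q: "\<And>i. q i \<in> carrier R" and ex: "koszul_exact R q (self_module R) r (Suc i)"
  shows "koszul_exact R q (free_module R V) r (Suc i)"
  unfolding koszul_exact_def
proof (intro allI impI, elim conjE)
  let ?F = "free_module R V"
  interpret F: koszul_module R ?F q by (rule koszul_moduleI[OF free_module_is_module q])
  interpret S: koszul_module R "self_module R" q by (rule koszul_moduleI[OF self_module_is_module q])
  fix c assume c: "\<forall>U. c U \<in> carrier ?F"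
    and cyc: "\<forall>T\<subseteq>{..<r}. Suc (card T) = Suc i \<longrightarrow> F.kz r c T = \<zero>\<^bsub>?F\<^esub>"
  have ev: "(\<lambda>v. v x) \<in> mod_hom R ?F (self_module R)" for x
    by (rule mod_homI) (auto simp: free_module_def)
  have kev: "F.kz r c T x = S.kz r (\<lambda>U. c U x) T" if "\<And>U. c U \<in> carrier ?F" for c T x
    by (rule koszul_hom[OF ev F.koszul_module_axioms S.koszul_module_axioms that])
  have cx: "c U x \<in> carrier R" for U x using c by (auto simp: free_module_def)
  have "\<exists>w. (\<forall>U. w U \<in> carrier R) \<and> (\<forall>T\<subseteq>{..<r}. card T = Suc i \<longrightarrow> S.kz r w T = c T x)" for x
  proof -
    have "S.kz r (\<lambda>U. c U x) T = \<zero>" if "T \<subseteq> {..<r}" "Suc (card T) = Suc i" for T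
      using cyc that kev[of c T x] c by (simp add: free_module_def)
    then show ?thesis using koszul_exactE[OF ex, of "\<lambda>U. c U x"] cx by (metis self_module_simps(1,2))
  qed
  then obtain w where w: "\<And>x U. w x U \<in> carrier R"
    "\<And>x T. T \<subseteq> {..<r} \<Longrightarrow> card T = Suc i \<Longrightarrow> S.kz r (w x) T = c T x" by metis
  \<comment> \<open>Preimages were chosen separately in each coordinate. Only the finitely many
    coordinates in the supports of the values on subsets of \<open>{..<r}\<close> matter; cutting
    off the others keeps the combined preimage inside the free module.\<close>
  define Z where "Z = (\<Union>T\<in>Pow {..<r}. {x. c T x \<noteq> \<zero>})"
  have Z: "finite Z" "Z \<subseteq> V" using c unfolding Z_def by (auto simp: free_module_def)
  define w' where "w' = (\<lambda>U x. if x \<in> Z then w x U else \<zero>)"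
  have w': "w' U \<in> carrier ?F" for U
    using Z w(1) by (auto simp: free_module_def w'_def intro: finite_subset[of _ Z])
  have "F.kz r w' T x = c T x" if T: "T \<subseteq> {..<r}" "card T = Suc i" for T x
  proof (cases "x \<in> Z")
    case True
    then have "(\<lambda>U. w' U x) = w x" by (simp add: w'_def)
    then show ?thesis using kev[of w' T x, OF w'] w(2)[OF T] by simp
  next
    case False
    then have "(\<lambda>U. w' U x) = (\<lambda>_. \<zero>)" "c T x = \<zero>" using T by (auto simp: w'_def Z_def)
    then show ?thesis using kev[of w' T x, OF w'] S.kz_zero by simp
  qed
  then show "\<exists>w. (\<forall>U. w U \<in> carrier ?F) \<and> (\<forall>T\<subseteq>{..<r}. card T = Suc i \<longrightarrow> F.kz r w T = c T)"
    using w' by (intro exI[of _ w']) auto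
qed

text \<open>A projective module is a retract of the free module on its carrier: a cycle is moved
  there by the section \<open>s\<close>, bounded, and moved back by \<open>p\<close>.\<close>

lemma koszul_exact_projective:
  fixes P :: "('a, 'c) module"
  assumes q: "\<And>i. q i \<in> carrier R" and ex: "koszul_exact R q (self_module R) r (Suc i)"
    and P: "projective_module R P"
  shows "koszul_exact R q P r (Suc i)"
  unfolding koszul_exact_def
proof (intro allI impI, elim conjE)
  let ?F = "free_module R (carrier P)"
  have mP: "module R P" using P by (simp add: projective_module_def)
  interpret F: koszul_module R ?F q by (rule koszul_moduleI[OF free_module_is_module q])
  interpret P: koszul_module R P q by (rule koszul_moduleI[OF mP q])
  obtain p where p: "p \<in> mod_hom R ?F P" "\<And>x. x \<in> carrier P \<Longrightarrow> p (unit_vec R x) = x"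
    using free_hom_obtain[OF mP, of "carrier P" "\<lambda>x. x"] by auto
  have "p ` carrier ?F = carrier P"
    using mod_homD(1)[OF p(1)] p(2) unit_vec_closed[of _ "carrier P"] by (auto simp: image_iff) metis
  moreover have "(\<lambda>x. x) \<in> mod_hom R P P" by (rule mod_homI) auto
  ultimately obtain s where s: "s \<in> mod_hom R P ?F" "\<And>x. x \<in> carrier P \<Longrightarrow> p (s x) = x"
    using projective_module_lift[OF P F.module_axioms mP p(1)] by metis
  fix c assume c: "\<forall>U. c U \<in> carrier P"
    and cyc: "\<forall>T\<subseteq>{..<r}. Suc (card T) = Suc i \<longrightarrow> P.kz r c T = \<zero>\<^bsub>P\<^esub>"
  have sc: "s (c U) \<in> carrier ?F" for U using c mod_homD(1)[OF s(1)] by simp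
  have "F.kz r (\<lambda>U. s (c U)) T = \<zero>\<^bsub>?F\<^esub>" if "T \<subseteq> {..<r}" "Suc (card T) = Suc i" for T
    using koszul_hom[OF s(1) P.koszul_module_axioms F.koszul_module_axioms, of c r T] cyc that c
    by (simp add: mod_hom_zero[OF s(1) mP F.module_axioms])
  from koszul_exactE[of R q ?F r "Suc i" "\<lambda>U. s (c U)", OF koszul_exact_free[OF q ex] sc this] obtain w where
    w: "\<And>U. w U \<in> carrier ?F" "\<And>T. T \<subseteq> {..<r} \<Longrightarrow> card T = Suc i \<Longrightarrow> F.kz r w T = s (c T)" by metis
  have "P.kz r (\<lambda>U. p (w U)) T = c T" if "T \<subseteq> {..<r}" "card T = Suc i" for T
    using koszul_hom[OF p(1) F.koszul_module_axioms P.koszul_module_axioms, of w r T, OF w(1)] w(2)[OF that] s(2) c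
    by simp
  then show "\<exists>w. (\<forall>U. w U \<in> carrier P) \<and> (\<forall>T\<subseteq>{..<r}. card T = Suc i \<longrightarrow> P.kz r w T = c T)"
    using w(1) mod_homD(1)[OF p(1)] by (intro exI[of _ "\<lambda>U. p (w U)"]) auto
qed

lemma koszul_exact_zero:
  assumes q: "\<And>i. q i \<in> carrier R" and M: "module R M" and z: "carrier M = {\<zero>\<^bsub>M\<^esub>}"
  shows "koszul_exact R q M r i"
proof -
  interpret koszul_module R M q by (rule koszul_moduleI[OF M q])
  show ?thesis unfolding koszul_exact_def
  proof (intro allI impI exI[of _ "\<lambda>_. \<zero>\<^bsub>M\<^esub>"], elim conjE)
    fix c :: "nat set \<Rightarrow> _" assume "\<forall>U. c U \<in> carrier M"
    then have "c T = \<zero>\<^bsub>M\<^esub>" for T using z by blast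
    then show "(\<forall>U :: nat set. \<zero>\<^bsub>M\<^esub> \<in> carrier M) \<and> (\<forall>T\<subseteq>{..<r}. card T = i \<longrightarrow> kz r (\<lambda>_. \<zero>\<^bsub>M\<^esub>) T = c T)"
      by (simp add: kz_zero)
  qed
qed

text \<open>Dimension shifting along the syzygies \<open>N i\<close>. As \<open>N l\<close> is zero,
  it is exact in all degrees, degree zero included. Each step back to a lower index, and finally to
  \<open>M\<close>, raises by one the degree from which exactness is known.\<close>

theorem koszul_exact_resolution:
  fixes P :: "nat \<Rightarrow> ('a, 'c) module" and M :: "('a, 'm) module"
  assumes q: "\<And>i. q i \<in> carrier R" and ex: "\<And>i. koszul_exact R q (self_module R) r (Suc i)"
    and M: "module R M" and res: "projective_resolution R M P d e"
    and l: "\<And>i. i > l \<Longrightarrow> carrier (P i) = {\<zero>\<^bsub>P i\<^esub>}" and j: "j > l"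
  shows "koszul_exact R q M r j"
proof -
  have proj: "projective_module R (P i)" and d: "d i \<in> mod_hom R (P (Suc i)) (P i)"
    and ki: "a_kernel (P (Suc i)) (P i) (d i) = d (Suc i) ` carrier (P (Suc (Suc i)))" for i
    using res by (simp_all add: projective_resolution_def)
  have mP: "module R (P i)" for i using proj by (simp add: projective_module_def)
  have e: "e \<in> mod_hom R (P 0) M" "e ` carrier (P 0) = carrier M"
    and k0: "a_kernel (P 0) M e = d 0 ` carrier (P 1)"
    using res by (simp_all add: projective_resolution_def)
  define N where "N = (\<lambda>i. case i of 0 \<Rightarrow> ker_module (P 0) M e | Suc i \<Rightarrow> ker_module (P (Suc i)) (P i) (d i))"
  have N: "module R (N i)" for i
    by (cases i) (auto simp: N_def intro!: ker_module_is_module e d mP M)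
  have Nc: "carrier (N i) = d i ` carrier (P (Suc i))" for i
    using k0 ki by (cases i) (auto simp: N_def a_kernel_def')
  have Nop: "(\<oplus>\<^bsub>N i\<^esub>) = (\<oplus>\<^bsub>P i\<^esub>)" "\<zero>\<^bsub>N i\<^esub> = \<zero>\<^bsub>P i\<^esub>" "(\<odot>\<^bsub>N i\<^esub>) = (\<odot>\<^bsub>P i\<^esub>)" for i
    by (cases i; simp add: N_def)+
  have sN: "short_exact R (N (Suc i)) (P (Suc i)) (N i) (\<lambda>x. x) (d i)" for i
  proof (rule short_exactI)
    show "(\<lambda>x. x) \<in> mod_hom R (N (Suc i)) (P (Suc i))" by (rule mod_homI) (auto simp: N_def)
    show "d i \<in> mod_hom R (P (Suc i)) (N i)"
      by (rule mod_homI) (use mod_homD[OF d[of i]] in \<open>auto simp: Nc Nop\<close>)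
    show "\<exists>y\<in>carrier (P (Suc i)). d i y = z" if "z \<in> carrier (N i)" for z using that by (auto simp: Nc)
    show "d i x = \<zero>\<^bsub>N i\<^esub>" if "x \<in> carrier (N (Suc i))" for x using that by (simp add: Nop) (simp add: N_def)
    show "\<exists>x\<in>carrier (N (Suc i)). y = x" if "y \<in> carrier (P (Suc i))" "d i y = \<zero>\<^bsub>N i\<^esub>" for y
      using that by (simp add: Nop) (simp add: N_def)
  qed (auto intro: N mP)
  have sM: "short_exact R (N 0) (P 0) M (\<lambda>x. x) e"
  proof (rule short_exactI)
    show "\<exists>y\<in>carrier (P 0). e y = z" if "z \<in> carrier M" for z using that e(2) by (metis imageE)
  qed (use N[of 0] mP M e in \<open>auto simp: N_def intro!: mod_homI\<close>)
  have "koszul_exact R q (N i) r j" if "j + i \<ge> l" "i \<le> l" for i j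
    using that(2,1)
  proof (induction arbitrary: j rule: inc_induct)
    case base
    interpret P: module R "P (Suc l)" by (rule mP)
    have "carrier (N l) = {\<zero>\<^bsub>N l\<^esub>}"
      using l[of "Suc l"] mod_hom_zero[OF d mP mP, of l] by (simp add: Nc Nop)
    then show ?case by (rule koszul_exact_zero[OF q N])
  next
    case (step i)
    then obtain j' where j': "j = Suc j'" by (cases j) auto
    show ?case unfolding j'
      by (rule koszul_exact_quotient[OF sN q step.IH koszul_exact_projective[OF q ex proj]])
        (use step.prems j' in auto)
  qed
  moreover obtain j' where j': "j = Suc j'" using j by (cases j) auto
  ultimately have "koszul_exact R q (N 0) r j'" using j by simp
  then show ?thesis unfolding j'
    by (rule koszul_exact_quotient[OF sM q _ koszul_exact_projective[OF q ex proj]])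
qed

end

lemma a_inv_self_module [simp]: "\<ominus>\<^bsub>self_module R\<^esub> x = \<ominus>\<^bsub>R\<^esub> x"
  by (simp add: a_inv_def m_inv_def self_module_def)

lemma a_minus_self_module [simp]: "x \<ominus>\<^bsub>self_module R\<^esub> y = x \<ominus>\<^bsub>R\<^esub> y"
  by (simp add: a_minus_def)

section \<open>Cyclic modules and the colon sequence\<close>

context cring
begin

lemma carrier_quotient_module:
  assumes "ideal J R"
  shows "carrier (quotient_module R J) = (\<lambda>r. J +> r) ` carrier R"
  by (auto simp: quotient_module_simps A_RCOSETS_defs a_r_coset_def r_coset_def)

lemma quotient_hom:
  assumes "ideal J R"
  shows "(\<lambda>r. J +> r) \<in> mod_hom R (self_module R) (quotient_module R J)"
proof -
  interpret J: ideal J R by fact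
  show ?thesis
    by (rule mod_homI)
      (auto simp: carrier_quotient_module[OF assms] quotient_module_simps(2-) J.a_rcos_sum J.rcoset_mult_add)
qed

lemma coset_eq_iff:
  assumes "ideal J R" "r \<in> carrier R" "s \<in> carrier R"
  shows "J +> r = J +> s \<longleftrightarrow> r \<ominus> s \<in> J"
  using quotient_eq_iff_same_a_r_cos[OF assms] by simp

lemma coset_eq_zero_iff:
  assumes "ideal J R" "r \<in> carrier R"
  shows "J +> r = \<zero>\<^bsub>quotient_module R J\<^esub> \<longleftrightarrow> r \<in> J"
proof -
  have "J +> \<zero> = \<zero>\<^bsub>quotient_module R J\<^esub>"
    using mod_hom_zero[OF quotient_hom[OF assms(1)] self_module_is_module quotient_module_is_module[OF assms(1)]] by simp
  then show ?thesis using coset_eq_iff[OF assms zero_closed] assms(2) by (simp add: minus_eq)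
qed

lemma quotient_hom_obtain:
  assumes J: "ideal J R" and N: "module R N" and f: "f \<in> mod_hom R (self_module R) N"
    and z: "\<And>r. r \<in> J \<Longrightarrow> f r = \<zero>\<^bsub>N\<^esub>"
  obtains g where "g \<in> mod_hom R (quotient_module R J) N" "\<And>r. r \<in> carrier R \<Longrightarrow> g (J +> r) = f r"
proof -
  interpret J: ideal J R by fact
  interpret N: module R N by fact
  note fh = mod_homD[OF f, simplified] and \<pi>h = mod_homD[OF quotient_hom[OF J], simplified]
  define g where "g = (\<lambda>x. f (SOME r. r \<in> carrier R \<and> x = J +> r))"
  have g: "g (J +> r) = f r" if r: "r \<in> carrier R" for r
  proof -
    let ?s = "SOME s. s \<in> carrier R \<and> J +> r = J +> s"
    have s: "?s \<in> carrier R \<and> J +> r = J +> ?s" by (rule someI[of _ r]) (use r in auto)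
    then have "?s \<ominus> r \<in> J" using coset_eq_iff[OF J, of ?s r] r by auto
    then have "f (?s \<ominus> r) = \<zero>\<^bsub>N\<^esub>" by (rule z)
    then have "f ?s \<ominus>\<^bsub>N\<^esub> f r = \<zero>\<^bsub>N\<^esub>"
      using mod_hom_minus(1)[OF f self_module_is_module N, of ?s r] s r by simp
    moreover have "f ?s = (f ?s \<ominus>\<^bsub>N\<^esub> f r) \<oplus>\<^bsub>N\<^esub> f r"
      using s r fh(1) by (simp add: N.minus_eq N.a_assoc N.l_neg)
    ultimately have "f ?s = f r" using r fh(1) by simp
    then show ?thesis by (simp only: g_def)
  qed
  have "g \<in> mod_hom R (quotient_module R J) N"
  proof (rule mod_homI)
    show "g x \<in> carrier N" if "x \<in> carrier (quotient_module R J)" for x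
      using that fh(1) by (auto simp: carrier_quotient_module[OF J] g)
    show "g (x \<oplus>\<^bsub>quotient_module R J\<^esub> y) = g x \<oplus>\<^bsub>N\<^esub> g y"
      if "x \<in> carrier (quotient_module R J)" "y \<in> carrier (quotient_module R J)" for x y
      using that fh(2) by (auto simp: carrier_quotient_module[OF J] g \<pi>h(2)[symmetric])
    show "g (r \<odot>\<^bsub>quotient_module R J\<^esub> x) = r \<odot>\<^bsub>N\<^esub> g x"
      if "r \<in> carrier R" "x \<in> carrier (quotient_module R J)" for r x
      using that fh(3) by (auto simp: carrier_quotient_module[OF J] g \<pi>h(3)[symmetric])
  qed
  then show thesis using g by (rule that)
qed

text \<open>Here \<open>I\<close> is the ideal quotient of \<open>J\<close> by \<open>f\<close>, and
  \<open>K\<close> is the sum of \<open>J\<close> and the principal ideal of \<open>f\<close>. Both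
  are described by membership conditions, so that monomial ideals can be inserted directly. The map
  \<alpha> is multiplication by \<open>f\<close>, and \<beta> is the projection.\<close>

lemma short_exact_colon:
  assumes I: "ideal I R" and J: "ideal J R" and K: "ideal K R" and f: "f \<in> carrier R"
    and IJ: "\<And>r. r \<in> carrier R \<Longrightarrow> r \<in> I \<longleftrightarrow> f \<otimes> r \<in> J"
    and KJ: "\<And>r. r \<in> carrier R \<Longrightarrow> r \<in> K \<longleftrightarrow> (\<exists>s\<in>carrier R. r \<ominus> f \<otimes> s \<in> J)"
  shows "\<exists>\<alpha> \<beta>. short_exact R (quotient_module R I) (quotient_module R J) (quotient_module R K) \<alpha> \<beta>"
proof -
  interpret I: ideal I R by fact
  interpret J: ideal J R by fact
  interpret K: ideal K R by fact
  note mQ = quotient_module_is_module and cQ = carrier_quotient_module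
  have mulf: "(\<lambda>r. f \<otimes> r) \<in> mod_hom R (self_module R) (self_module R)"
    by (rule mod_homI) (auto simp: f r_distr m_lcomm)
  have fI: "J +> f \<otimes> r = \<zero>\<^bsub>quotient_module R J\<^esub>" if "r \<in> I" for r
    using coset_eq_zero_iff[OF J, of "f \<otimes> r"] IJ[OF I.a_Hcarr[OF that]] f I.a_Hcarr[OF that] that by simp
  obtain \<alpha> where \<alpha>: "\<alpha> \<in> mod_hom R (quotient_module R I) (quotient_module R J)"
    "\<And>r. r \<in> carrier R \<Longrightarrow> \<alpha> (I +> r) = J +> f \<otimes> r"
    by (rule quotient_hom_obtain[OF I mQ[OF J] mod_hom_compose[OF mulf quotient_hom[OF J]] fI]) (assumption, rule that)
  have JK: "r \<in> K" if "r \<in> J" for r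
    using KJ[of r] that f J.a_Hcarr by (auto intro!: bexI[of _ \<zero>] simp: minus_eq)
  have KJ0: "K +> r = \<zero>\<^bsub>quotient_module R K\<^esub>" if "r \<in> J" for r
    using coset_eq_zero_iff[OF K, of r] JK that J.a_Hcarr[OF that] by simp
  obtain \<beta> where \<beta>: "\<beta> \<in> mod_hom R (quotient_module R J) (quotient_module R K)"
    "\<And>r. r \<in> carrier R \<Longrightarrow> \<beta> (J +> r) = K +> r"
    by (rule quotient_hom_obtain[OF J mQ[OF K] quotient_hom[OF K] KJ0]) (assumption, rule that)
  have "short_exact R (quotient_module R I) (quotient_module R J) (quotient_module R K) \<alpha> \<beta>"
  proof (rule short_exactI)
    show "inj_on \<alpha> (carrier (quotient_module R I))"
    proof (rule inj_onI)
      fix x y assume xy: "x \<in> carrier (quotient_module R I)" "y \<in> carrier (quotient_module R I)" "\<alpha> x = \<alpha> y"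
      then obtain r s where rs: "r \<in> carrier R" "x = I +> r" "s \<in> carrier R" "y = I +> s" by (auto simp: cQ[OF I])
      then have "f \<otimes> r \<ominus> f \<otimes> s \<in> J" using xy(3) f \<alpha>(2) coset_eq_iff[OF J, of "f \<otimes> r" "f \<otimes> s"] by simp
      then have "f \<otimes> (r \<ominus> s) \<in> J" using rs f by (simp add: minus_eq r_distr r_minus)
      then show "x = y" using IJ[of "r \<ominus> s"] rs coset_eq_iff[OF I] by simp
    qed
    show "\<exists>y\<in>carrier (quotient_module R J). \<beta> y = z" if "z \<in> carrier (quotient_module R K)" for z
      using that \<beta>(2) by (auto simp: cQ[OF K] cQ[OF J])
    show "\<beta> (\<alpha> x) = \<zero>\<^bsub>quotient_module R K\<^esub>" if x: "x \<in> carrier (quotient_module R I)" for x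
    proof -
      obtain r where r: "r \<in> carrier R" "x = I +> r" using x by (auto simp: cQ[OF I])
      have "f \<otimes> r \<in> K"
        using KJ[of "f \<otimes> r"] r f J.zero_closed by (auto intro!: bexI[of _ r] simp: minus_eq r_neg)
      then show ?thesis using r f \<alpha>(2) \<beta>(2) coset_eq_zero_iff[OF K] by simp
    qed
    show "\<exists>x\<in>carrier (quotient_module R I). y = \<alpha> x"
      if y: "y \<in> carrier (quotient_module R J)" "\<beta> y = \<zero>\<^bsub>quotient_module R K\<^esub>" for y
    proof -
      obtain r where r: "r \<in> carrier R" "y = J +> r" using y by (auto simp: cQ[OF J])
      then have "r \<in> K" using y \<beta>(2) coset_eq_zero_iff[OF K] by simp
      then obtain s where s: "s \<in> carrier R" "r \<ominus> f \<otimes> s \<in> J" using KJ r by auto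
      then have "y = \<alpha> (I +> s)" using r f \<alpha>(2) coset_eq_iff[OF J, of r "f \<otimes> s"] by simp
      then show ?thesis using s by (auto simp: cQ[OF I])
    qed
  qed (auto intro: mQ I J K \<alpha> \<beta>)
  then show ?thesis by blast
qed

lemma free_res_quotient_zero:
  assumes J: "ideal J R" and z: "J = {\<zero>}"
  shows "free_res R 1 (quotient_module R J)"
proof -
  let ?Q = "quotient_module R J"
  have mQ: "module R ?Q" by (rule quotient_module_is_module[OF J])
  interpret F: module R "fin_free R 1" by (rule free_module_is_module)
  have ev: "(\<lambda>v. v 0) \<in> mod_hom R (fin_free R 1) (self_module R)"
    by (rule mod_homI) (auto simp: free_module_def)
  note f = mod_hom_compose[OF ev quotient_hom[OF J]]
  have "cover R 1 ?Q (\<lambda>v. J +> v 0)"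
    unfolding cover_def
  proof (intro conjI f equalityI subsetI)
    fix x assume "x \<in> carrier ?Q"
    then obtain r where r: "r \<in> carrier R" "x = J +> r" by (auto simp: carrier_quotient_module[OF J])
    let ?v = "\<lambda>x :: nat. if x = 0 then r else \<zero>"
    have "?v \<in> carrier (fin_free R 1)"
      using r by (auto simp: free_module_def intro: finite_subset[of _ "{0}"])
    then show "x \<in> (\<lambda>v. J +> v 0) ` carrier (fin_free R 1)"
      by (rule rev_image_eqI) (simp add: r)
  qed (use mod_homD(1)[OF f] in auto)
  moreover have "carrier (ker_module (fin_free R 1) ?Q (\<lambda>v. J +> v 0)) = {\<zero>\<^bsub>fin_free R 1\<^esub>}"
  proof -
    have "v = \<zero>\<^bsub>fin_free R 1\<^esub>" if v: "v \<in> carrier (fin_free R 1)" "J +> v 0 = \<zero>\<^bsub>?Q\<^esub>" for v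
    proof -
      have "v 0 \<in> carrier R" using v by (simp add: free_module_def)
      then have "v 0 = \<zero>" using v(2) coset_eq_zero_iff[OF J] z by auto
      moreover have "v x = \<zero>" if "x \<noteq> 0" for x using v(1) that by (simp add: free_module_def)
      ultimately have "v x = \<zero>" for x by metis
      then show ?thesis by (simp add: free_module_def fun_eq_iff)
    qed
    moreover have "J +> \<zero>\<^bsub>fin_free R 1\<^esub> 0 = \<zero>\<^bsub>?Q\<^esub>"
      by (rule mod_hom_zero[OF f F.module_axioms mQ])
    ultimately show ?thesis using F.zero_closed unfolding ker_module_simps by blast
  qed
  ultimately have "\<exists>k f. cover R k ?Q f \<and> free_res R 0 (ker_module (fin_free R k) ?Q f)"
    unfolding free_res_0 ker_module_simps(3) by blast
  then show ?thesis by (simp add: free_res_Suc)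
qed

lemma free_res_quotient_carrier: "free_res R 0 (quotient_module R (carrier R))"
proof -
  have J: "ideal (carrier R) R" by (rule oneideal)
  have "J +> r = \<zero>\<^bsub>quotient_module R J\<^esub>" if "J = carrier R" "r \<in> carrier R" for r J
    using coset_eq_zero_iff[of J r] J that by simp
  then show ?thesis using zero_closed by (auto simp: free_res_0 carrier_quotient_module[OF J])
qed

text \<open>The chain \<open>z\<close> over the ring becomes a cycle modulo \<open>J\<close>, and
  \<open>nb\<close> says that it does not become a boundary. So the Koszul homology of the quotient
  is nonzero in degree \<open>i\<close>, which contradicts a projective resolution of length below
  \<open>i\<close>.\<close>

theorem projective_dimension_ge:
  assumes J: "ideal J R" and q: "\<And>i. q i \<in> carrier R"
    and ex: "\<And>i. koszul_exact R q (self_module R) r (Suc i)"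
    and z: "\<And>U. z U \<in> carrier R"
    and cyc: "\<And>T. T \<subseteq> {..<r} \<Longrightarrow> Suc (card T) = i \<Longrightarrow> koszul R q (self_module R) r z T \<in> J"
    and nb: "\<And>w. (\<And>U. w U \<in> carrier R) \<Longrightarrow>
      \<exists>T\<subseteq>{..<r}. card T = i \<and> z T \<ominus> koszul R q (self_module R) r w T \<notin> J"
  shows "enat i \<le> projective_dimension R (quotient_module R J)"
proof -
  let ?Q = "quotient_module R J"
  have mQ: "module R ?Q" by (rule quotient_module_is_module[OF J])
  interpret S: koszul_module R "self_module R" q by (rule koszul_moduleI[OF self_module_is_module q])
  interpret Q: koszul_module R ?Q q by (rule koszul_moduleI[OF mQ q])
  have k\<pi>: "J +> S.kz r c T = Q.kz r (\<lambda>U. J +> c U) T" if "\<And>U. c U \<in> carrier R" for c T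
    by (rule koszul_hom[OF quotient_hom[OF J] S.koszul_module_axioms Q.koszul_module_axioms]) (simp add: that)
  have cQ: "J +> a \<in> carrier ?Q" if "a \<in> carrier R" for a
    using that by (simp add: carrier_quotient_module[OF J])
  have notex: "\<not> koszul_exact R q ?Q r i"
  proof
    assume ex: "koszul_exact R q ?Q r i"
    have "Q.kz r (\<lambda>U. J +> z U) T = \<zero>\<^bsub>?Q\<^esub>" if "T \<subseteq> {..<r}" "Suc (card T) = i" for T
      using cyc[OF that] k\<pi>[of z T, OF z] coset_eq_zero_iff[OF J, of "S.kz r z T"] S.kz_closed[of z r T] z by simp
    from koszul_exactE[of R q ?Q r i "\<lambda>U. J +> z U", OF ex cQ[OF z] this] obtain w where
      w: "\<And>U. w U \<in> carrier ?Q" "\<And>T. T \<subseteq> {..<r} \<Longrightarrow> card T = i \<Longrightarrow> Q.kz r w T = J +> z T" by metis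
    have "\<forall>U. \<exists>a\<in>carrier R. w U = J +> a" using w(1) by (auto simp: carrier_quotient_module[OF J])
    then obtain w' where w': "\<And>U. w' U \<in> carrier R" "\<And>U. w U = J +> w' U" by metis
    have wfun: "w = (\<lambda>U. J +> w' U)" by (rule ext) (rule w'(2))
    have "z T \<ominus> S.kz r w' T \<in> J" if "T \<subseteq> {..<r}" "card T = i" for T
      using w(2)[OF that] k\<pi>[of w' T, OF w'(1)] coset_eq_iff[OF J z[of T], of "S.kz r w' T"] S.kz_closed[of w' r T] w'(1)
      by (simp add: wfun)
    with nb[of w', OF w'(1)] show False by blast
  qed
  show ?thesis unfolding projective_dimension_def
  proof (rule Inf_greatest)
    fix x assume "x \<in> {enat l |l. \<exists>(P :: nat \<Rightarrow> ('a, (nat \<Rightarrow> 'a) \<times> 'a set) module) d e.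
      projective_resolution R ?Q P d e \<and> (\<forall>i>l. carrier (P i) = {\<zero>\<^bsub>P i\<^esub>})}"
    then have "\<exists>l. x = enat l \<and> (\<exists>(P :: nat \<Rightarrow> ('a, (nat \<Rightarrow> 'a) \<times> 'a set) module) d e.
      projective_resolution R ?Q P d e \<and> (\<forall>i>l. carrier (P i) = {\<zero>\<^bsub>P i\<^esub>}))"
      by (simp only: mem_Collect_eq)
    then obtain l d e and P :: "nat \<Rightarrow> ('a, (nat \<Rightarrow> 'a) \<times> 'a set) module"
      where l: "x = enat l" "projective_resolution R ?Q P d e" "\<forall>i>l. carrier (P i) = {\<zero>\<^bsub>P i\<^esub>}"
      by (elim exE conjE)
    have "\<not> l < i"
    proof
      assume "l < i"
      have "koszul_exact R q ?Q r i"
        using koszul_exact_resolution[OF q ex mQ l(2) _ \<open>l < i\<close>] l(3) by simp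
      with notex show False by blast
    qed
    then show "enat i \<le> x" by (simp add: l)
  qed
qed

end

section \<open>Joins of boundaries of simplices as Koszul cycles\<close>

definition join_simplex :: "('a, 'r) ring_scheme \<Rightarrow> nat \<Rightarrow> nat \<Rightarrow> (nat set \<Rightarrow> 'a) \<Rightarrow> nat set \<Rightarrow> 'a"
  where "join_simplex R a b c U = (if {a..<b} \<subseteq> U then c (U - {a..<b}) else \<zero>\<^bsub>R\<^esub>)"

text \<open>The iterated join of the boundaries of the simplices on the blocks \<open>{s k..<s (k + 1)}\<close>, \<open>k < c\<close>.\<close>

primrec sphere :: "('a, 'r) ring_scheme \<Rightarrow> (nat \<Rightarrow> 'a) \<Rightarrow> (nat \<Rightarrow> nat) \<Rightarrow> nat \<Rightarrow> nat set \<Rightarrow> 'a"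
  where
    "sphere R q s 0 T = (if T = {} then \<one>\<^bsub>R\<^esub> else \<zero>\<^bsub>R\<^esub>)"
  | "sphere R q s (Suc c) T = koszul R q (self_module R) (s (Suc c)) (join_simplex R (s c) (s (Suc c)) (sphere R q s c)) T"

definition misses_one :: "nat set \<Rightarrow> nat set \<Rightarrow> bool"
  where "misses_one T B \<longleftrightarrow> (\<exists>i\<in>B. T \<inter> B = B - {i})"

context cring
begin

text \<open>\<open>join_simplex\<close> is the wedge product of \<open>c\<close> with all basis
  elements of the block \<open>{a..<b}\<close>. Since \<open>c\<close> is a cycle, the Leibniz rule
  leaves only the boundary of the block: one term for each deleted \<open>i\<close>, with
  coefficient \<open>q i\<close> and a sign. A set that contains the whole block receives only the
  boundary of \<open>c\<close>, and a set that misses two or more of its elements receives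
  nothing.\<close>

lemma koszul_join_simplex:
  assumes q: "\<And>i. q i \<in> carrier R" and c: "\<And>U. c U \<in> carrier R"
    and cyc: "\<And>T. T \<subseteq> {..<a} \<Longrightarrow> koszul R q (self_module R) a c T = \<zero>"
    and "a \<le> b" and "T \<subseteq> {..<b}"
  shows "i \<in> {a..<b} \<Longrightarrow> T \<inter> {a..<b} = {a..<b} - {i} \<Longrightarrow>
      koszul R q (self_module R) b (join_simplex R a b c) T
        \<in> {q i \<otimes> c (T \<inter> {..<a}), \<ominus> (q i \<otimes> c (T \<inter> {..<a}))}" (is "_ \<Longrightarrow> _ \<Longrightarrow> ?P b T i")
    and "\<not> misses_one T {a..<b} \<Longrightarrow> koszul R q (self_module R) b (join_simplex R a b c) T = \<zero>"
      (is "_ \<Longrightarrow> ?Q b T")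
proof -
  interpret S: koszul_module R "self_module R" q by (rule koszul_moduleI[OF self_module_is_module q])
  let ?A = "\<lambda>b. join_simplex R a b c"
  have "(\<forall>i. i \<in> {a..<b} \<longrightarrow> T \<inter> {a..<b} = {a..<b} - {i} \<longrightarrow> ?P b T i) \<and> (\<not> misses_one T {a..<b} \<longrightarrow> ?Q b T)"
    using assms(4,5)
  proof (induction b arbitrary: T rule: dec_induct)
    case base
    have "?A a = c" by (auto simp: join_simplex_def)
    then show ?case using cyc base by simp
  next
    case (step b)
    have ab: "{a..<Suc b} = insert b {a..<b}" using step.hyps by auto
    show ?case
    proof (cases "b \<in> T")
      case True
      let ?T = "T - {b}"
      have T': "?T \<subseteq> {..<b}" using step.prems by (auto simp: less_Suc_eq)
      have "S.kz b (\<lambda>U. ?A (Suc b) (insert b U)) ?T = S.kz b (?A b) ?T"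
      proof (rule koszul_cong)
        fix i assume i: "i < b" "i \<notin> ?T"
        let ?U = "insert i ?T"
        have "insert b ?U - {a..<Suc b} = ?U - {a..<b}" using i step.hyps by auto
        moreover have "{a..<Suc b} \<subseteq> insert b ?U \<longleftrightarrow> {a..<b} \<subseteq> ?U" using i unfolding ab by auto
        ultimately show "?A (Suc b) (insert b ?U) = ?A b ?U" by (simp add: join_simplex_def)
      qed
      then have eq: "S.kz (Suc b) (?A (Suc b)) T = \<ominus> S.kz b (?A b) ?T" using True by simp
      have TT: "?T \<inter> {..<a} = T \<inter> {..<a}" using step.hyps by auto
      have mo: "T \<inter> {a..<Suc b} = {a..<Suc b} - {i} \<longleftrightarrow> ?T \<inter> {a..<b} = {a..<b} - {i}" if "i \<in> {a..<b}" for i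
      proof -
        have e1: "T \<inter> {a..<Suc b} = insert b (?T \<inter> {a..<b})" using True unfolding ab by auto
        have e2: "{a..<Suc b} - {i} = insert b ({a..<b} - {i})" using that unfolding ab by auto
        show ?thesis unfolding e1 e2 by (rule insert_ident) auto
      qed
      have nb: "T \<inter> {a..<Suc b} \<noteq> {a..<Suc b} - {b}"
      proof -
        have "b \<in> {a..<Suc b}" using step.hyps by simp
        with True show ?thesis by blast
      qed
      note IH = step.IH[OF T']
      show ?thesis
      proof (intro conjI allI impI)
        fix i assume i: "i \<in> {a..<Suc b}" "T \<inter> {a..<Suc b} = {a..<Suc b} - {i}"
        with nb have "i \<noteq> b" by blast
        then have i': "i \<in> {a..<b}" using i(1) by auto
        have "?T \<inter> {a..<b} = {a..<b} - {i}" using mo[OF i'] i(2) by (rule iffD1)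
        with IH i' have "S.kz b (?A b) ?T \<in> {q i \<otimes> c (T \<inter> {..<a}), \<ominus> (q i \<otimes> c (T \<inter> {..<a}))}"
          unfolding TT by (elim conjE) (drule spec[of _ i], drule mp, assumption, drule mp, assumption)
        then show "?P (Suc b) T i" unfolding eq using q[of i] c[of "T \<inter> {..<a}"] by (elim insertE) simp_all
      next
        assume "\<not> misses_one T {a..<Suc b}"
        then have "\<not> misses_one ?T {a..<b}"
          unfolding misses_one_def using mo by (metis ab insertI2)
        then have "S.kz b (?A b) ?T = \<zero>" using IH by blast
        then show "?Q (Suc b) T" unfolding eq by simp
      qed
    next
      case False
      then have T': "T \<subseteq> {..<b}" using step.prems by (auto simp: less_Suc_eq)
      \<comment> \<open>No set that arises here contains \<open>b\<close>, so none contains the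
        whole block; only the term that adds \<open>b\<close> itself survives.\<close>
      have "S.kz b (?A (Suc b)) T = S.kz b (\<lambda>U. \<zero>) T"
        by (rule koszul_cong) (use False step.hyps in \<open>auto simp: join_simplex_def\<close>)
      also have "\<dots> = \<zero>" using S.kz_zero by simp
      finally have eq: "S.kz (Suc b) (?A (Suc b)) T = q b \<otimes> ?A (Suc b) (insert b T)"
        using False q c by (simp add: join_simplex_def)
      have sub: "{a..<Suc b} \<subseteq> insert b T \<longleftrightarrow> {a..<b} \<subseteq> T" unfolding ab by auto
      have only: "i = b" if "i \<in> {a..<Suc b}" "T \<inter> {a..<Suc b} = {a..<Suc b} - {i}" for i
      proof (rule ccontr)
        assume "i \<noteq> b"
        then have "b \<in> {a..<Suc b} - {i}" using step.hyps by simp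
        with that(2) False show False by blast
      qed
      show ?thesis
      proof (intro conjI allI impI)
        fix i assume i: "i \<in> {a..<Suc b}" "T \<inter> {a..<Suc b} = {a..<Suc b} - {i}"
        from only[OF this] have [simp]: "i = b" .
        have "{a..<b} \<subseteq> T"
        proof
          fix x assume "x \<in> {a..<b}"
          then have "x \<in> {a..<Suc b} - {i}" by simp
          then show "x \<in> T" unfolding i(2)[symmetric] by simp
        qed
        moreover have "insert b T - {a..<Suc b} = T \<inter> {..<a}" using T' step.hyps by auto
        ultimately show "?P (Suc b) T i" unfolding eq by (simp add: join_simplex_def sub)
      next
        assume nm: "\<not> misses_one T {a..<Suc b}"
        have "\<not> {a..<b} \<subseteq> T"
        proof
          assume "{a..<b} \<subseteq> T"
          then have "T \<inter> {a..<Suc b} = {a..<Suc b} - {b}" using False unfolding ab by fast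
          moreover have "b \<in> {a..<Suc b}" using step.hyps by simp
          ultimately show False using nm unfolding misses_one_def by blast
        qed
        then show "?Q (Suc b) T" unfolding eq using q by (simp add: join_simplex_def sub)
      qed
    qed
  qed
  then show "i \<in> {a..<b} \<Longrightarrow> T \<inter> {a..<b} = {a..<b} - {i} \<Longrightarrow> ?P b T i" "\<not> misses_one T {a..<b} \<Longrightarrow> ?Q b T"
    by simp_all
qed

lemma sphere_closed:
  assumes q: "\<And>i. q i \<in> carrier R"
  shows "sphere R q s c T \<in> carrier R"
proof -
  interpret S: koszul_module R "self_module R" q by (rule koszul_moduleI[OF self_module_is_module q])
  show ?thesis
  proof (induction c arbitrary: T)
    case (Suc c)
    have "join_simplex R (s c) (s (Suc c)) (sphere R q s c) U \<in> carrier R" for U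
      by (simp add: join_simplex_def Suc)
    then show ?case using S.kz_closed by simp
  qed simp
qed

lemma koszul_sphere:
  assumes q: "\<And>i. q i \<in> carrier R" and "s 0 = 0"
  shows "koszul R q (self_module R) (s c) (sphere R q s c) T = \<zero>"
proof -
  interpret S: koszul_module R "self_module R" q by (rule koszul_moduleI[OF self_module_is_module q])
  show ?thesis
  proof (cases c)
    case (Suc c')
    have "sphere R q s c = S.kz (s c) (join_simplex R (s c') (s c) (sphere R q s c'))"
      by (simp add: Suc fun_eq_iff)
    then show ?thesis using S.kz_kz sphere_closed[OF q] by (simp add: join_simplex_def)
  qed (simp add: assms)
qed

text \<open>The sphere is the product of the boundaries of its blocks. A set in its support lacks
  one element of each block, and each lacking \<open>i\<close> contributes the factor
  \<open>q i\<close>. The sign stays open: later only membership in an ideal and nonvanishing of a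
  coefficient matter.\<close>

lemma sphere_eq:
  assumes q: "\<And>i. q i \<in> carrier R" and "s 0 = 0" and mono: "mono s" and "T \<subseteq> {..<s c}"
  shows "(\<And>k. k < c \<Longrightarrow> misses_one T {s k..<s (Suc k)}) \<Longrightarrow>
      sphere R q s c T \<in> {finprod R q ({..<s c} - T), \<ominus> finprod R q ({..<s c} - T)}"
    and "k < c \<Longrightarrow> \<not> misses_one T {s k..<s (Suc k)} \<Longrightarrow> sphere R q s c T = \<zero>"
proof -
  let ?p = "\<lambda>c T. finprod R q ({..<s c} - T)"
  let ?m = "\<lambda>T k. misses_one T {s k..<s (Suc k)}"
  have "((\<forall>k<c. ?m T k) \<longrightarrow> sphere R q s c T \<in> {?p c T, \<ominus> ?p c T}) \<and> (\<forall>k<c. \<not> ?m T k \<longrightarrow> sphere R q s c T = \<zero>)"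
    using assms(4)
  proof (induction c arbitrary: T)
    case 0
    then show ?case using assms(2) by simp
  next
    case (Suc c)
    have le: "s c \<le> s (Suc c)" using mono by (simp add: mono_def)
    let ?T = "T \<inter> {..<s c}" and ?B = "{s c..<s (Suc c)}"
    note J = koszul_join_simplex[where q = q and c = "sphere R q s c",
      OF q sphere_closed[where q = q, OF q] koszul_sphere[where q = q and s = s and c = c, OF q assms(2)] le Suc.prems]
    note IH = Suc.IH[of ?T]
    have mT: "?m ?T k = ?m T k" if "k < c" for k
    proof -
      have "s (Suc k) \<le> s c" using mono that by (auto simp: mono_def)
      then have "?T \<inter> {s k..<s (Suc k)} = T \<inter> {s k..<s (Suc k)}" by auto
      then show ?thesis by (simp add: misses_one_def)
    qed
    show ?case
    proof (intro conjI impI allI)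
      assume all: "\<forall>k<Suc c. ?m T k"
      then obtain i where i: "i \<in> ?B" "T \<inter> ?B = ?B - {i}" unfolding misses_one_def by blast
      have "sphere R q s c ?T \<in> {?p c ?T, \<ominus> ?p c ?T}" using IH all mT by auto
      moreover have "?p (Suc c) T = q i \<otimes> ?p c ?T"
      proof -
        have "{..<s (Suc c)} - T = ({..<s c} - ?T) \<union> (?B - T \<inter> ?B)" using le by auto
        also have "?B - T \<inter> ?B = {i}" unfolding i(2) using i(1) by blast
        finally have eq: "{..<s (Suc c)} - T = insert i ({..<s c} - ?T)" by simp
        have "i \<notin> {..<s c} - ?T" using i(1) by simp
        then show ?thesis unfolding eq using q by (intro finprod_insert) auto
      qed
      moreover have "?p c ?T \<in> carrier R" using q by (intro finprod_closed) auto
      ultimately show "sphere R q s (Suc c) T \<in> {?p (Suc c) T, \<ominus> ?p (Suc c) T}"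
        using J(1)[OF i] q[of i] by (elim insertE) (simp_all add: r_minus)
    next
      fix k assume k: "k < Suc c" "\<not> ?m T k"
      show "sphere R q s (Suc c) T = \<zero>"
      proof (cases "?m T c")
        case False
        then show ?thesis using J(2) by simp
      next
        case True
        then have "k < c" using k by (metis less_Suc_eq)
        then have "sphere R q s c ?T = \<zero>" using IH k mT by auto
        moreover obtain i where i: "i \<in> ?B" "T \<inter> ?B = ?B - {i}" using True unfolding misses_one_def by blast
        ultimately show ?thesis using J(1)[OF i] q by simp
      qed
    qed
  qed
  then show "(\<And>k. k < c \<Longrightarrow> ?m T k) \<Longrightarrow> sphere R q s c T \<in> {?p c T, \<ominus> ?p c T}"
    "k < c \<Longrightarrow> \<not> ?m T k \<Longrightarrow> sphere R q s c T = \<zero>" by blast+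
qed

end

section \<open>Monomial ideals\<close>

abbreviation "lookup \<equiv> Poly_Mapping.lookup"

abbreviation "keys \<equiv> Poly_Mapping.keys"

abbreviation "single \<equiv> Poly_Mapping.single"

abbreviation xmon :: "(nat \<Rightarrow>\<^sub>0 nat) \<Rightarrow> 'k::field mpoly"
  where "xmon \<mu> \<equiv> single \<mu> 1"

definition exponents :: "nat \<Rightarrow> (nat \<Rightarrow>\<^sub>0 nat) set"
  where "exponents n = {\<mu>. keys \<mu> \<subseteq> {1..n}}"

definition upclosed :: "(nat \<Rightarrow>\<^sub>0 nat) set \<Rightarrow> bool"
  where "upclosed U \<longleftrightarrow> (\<forall>\<mu>\<in>U. \<forall>\<nu>. \<mu> + \<nu> \<in> U)"

definition multiples :: "(nat \<Rightarrow>\<^sub>0 nat) \<Rightarrow> (nat \<Rightarrow>\<^sub>0 nat) set"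
  where "multiples \<mu> = range (\<lambda>\<nu>. \<mu> + \<nu>)"

text \<open>\<open>U\<close> consists of exponents in all variables and is cut down by the carrier
  only. The same \<open>U\<close> can thus be used with every number of variables, and
  \<open>UNIV\<close> stands for the unit ideal.\<close>

definition monomial_ideal :: "nat \<Rightarrow> (nat \<Rightarrow>\<^sub>0 nat) set \<Rightarrow> 'k::field mpoly set"
  where "monomial_ideal n U = {p \<in> carrier (mpoly_ring n). keys p \<subseteq> U}"

lemma poly_mapping_eq_sum_single:
  "p = (\<Sum>\<kappa>\<in>keys p. single \<kappa> (lookup p \<kappa>))"
  by (rule poly_mapping_eqI) (auto simp: lookup_sum lookup_single when_def sum.delta in_keys_iff)

lemma lookup_single_mult:
  fixes e \<mu> :: "nat \<Rightarrow>\<^sub>0 nat" and p :: "'k::field mpoly"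
  shows "lookup (single e a * p) (e + \<mu>) = a * lookup p \<mu>"
proof -
  have "single e a * p =
      (\<Sum>\<kappa>\<in>keys p. single (e + \<kappa>) (a * lookup p \<kappa>))"
    by (subst poly_mapping_eq_sum_single[of p]) (simp add: sum_distrib_left mult_single)
  then show ?thesis by (auto simp: lookup_sum lookup_single when_def sum.delta in_keys_iff)
qed

lemma keys_single_mult:
  fixes e :: "nat \<Rightarrow>\<^sub>0 nat" and p :: "'k::field mpoly"
  assumes "\<kappa> \<in> keys (single e a * p)"
  shows "\<exists>\<mu>\<in>keys p. \<kappa> = e + \<mu>"
  using keys_mult[of "single e a" p] assms by (auto split: if_splits)

lemma exponents_add_iff: "\<mu> + \<nu> \<in> exponents n \<longleftrightarrow> \<mu> \<in> exponents n \<and> \<nu> \<in> exponents n"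
proof -
  have "keys (\<mu> + \<nu>) = keys \<mu> \<union> keys \<nu>"
    by (auto simp: in_keys_iff lookup_add)
  then show ?thesis by (auto simp: exponents_def)
qed

lemma mpoly_ring_simps [simp]:
  "p \<otimes>\<^bsub>mpoly_ring n\<^esub> q = p * q" "p \<oplus>\<^bsub>mpoly_ring n\<^esub> q = p + q"
  "\<zero>\<^bsub>mpoly_ring n\<^esub> = 0" "\<one>\<^bsub>mpoly_ring n\<^esub> = 1"
  by (simp_all add: mpoly_ring_def)

lemma carrier_mpoly_ring: "p \<in> carrier (mpoly_ring n) \<longleftrightarrow> keys p \<subseteq> exponents n"
  by (auto simp: mpoly_ring_def exponents_def)

lemma single_in_carrier [intro]: "\<mu> \<in> exponents n \<Longrightarrow> single \<mu> a \<in> carrier (mpoly_ring n)"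
  by (simp add: carrier_mpoly_ring)

lemma mpoly_ring_closed:
  "p \<in> carrier (mpoly_ring n) \<Longrightarrow> q \<in> carrier (mpoly_ring n) \<Longrightarrow> p + q \<in> carrier (mpoly_ring n)"
  "p \<in> carrier (mpoly_ring n) \<Longrightarrow> q \<in> carrier (mpoly_ring n) \<Longrightarrow> p * q \<in> carrier (mpoly_ring n)"
proof -
  interpret cring "mpoly_ring n :: 'a mpoly ring" by (rule mpoly_ring_cring)
  show "p \<in> carrier (mpoly_ring n) \<Longrightarrow> q \<in> carrier (mpoly_ring n) \<Longrightarrow> p + q \<in> carrier (mpoly_ring n)"
    "p \<in> carrier (mpoly_ring n) \<Longrightarrow> q \<in> carrier (mpoly_ring n) \<Longrightarrow> p * q \<in> carrier (mpoly_ring n)"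
    using a_closed[of p q] m_closed[of p q] by simp_all
qed

lemma mpoly_ring_uminus:
  assumes "p \<in> carrier (mpoly_ring n :: 'k::field mpoly ring)"
  shows "-p \<in> carrier (mpoly_ring n)" "\<ominus>\<^bsub>mpoly_ring n\<^esub> p = -p"
proof -
  interpret cring "mpoly_ring n :: 'k mpoly ring" by (rule mpoly_ring_cring)
  show "-p \<in> carrier (mpoly_ring n)" using assms by (simp add: carrier_mpoly_ring)
  then show "\<ominus>\<^bsub>mpoly_ring n\<^esub> p = -p" using minus_equality[of "-p" p] assms by simp
qed

lemma mpoly_ring_minus:
  assumes "p \<in> carrier (mpoly_ring n :: 'k::field mpoly ring)" "q \<in> carrier (mpoly_ring n)"
  shows "p \<ominus>\<^bsub>mpoly_ring n\<^esub> q = p - q"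
  using mpoly_ring_uminus[OF assms(2)] by (simp add: a_minus_def)

lemma monomial_ideal_ideal:
  assumes U: "upclosed U"
  shows "ideal (monomial_ideal n U) (mpoly_ring n :: 'k::field mpoly ring)"
proof -
  interpret cring "mpoly_ring n :: 'k mpoly ring" by (rule mpoly_ring_cring)
  let ?I = "monomial_ideal n U :: 'k mpoly set"
  have mult: "p * q \<in> ?I" if "p \<in> ?I" "q \<in> carrier (mpoly_ring n)" for p q :: "'k mpoly"
    using keys_mult[of p q] that U mpoly_ring_closed(2)[of p n q] by (fastforce simp: monomial_ideal_def upclosed_def)
  show ?thesis
  proof (rule idealI[OF ring_axioms])
    show "subgroup ?I (add_monoid (mpoly_ring n))"
    proof (rule add.subgroupI)
      show "?I \<subseteq> carrier (mpoly_ring n)" by (auto simp: monomial_ideal_def)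
      show "?I \<noteq> {}" by (auto simp: monomial_ideal_def carrier_mpoly_ring intro!: exI[of _ 0])
      show "\<ominus>\<^bsub>mpoly_ring n\<^esub> p \<in> ?I" if "p \<in> ?I" for p
        using that mpoly_ring_uminus[of p n] by (simp add: monomial_ideal_def)
      show "p \<oplus>\<^bsub>mpoly_ring n\<^esub> q \<in> ?I" if "p \<in> ?I" "q \<in> ?I" for p q
        using that mpoly_ring_closed(1)[of p n q] Poly_Mapping.keys_add[of p q] by (auto simp: monomial_ideal_def)
    qed
    show "x \<otimes>\<^bsub>mpoly_ring n\<^esub> a \<in> ?I" "a \<otimes>\<^bsub>mpoly_ring n\<^esub> x \<in> ?I"
      if "a \<in> ?I" "x \<in> carrier (mpoly_ring n)" for a x
      using mult[OF that] by (simp_all add: mult.commute)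
  qed
qed

lemma ideal_sum_closed:
  assumes "ideal I (mpoly_ring n :: 'k::field mpoly ring)" "\<And>x. x \<in> A \<Longrightarrow> f x \<in> I"
  shows "sum f A \<in> I"
proof -
  interpret ideal I "mpoly_ring n :: 'k mpoly ring" by fact
  show ?thesis
    using assms(2) additive_subgroup.zero_closed[OF additive_subgroup_axioms]
      additive_subgroup.a_closed[OF additive_subgroup_axioms]
    by (induction A rule: infinite_finite_induct) auto
qed

lemma genideal_monomials:
  assumes G: "G \<subseteq> exponents n"
  shows "Idl\<^bsub>mpoly_ring n\<^esub> (xmon ` G) = (monomial_ideal n (\<Union>(multiples ` G)) :: 'k::field mpoly set)"
proof -
  interpret cring "mpoly_ring n :: 'k mpoly ring" by (rule mpoly_ring_cring)
  let ?U = "\<Union>(multiples ` G)" and ?M = "xmon ` G :: 'k mpoly set"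
  have U: "upclosed ?U" by (auto simp: upclosed_def multiples_def add.assoc)
  have M: "?M \<subseteq> carrier (mpoly_ring n)" using G by auto
  have "\<mu> \<in> ?U" if "\<mu> \<in> G" for \<mu>
    using that by (auto simp: multiples_def image_iff intro!: bexI[of _ \<mu>] exI[of _ 0])
  then have "?M \<subseteq> monomial_ideal n ?U" using M by (auto simp: monomial_ideal_def)
  then have 1: "Idl\<^bsub>mpoly_ring n\<^esub> ?M \<subseteq> monomial_ideal n ?U"
    by (rule genideal_minimal[OF monomial_ideal_ideal[OF U]])
  interpret J: ideal "Idl\<^bsub>mpoly_ring n\<^esub> ?M" "mpoly_ring n" by (rule genideal_ideal[OF M])
  have "p \<in> Idl\<^bsub>mpoly_ring n\<^esub> ?M" if p: "p \<in> monomial_ideal n ?U" for p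
  proof (subst poly_mapping_eq_sum_single[of p], rule ideal_sum_closed[OF J.ideal_axioms])
    fix \<kappa> assume \<kappa>: "\<kappa> \<in> keys p"
    then obtain \<mu> \<nu> where \<mu>: "\<mu> \<in> G" "\<kappa> = \<mu> + \<nu>" using p by (auto simp: monomial_ideal_def multiples_def)
    have "\<kappa> \<in> exponents n" using p \<kappa> by (auto simp: monomial_ideal_def carrier_mpoly_ring)
    then have "\<nu> \<in> exponents n" using \<mu> exponents_add_iff by simp
    then have c: "single \<nu> (lookup p \<kappa>) \<in> carrier (mpoly_ring n)" by auto
    have "xmon \<mu> \<in> Idl\<^bsub>mpoly_ring n\<^esub> ?M" using genideal_self[OF M] \<mu>(1) by auto
    from J.I_r_closed[OF this c] show "single \<kappa> (lookup p \<kappa>) \<in> Idl\<^bsub>mpoly_ring n\<^esub> ?M"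
      by (simp add: mult_single \<mu>(2))
  qed
  with 1 show ?thesis by auto
qed

lemma ideal_prod_monomial:
  assumes U: "upclosed U" and V: "upclosed V"
  shows "ideal_prod (mpoly_ring n) (monomial_ideal n U) (monomial_ideal n V) =
    (monomial_ideal n {\<mu> + \<nu> |\<mu> \<nu>. \<mu> \<in> U \<and> \<nu> \<in> V} :: 'k::field mpoly set)" (is "?P = monomial_ideal n ?W")
proof -
  interpret cring "mpoly_ring n :: 'k mpoly ring" by (rule mpoly_ring_cring)
  have W: "upclosed ?W" unfolding upclosed_def
  proof (intro ballI allI)
    fix \<mu> \<nu> assume "\<mu> \<in> ?W"
    then obtain a b where "\<mu> = a + b" "a \<in> U" "b \<in> V" by auto
    then show "\<mu> + \<nu> \<in> ?W" using V by (auto simp: upclosed_def add.assoc)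
  qed
  have iW: "ideal (monomial_ideal n ?W :: 'k mpoly set) (mpoly_ring n)" by (rule monomial_ideal_ideal[OF W])
  have iP: "ideal ?P (mpoly_ring n)"
    by (rule ideal_prod_is_ideal[OF monomial_ideal_ideal[OF U] monomial_ideal_ideal[OF V]])
  have "p \<in> monomial_ideal n ?W" if "p \<in> ?P" for p
    using that
  proof induction
    case (prod i j)
    then have "i * j \<in> carrier (mpoly_ring n)" by (intro mpoly_ring_closed) (auto simp: monomial_ideal_def)
    moreover have "keys (i * j) \<subseteq> ?W"
    proof
      fix \<kappa> assume "\<kappa> \<in> keys (i * j)"
      then obtain a b where "\<kappa> = a + b" "a \<in> keys i" "b \<in> keys j"
        using keys_mult[of i j] by blast
      then show "\<kappa> \<in> ?W" using prod unfolding monomial_ideal_def by blast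
    qed
    ultimately show ?case by (simp add: monomial_ideal_def)
  qed (rule additive_subgroup.a_closed[OF ideal.axioms(1)[OF iW]])
  moreover have "p \<in> ?P" if p: "p \<in> monomial_ideal n ?W" for p
  proof (subst poly_mapping_eq_sum_single[of p], rule ideal_sum_closed[OF iP])
    fix \<kappa> assume \<kappa>: "\<kappa> \<in> keys p"
    then obtain \<mu> \<nu> where \<mu>: "\<mu> \<in> U" "\<nu> \<in> V" "\<kappa> = \<mu> + \<nu>" using p by (auto simp: monomial_ideal_def)
    have "\<kappa> \<in> exponents n" using p \<kappa> by (auto simp: monomial_ideal_def carrier_mpoly_ring)
    then have "\<mu> \<in> exponents n" "\<nu> \<in> exponents n" using \<mu> exponents_add_iff by auto
    then have "single \<mu> (lookup p \<kappa>) \<in> monomial_ideal n U" "xmon \<nu> \<in> (monomial_ideal n V :: 'k mpoly set)"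
      using \<mu> by (auto simp: monomial_ideal_def carrier_mpoly_ring)
    from ideal_prod.prod[OF this, of "mpoly_ring n"]
    show "single \<kappa> (lookup p \<kappa>) \<in> ?P"
      by (simp add: mult_single \<mu>(3))
  qed
  ultimately show ?thesis by auto
qed

primrec exponent_power :: "(nat \<Rightarrow>\<^sub>0 nat) set \<Rightarrow> nat \<Rightarrow> (nat \<Rightarrow>\<^sub>0 nat) set"
  where
    "exponent_power U 0 = UNIV"
  | "exponent_power U (Suc t) = {\<mu> + \<nu> |\<mu> \<nu>. \<mu> \<in> exponent_power U t \<and> \<nu> \<in> U}"

lemma upclosed_exponent_power: "upclosed U \<Longrightarrow> upclosed (exponent_power U t)"
proof (induction t)
  case (Suc t)
  show ?case unfolding upclosed_def
  proof (intro ballI allI)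
    fix \<mu> \<nu> assume "\<mu> \<in> exponent_power U (Suc t)"
    then obtain a b where "\<mu> = a + b" "a \<in> exponent_power U t" "b \<in> U" by auto
    then show "\<mu> + \<nu> \<in> exponent_power U (Suc t)" using Suc.prems by (auto simp: upclosed_def add.assoc)
  qed
qed (simp add: upclosed_def)

lemma monomial_ideal_power:
  assumes U: "upclosed U"
  shows "monomial_ideal n U [^]\<^bsub>ideals_set (mpoly_ring n)\<^esub> t =
    (monomial_ideal n (exponent_power U t) :: 'k::field mpoly set)"
proof (induction t)
  case 0
  then show ?case by (simp add: nat_pow_def ideals_set_def monomial_ideal_def)
next
  case (Suc t)
  then show ?case
    using ideal_prod_monomial[OF upclosed_exponent_power[OF U] U, of n t]
    by (simp add: nat_pow_def ideals_set_def)
qed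

section \<open>Resolutions of quotients by monomial ideals\<close>

definition mon_res :: "'k::field itself \<Rightarrow> nat \<Rightarrow> nat \<Rightarrow> (nat \<Rightarrow>\<^sub>0 nat) set \<Rightarrow> bool"
  where "mon_res _ n l U \<longleftrightarrow>
    free_res (mpoly_ring n) l (quotient_module (mpoly_ring n) (monomial_ideal n U :: 'k mpoly set))"

lemma upclosed_colon: "upclosed U \<Longrightarrow> upclosed {\<nu>. \<mu> + \<nu> \<in> U}"
  by (simp add: upclosed_def add.assoc[symmetric])

lemma upclosed_multiples: "upclosed (multiples \<mu>)"
  by (auto simp: upclosed_def multiples_def add.assoc)

lemma upclosed_Un: "upclosed U \<Longrightarrow> upclosed V \<Longrightarrow> upclosed (U \<union> V)"
  by (auto simp: upclosed_def)

lemma short_exact_monomial_colon: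
  assumes U: "upclosed U" and \<mu>: "\<mu> \<in> exponents n"
  shows "\<exists>\<alpha> \<beta>. short_exact (mpoly_ring n)
    (quotient_module (mpoly_ring n) (monomial_ideal n {\<nu>. \<mu> + \<nu> \<in> U} :: 'k::field mpoly set))
    (quotient_module (mpoly_ring n) (monomial_ideal n U))
    (quotient_module (mpoly_ring n) (monomial_ideal n (U \<union> multiples \<mu>))) \<alpha> \<beta>"
proof -
  interpret cring "mpoly_ring n :: 'k mpoly ring" by (rule mpoly_ring_cring)
  have f: "(xmon \<mu> :: 'k mpoly) \<in> carrier (mpoly_ring n)" using \<mu> by auto
  show ?thesis
  proof (rule short_exact_colon[OF _ _ _ f])
    fix r :: "'k mpoly" assume r: "r \<in> carrier (mpoly_ring n)"
    have "keys (xmon \<mu> * r) = (\<lambda>\<nu>. \<mu> + \<nu>) ` keys r"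
    proof (intro equalityI subsetI)
      fix \<kappa> assume "\<kappa> \<in> (\<lambda>\<nu>. \<mu> + \<nu>) ` keys r"
      then show "\<kappa> \<in> keys (xmon \<mu> * r)" by (auto simp: in_keys_iff lookup_single_mult)
    qed (use keys_single_mult[of _ \<mu> 1 r] in blast)
    then show "r \<in> monomial_ideal n {\<nu>. \<mu> + \<nu> \<in> U} \<longleftrightarrow> xmon \<mu> \<otimes>\<^bsub>mpoly_ring n\<^esub> r \<in> monomial_ideal n U"
      using r mpoly_ring_closed(2)[OF f r] by (auto simp: monomial_ideal_def)
    show "r \<in> monomial_ideal n (U \<union> multiples \<mu>) \<longleftrightarrow>
      (\<exists>s\<in>carrier (mpoly_ring n). r \<ominus>\<^bsub>mpoly_ring n\<^esub> xmon \<mu> \<otimes>\<^bsub>mpoly_ring n\<^esub> s \<in> monomial_ideal n U)"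
    proof
      assume R: "r \<in> monomial_ideal n (U \<union> multiples \<mu>)"
      \<comment> \<open>The terms of \<open>r\<close> divisible by the monomial \<mu> are collected
        and divided by it; all remaining terms have exponents in \<open>U\<close>.\<close>
      let ?A = "keys r \<inter> multiples \<mu>"
      define s where "s = (\<Sum>\<kappa>\<in>?A. single (\<kappa> - \<mu>) (lookup r \<kappa>))"
      have diff: "\<mu> + (\<kappa> - \<mu>) = \<kappa>" if "\<kappa> \<in> multiples \<mu>" for \<kappa> using that by (auto simp: multiples_def)
      have "\<kappa> - \<mu> \<in> exponents n" if "\<kappa> \<in> ?A" for \<kappa>
      proof -
        have "\<mu> + (\<kappa> - \<mu>) \<in> exponents n" using that r diff[of \<kappa>] by (auto simp: carrier_mpoly_ring)
        then show ?thesis by (simp add: exponents_add_iff)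
      qed
      then have s: "s \<in> carrier (mpoly_ring n)"
        unfolding s_def by (intro ideal_sum_closed[OF oneideal]) auto
      have "xmon \<mu> * s = (\<Sum>\<kappa>\<in>?A. single \<kappa> (lookup r \<kappa>))"
        unfolding s_def sum_distrib_left by (rule sum.cong) (auto simp: mult_single diff)
      moreover have "r = (\<Sum>\<kappa>\<in>?A. single \<kappa> (lookup r \<kappa>)) +
          (\<Sum>\<kappa>\<in>keys r - multiples \<mu>. single \<kappa> (lookup r \<kappa>))"
        by (subst poly_mapping_eq_sum_single[of r]) (rule sum.Int_Diff, simp)
      ultimately have "r - xmon \<mu> * s =
          (\<Sum>\<kappa>\<in>keys r - multiples \<mu>. single \<kappa> (lookup r \<kappa>))"
        by (metis add_diff_cancel_left')
      moreover have "\<dots> \<in> monomial_ideal n U"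
        by (rule ideal_sum_closed[OF monomial_ideal_ideal[OF U]])
          (use R in \<open>auto simp: monomial_ideal_def carrier_mpoly_ring\<close>)
      ultimately show "\<exists>s\<in>carrier (mpoly_ring n). r \<ominus>\<^bsub>mpoly_ring n\<^esub> xmon \<mu> \<otimes>\<^bsub>mpoly_ring n\<^esub> s \<in> monomial_ideal n U"
        using s mpoly_ring_minus[OF r mpoly_ring_closed(2)[OF f s]] by (intro bexI[of _ s]) simp_all
    next
      assume "\<exists>s\<in>carrier (mpoly_ring n). r \<ominus>\<^bsub>mpoly_ring n\<^esub> xmon \<mu> \<otimes>\<^bsub>mpoly_ring n\<^esub> s \<in> monomial_ideal n U"
      then obtain s where s: "s \<in> carrier (mpoly_ring n)" "r - xmon \<mu> * s \<in> monomial_ideal n U"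
        using mpoly_ring_minus[OF r mpoly_ring_closed(2)[OF f]] by auto
      have "keys r \<subseteq> keys (r - xmon \<mu> * s) \<union> keys (xmon \<mu> * s)"
        using Poly_Mapping.keys_add[of "r - xmon \<mu> * s" "xmon \<mu> * s"] by simp
      moreover have "keys (xmon \<mu> * s) \<subseteq> multiples \<mu>"
        using keys_single_mult[of _ \<mu> 1 s] by (auto simp: multiples_def)
      ultimately show "r \<in> monomial_ideal n (U \<union> multiples \<mu>)" using r s(2) by (auto simp: monomial_ideal_def)
    qed
  qed (auto intro!: monomial_ideal_ideal upclosed_colon upclosed_Un upclosed_multiples U)
qed

lemma mon_res_middle:
  assumes "upclosed U" "\<mu> \<in> exponents n" "mon_res TYPE('k::field) n l {\<nu>. \<mu> + \<nu> \<in> U}"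
    "mon_res TYPE('k) n l (U \<union> multiples \<mu>)"
  shows "mon_res TYPE('k) n l U"
proof -
  interpret cring "mpoly_ring n :: 'k mpoly ring" by (rule mpoly_ring_cring)
  show ?thesis
    using short_exact_monomial_colon[OF assms(1,2), where 'k = 'k] assms(3,4) free_res_middle
    unfolding mon_res_def by blast
qed

text \<open>The ideal quotient is allowed one step less, because its resolution enters that of the
  sum shifted by one degree.\<close>

lemma mon_res_Un:
  assumes "upclosed U" "\<mu> \<in> exponents n" "mon_res TYPE('k::field) n l {\<nu>. \<mu> + \<nu> \<in> U}"
    "mon_res TYPE('k) n (Suc l) U"
  shows "mon_res TYPE('k) n (Suc l) (U \<union> multiples \<mu>)"
proof -
  interpret cring "mpoly_ring n :: 'k mpoly ring" by (rule mpoly_ring_cring)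
  show ?thesis
    using short_exact_monomial_colon[OF assms(1,2), where 'k = 'k] assms(3,4) free_res_quotient
    unfolding mon_res_def by blast
qed

lemma mon_res_mono:
  assumes "upclosed U" "mon_res TYPE('k::field) n l U" "l \<le> l'"
  shows "mon_res TYPE('k) n l' U"
proof -
  interpret cring "mpoly_ring n :: 'k mpoly ring" by (rule mpoly_ring_cring)
  show ?thesis
    using free_res_mono[OF quotient_module_is_module[OF monomial_ideal_ideal[OF assms(1)]]] assms(2,3)
    unfolding mon_res_def by blast
qed

lemma mon_res_empty: "mon_res TYPE('k::field) n 1 {}"
proof -
  interpret cring "mpoly_ring n :: 'k mpoly ring" by (rule mpoly_ring_cring)
  have "upclosed {}" by (simp add: upclosed_def)
  moreover have "monomial_ideal n {} = {0 :: 'k mpoly}" by (auto simp: monomial_ideal_def carrier_mpoly_ring)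
  ultimately show ?thesis
    unfolding mon_res_def using free_res_quotient_zero[OF monomial_ideal_ideal] by simp
qed

lemma mon_res_UNIV: "mon_res TYPE('k::field) n 0 UNIV"
proof -
  interpret cring "mpoly_ring n :: 'k mpoly ring" by (rule mpoly_ring_cring)
  have "monomial_ideal n UNIV = carrier (mpoly_ring n :: 'k mpoly ring)" by (auto simp: monomial_ideal_def)
  then show ?thesis unfolding mon_res_def using free_res_quotient_carrier by simp
qed

section \<open>The Koszul complex of distinct variables\<close>

definition var_seq :: "nat \<Rightarrow> (nat \<Rightarrow> nat) \<Rightarrow> nat \<Rightarrow> 'k::field mpoly"
  where "var_seq r v i = (if i < r then poly_var (v i) else 0)"

lemma single_var_exponents: "i \<in> {1..n} \<Longrightarrow> single i k \<in> exponents n"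
  by (simp add: exponents_def)

text \<open>The locale \<open>koszul_module\<close> asks for ring elements at all indices, hence the
  value 0 of \<open>var_seq\<close> from \<open>r\<close> on.\<close>

lemma var_seq_closed:
  assumes "v ` {..<r} \<subseteq> {1..n}"
  shows "var_seq r v i \<in> carrier (mpoly_ring n)"
proof (cases "i < r")
  case True
  then have "v i \<in> {1..n}" using assms by auto
  then show ?thesis
    using True single_in_carrier[OF single_var_exponents] by (simp add: var_seq_def poly_var_def)
qed (simp add: var_seq_def carrier_mpoly_ring)

lemma koszul_module_var_seq:
  assumes "v ` {..<r} \<subseteq> {1..n}"
  shows "koszul_module (mpoly_ring n :: 'k::field mpoly ring) (self_module (mpoly_ring n)) (var_seq r v)"
proof -
  interpret cring "mpoly_ring n :: 'k mpoly ring" by (rule mpoly_ring_cring)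
  show ?thesis by (rule koszul_moduleI[OF self_module_is_module var_seq_closed[OF assms]])
qed

text \<open>The Koszul differential preserves multidegrees: the monomial \<kappa> in the boundary at
  \<open>T\<close> comes only from \<kappa> divided by one of the variables adjoined to
  \<open>T\<close>. Speaking of vanishing alone makes the signs irrelevant.\<close>

lemma lookup_koszul_zero:
  fixes c :: "nat set \<Rightarrow> 'k::field mpoly"
  assumes v: "v ` {..<r} \<subseteq> {1..n}" and c: "\<And>U. c U \<in> carrier (mpoly_ring n)" and "k \<le> r"
    and "\<And>i \<nu>. i < k \<Longrightarrow> i \<notin> T \<Longrightarrow> \<kappa> = single (v i) 1 + \<nu> \<Longrightarrow>
      lookup (c (insert i T)) \<nu> = 0"
  shows "lookup (koszul (mpoly_ring n) (var_seq r v) (self_module (mpoly_ring n)) k c T) \<kappa> = 0"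
proof -
  interpret S: koszul_module "mpoly_ring n :: 'k mpoly ring" "self_module (mpoly_ring n)" "var_seq r v"
    by (rule koszul_module_var_seq[OF v])
  show ?thesis using assms(2-)
  proof (induction k arbitrary: c T)
    case (Suc k)
    show ?case
    proof (cases "k \<in> T")
      case True
      let ?p = "S.kz k (\<lambda>U. c (insert k U)) (T - {k})"
      have "lookup ?p \<kappa> = 0"
      proof (rule Suc.IH)
        fix i \<nu> assume i: "i < k" "i \<notin> T - {k}" "\<kappa> = single (v i) 1 + \<nu>"
        then have "insert k (insert i (T - {k})) = insert i T" "i \<notin> T" using True by auto
        then show "lookup (c (insert k (insert i (T - {k})))) \<nu> = 0"
          using Suc.prems(3)[of i \<nu>] i by simp
      qed (use Suc.prems in auto)
      moreover have "?p \<in> carrier (mpoly_ring n)"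
        using S.kz_closed[of "\<lambda>U. c (insert k U)" k "T - {k}"] Suc.prems(1) by simp
      ultimately show ?thesis using True by (simp add: mpoly_ring_uminus(2))
    next
      case False
      have "lookup (S.kz k c T) \<kappa> = 0"
        by (rule Suc.IH) (use Suc.prems in auto)
      moreover have "lookup (var_seq r v k * c (insert k T)) \<kappa> = 0"
      proof (cases "\<exists>\<nu>. \<kappa> = single (v k) 1 + \<nu>")
        case True
        then obtain \<nu> where \<nu>: "\<kappa> = single (v k) 1 + \<nu>" by blast
        show ?thesis unfolding \<nu> using Suc.prems(2) Suc.prems(3)[of k \<nu>] False \<nu>
          by (simp add: var_seq_def poly_var_def lookup_single_mult)
      next
        case nex: False
        then have "\<kappa> \<notin> keys (poly_var (v k) * c (insert k T))"
          using keys_single_mult[of \<kappa> "single (v k) 1" 1] unfolding poly_var_def by blast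
        then show ?thesis using Suc.prems(2) by (simp add: var_seq_def in_keys_iff)
      qed
      ultimately show ?thesis using False by (simp add: lookup_add)
    qed
  qed simp
qed

lemma keys_variable_decompose:
  fixes \<mu> :: "nat \<Rightarrow>\<^sub>0 nat"
  assumes "lookup \<mu> i > 0"
  shows "\<exists>\<nu>. \<mu> = single i 1 + \<nu>"
proof -
  have "\<mu> = single i 1 + (\<mu> - single i 1)"
    by (rule poly_mapping_eqI) (use assms in \<open>auto simp: lookup_add lookup_minus lookup_single when_def\<close>)
  then show ?thesis by blast
qed

text \<open>Boundaries in degree zero form the ideal of the first \<open>k\<close> variables, and a
  polynomial lies in it iff each of its monomials is divisible by one of them. This turns regularity
  of the sequence into a statement on exponents.\<close>

lemma koszul_empty_iff:
  fixes b :: "'k::field mpoly"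
  assumes v: "v ` {..<r} \<subseteq> {1..n}" and k: "k \<le> r" and b: "b \<in> carrier (mpoly_ring n)"
  shows "(\<exists>c. (\<forall>U. c U \<in> carrier (mpoly_ring n)) \<and>
      b = koszul (mpoly_ring n) (var_seq r v) (self_module (mpoly_ring n)) k c {}) \<longleftrightarrow>
    (\<forall>\<mu>\<in>keys b. \<exists>i<k. lookup \<mu> (v i) > 0)" (is "?L \<longleftrightarrow> ?R")
proof
  interpret S: koszul_module "mpoly_ring n :: 'k mpoly ring" "self_module (mpoly_ring n)" "var_seq r v"
    by (rule koszul_module_var_seq[OF v])
  let ?D = "\<lambda>b. \<exists>c. (\<forall>U. c U \<in> carrier (mpoly_ring n)) \<and> b = S.kz k c {}"
  {
    assume ?L
    then obtain c where c: "\<And>U. c U \<in> carrier (mpoly_ring n)" "b = S.kz k c {}" by blast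
    show ?R
    proof (rule ballI, rule ccontr)
      fix \<mu> assume \<mu>: "\<mu> \<in> keys b" "\<not> (\<exists>i<k. lookup \<mu> (v i) > 0)"
      have "lookup (S.kz k c {}) \<mu> = 0"
        by (rule lookup_koszul_zero[OF v c(1) k]) (use \<mu>(2) in \<open>auto simp: lookup_add\<close>)
      with \<mu>(1) c(2) show False by (simp add: in_keys_iff)
    qed
  next
    assume R: ?R
    have D0: "?D 0" using S.kz_zero[of k "{}"] by (intro exI[of _ "\<lambda>_. 0"]) (simp add: carrier_mpoly_ring)
    have Dadd: "?D (a + b)" if "?D a" "?D b" for a b
    proof -
      from that obtain c c' where "\<forall>U. c U \<in> carrier (mpoly_ring n)" "a = S.kz k c {}"
        "\<forall>U. c' U \<in> carrier (mpoly_ring n)" "b = S.kz k c' {}" by blast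
      then show ?thesis using S.kz_add[of c c' k "{}"]
        by (intro exI[of _ "\<lambda>U. c U + c' U"]) (simp add: mpoly_ring_closed)
    qed
    have Dsingle: "?D (single \<mu> a)"
      if m: "\<mu> \<in> exponents n" "i < k" "lookup \<mu> (v i) > 0" for \<mu> a i
    proof -
      obtain \<nu> where \<nu>: "\<mu> = single (v i) 1 + \<nu>" using keys_variable_decompose[OF m(3)] by blast
      let ?x = "single \<nu> a :: 'k mpoly"
      let ?c = "\<lambda>U. if U = {i} then ?x else 0"
      have x: "?x \<in> carrier (mpoly_ring n)" using m(1) \<nu> by (auto simp: exponents_add_iff)
      have val: "S.kz l ?c {} = (if i < l then var_seq r v i * ?x else 0)" for l
        by (induction l) (auto simp: less_Suc_eq)
      have "S.kz k ?c {} = single \<mu> a"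
        using val[of k] m(2) k by (simp add: var_seq_def poly_var_def mult_single \<nu>)
      moreover have "\<forall>U. ?c U \<in> carrier (mpoly_ring n)" using x by (simp add: carrier_mpoly_ring)
      ultimately show ?thesis by (intro exI[of _ ?c]) simp
    qed
    have "?D (\<Sum>\<mu>\<in>A. single \<mu> (lookup b \<mu>))" if "A \<subseteq> keys b" "finite A" for A
      using that(2,1)
    proof (induction A rule: finite_induct)
      case empty
      then show ?case using D0 by simp
    next
      case (insert \<mu> A)
      have "\<mu> \<in> exponents n" using insert.prems b by (auto simp: carrier_mpoly_ring)
      moreover obtain i where "i < k" "lookup \<mu> (v i) > 0" using R insert.prems by auto
      ultimately have "?D (single \<mu> (lookup b \<mu>))" by (rule Dsingle)
      from Dadd[OF this insert.IH] insert show ?case by simp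
    qed
    from this[of "keys b"] have "?D (\<Sum>\<mu>\<in>keys b. single \<mu> (lookup b \<mu>))" by simp
    then show ?L unfolding poly_mapping_eq_sum_single[of b, symmetric] .
  }
qed

text \<open>Multiplication by a variable different from the first \<open>k\<close> ones does not
  affect divisibility by any of these, so distinct variables form a regular sequence.\<close>

lemma koszul_exact_var_seq:
  assumes v: "v ` {..<r} \<subseteq> {1..n}" and inj: "inj_on v {..<r}"
  shows "koszul_exact (mpoly_ring n :: 'k::field mpoly ring) (var_seq r v) (self_module (mpoly_ring n)) r (Suc i)"
proof -
  interpret S: koszul_module "mpoly_ring n :: 'k mpoly ring" "self_module (mpoly_ring n)" "var_seq r v"
    by (rule koszul_module_var_seq[OF v])
  show ?thesis
  proof (rule S.koszul_exact_regular)
    fix k and b :: "'k mpoly"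
    assume k: "k < r" and b': "b \<in> carrier (self_module (mpoly_ring n))"
      and ex: "\<exists>c. (\<forall>U. c U \<in> carrier (self_module (mpoly_ring n))) \<and>
        var_seq r v k \<odot>\<^bsub>self_module (mpoly_ring n)\<^esub> b = S.kz k c {}"
    have b: "b \<in> carrier (mpoly_ring n)" using b' by simp
    have qb: "var_seq r v k * b \<in> carrier (mpoly_ring n)" by (rule mpoly_ring_closed(2)[OF var_seq_closed[OF v] b])
    have "k \<le> r" using k by simp
    note iff = koszul_empty_iff[OF v this]
    have *: "\<forall>\<mu>\<in>keys (var_seq r v k * b). \<exists>i<k. lookup \<mu> (v i) > 0"
      using iff[OF qb] ex by simp
    have "\<forall>\<mu>\<in>keys b. \<exists>i<k. lookup \<mu> (v i) > 0"
    proof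
      fix \<mu> assume "\<mu> \<in> keys b"
      then have "single (v k) 1 + \<mu> \<in> keys (var_seq r v k * b)"
        using k by (simp add: var_seq_def poly_var_def in_keys_iff lookup_single_mult)
      with * obtain i where i: "i < k" "lookup (single (v k) 1 + \<mu>) (v i) > 0" by blast
      moreover have "v k \<noteq> v i" using inj_onD[OF inj, of k i] i(1) k by auto
      ultimately show "\<exists>i<k. lookup \<mu> (v i) > 0" by (auto simp: lookup_add lookup_single)
    qed
    then show "\<exists>c. (\<forall>U. c U \<in> carrier (self_module (mpoly_ring n))) \<and> b = S.kz k c {}"
      using iff[OF b] by simp
  qed
qed

text \<open>Sorting by colour makes the colour classes consecutive blocks of indices, the shape that
  \<open>sphere\<close> expects.\<close>

lemma monotone_enumeration:
  fixes \<kappa> :: "nat \<Rightarrow> nat"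
  assumes "finite W"
  obtains v where "bij_betw v {..<card W} W" "\<And>i j. i \<le> j \<Longrightarrow> j < card W \<Longrightarrow> \<kappa> (v i) \<le> \<kappa> (v j)"
proof -
  let ?xs = "sort_key \<kappa> (sorted_list_of_set W)"
  have len: "length ?xs = card W" and set: "set ?xs = W" and dist: "distinct ?xs" using assms by simp_all
  have "bij_betw (\<lambda>i. ?xs ! i) {..<card W} W"
    using bij_betw_nth[OF dist, of "{..<card W}" W] len set by simp
  moreover have "\<kappa> (?xs ! i) \<le> \<kappa> (?xs ! j)" if "i \<le> j" "j < card W" for i j
    using sorted_nth_mono[of "map \<kappa> ?xs" i j] that len by simp
  ultimately show thesis by (rule that)
qed

lemma finprod_var_seq:
  assumes v: "v ` {..<r} \<subseteq> {1..n}" and A: "A \<subseteq> {..<r}"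
  shows "finprod (mpoly_ring n) (var_seq r v) A = (xmon (\<Sum>i\<in>A. single (v i) 1) :: 'k::field mpoly)"
proof -
  let ?S = "mpoly_ring n :: 'k mpoly ring"
  interpret cring ?S by (rule mpoly_ring_cring)
  have "finite A" using A by (rule finite_subset) simp
  then show ?thesis using A
  proof (induction A rule: finite_induct)
    case empty
    then show ?case by simp
  next
    case (insert a A)
    have "finprod ?S (var_seq r v) (insert a A) = var_seq r v a \<otimes>\<^bsub>?S\<^esub> finprod ?S (var_seq r v) A"
      using insert.hyps var_seq_closed[OF v] by (intro finprod_insert) auto
    also have "finprod ?S (var_seq r v) A = xmon (\<Sum>i\<in>A. single (v i) 1)"
      using insert by blast
    also have "(var_seq r v a :: 'k mpoly) = xmon (single (v a) 1)"
      using insert.prems by (simp add: var_seq_def poly_var_def)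
    finally show ?case using insert.hyps by (simp add: mult_single)
  qed
qed

lemma (in koszul_module) kz_minus:
  assumes "\<And>U. c U \<in> carrier M" "\<And>U. c' U \<in> carrier M"
  shows "kz r (\<lambda>U. c U \<ominus>\<^bsub>M\<^esub> c' U) T = kz r c T \<ominus>\<^bsub>M\<^esub> kz r c' T"
  using assms by (simp add: M.minus_eq kz_add kz_neg)

text \<open>The cycle is \<open>u\<close> times the join of the boundaries of all colour classes but
  the last with the full simplex on the last one. Its boundary is \<open>u\<close> times the sphere.
  The coefficients of the sphere are products over transversals up to sign, so the boundary lies in
  the ideal. If the cycle were a boundary modulo the ideal, some chain \<open>y\<close> with
  coefficients in the ideal would have the same boundary. At the complement of the transversal
  \<open>\<tau>0\<close>, the monomial \<open>u + e\<close> of this boundary has a nonzero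
  coefficient, but it could come only from monomials excluded by \<open>minimal\<close>.\<close>

theorem projective_dimension_monomial_ge:
  fixes \<kappa> :: "nat \<Rightarrow> nat" and u :: "nat \<Rightarrow>\<^sub>0 nat"
  assumes U: "upclosed U" and u: "u \<in> exponents n" and W: "W \<subseteq> {1..n}" and c: "c \<ge> 1"
    and colours: "\<And>w. w \<in> W \<Longrightarrow> \<kappa> w < c"
    and trans: "\<And>\<tau>. (\<And>k. k < c \<Longrightarrow> \<tau> k \<in> W \<and> \<kappa> (\<tau> k) = k) \<Longrightarrow>
      u + (\<Sum>k<c. single (\<tau> k) 1) \<in> U"
    and \<tau>0: "\<And>k. k < c \<Longrightarrow> \<tau>0 k \<in> W \<and> \<kappa> (\<tau>0 k) = k"
    and minimal: "\<And>j. j < c \<Longrightarrow> u + (\<Sum>k\<in>{..<c} - {j}. single (\<tau>0 k) 1) \<notin> U"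
  shows "enat (card W - c + 1) \<le>
    projective_dimension (mpoly_ring n) (quotient_module (mpoly_ring n) (monomial_ideal n U :: 'k::field mpoly set))"
proof -
  let ?S = "mpoly_ring n :: 'k mpoly ring"
  interpret cring ?S by (rule mpoly_ring_cring)
  have finW: "finite W" using W by (rule finite_subset) simp
  define r where "r = card W"
  obtain v where v: "bij_betw v {..<r} W" and mono: "\<And>i j. i \<le> j \<Longrightarrow> j < r \<Longrightarrow> \<kappa> (v i) \<le> \<kappa> (v j)"
    using monotone_enumeration[OF finW] unfolding r_def by metis
  have vW: "v i \<in> W" if "i < r" for i using v that by (auto simp: bij_betw_def)
  have v1: "v ` {..<r} \<subseteq> {1..n}" and inj: "inj_on v {..<r}" using v W by (auto simp: bij_betw_def)
  define q :: "nat \<Rightarrow> 'k mpoly" where "q = var_seq r v"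
  have q: "q i \<in> carrier ?S" for i unfolding q_def by (rule var_seq_closed[OF v1])
  interpret S: koszul_module ?S "self_module ?S" q unfolding q_def by (rule koszul_module_var_seq[OF v1])
  \<comment> \<open>The index at which the block of colour \<open>k\<close> begins in the sorted
    enumeration.\<close>
  define s where "s = (\<lambda>k. card {i. i < r \<and> \<kappa> (v i) < k})"
  have s_iff: "i < s k \<longleftrightarrow> \<kappa> (v i) < k" if "i < r" for i k
  proof
    assume "\<kappa> (v i) < k"
    then have "{..i} \<subseteq> {j. j < r \<and> \<kappa> (v j) < k}" using mono[of _ i] that by fastforce
    from card_mono[OF _ this] show "i < s k" by (simp add: s_def)
  next
    assume i: "i < s k"
    show "\<kappa> (v i) < k"
    proof (rule ccontr)
      assume "\<not> \<kappa> (v i) < k"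
      then have "{j. j < r \<and> \<kappa> (v j) < k} \<subseteq> {..<i}"
        using mono[of i] by (auto simp: not_le[symmetric]) (metis le_trans linorder_not_le)
      from card_mono[OF _ this] i show False by (simp add: s_def)
    qed
  qed
  have sle: "s k \<le> r" for k
  proof -
    have "{i. i < r \<and> \<kappa> (v i) < k} \<subseteq> {..<r}" by auto
    from card_mono[OF _ this] show ?thesis by (simp add: s_def)
  qed
  have s0: "s 0 = 0" by (simp add: s_def)
  have sc: "s c = r"
  proof -
    have "{i. i < r \<and> \<kappa> (v i) < c} = {..<r}" using colours vW by auto
    then show ?thesis by (simp add: s_def)
  qed
  have smono: "mono s" unfolding s_def by (intro monoI card_mono) auto
  have block: "i \<in> {s k..<s (Suc k)} \<longleftrightarrow> i < r \<and> \<kappa> (v i) = k" for i k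
    using s_iff[of i k] s_iff[of i "Suc k"] sle[of "Suc k"] by (cases "i < r") auto
  obtain c' where c': "c = Suc c'" using c by (cases c) auto
  define \<omega> where "\<omega> = sphere ?S q s"
  define z where "z = (\<lambda>T. xmon u * join_simplex ?S (s c') (s c) (\<omega> c') T)"
  have \<omega>c: "\<omega> k T \<in> carrier ?S" for k T unfolding \<omega>_def by (rule sphere_closed[OF q])
  have uc: "xmon u \<in> carrier ?S" using u by auto
  have jc: "join_simplex ?S (s c') (s c) (\<omega> c') T \<in> carrier ?S" for T
    using \<omega>c by (simp add: join_simplex_def carrier_mpoly_ring)
  have z: "z T \<in> carrier ?S" for T unfolding z_def by (rule mpoly_ring_closed(2)[OF uc jc])
  have kz: "S.kz r z T = xmon u * \<omega> c T" for T
  proof -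
    have "S.kz r z T = xmon u * S.kz r (join_simplex ?S (s c') (s c) (\<omega> c')) T"
      using S.kz_smult[of "join_simplex ?S (s c') (s c) (\<omega> c')" "xmon u" r T] jc uc unfolding z_def by simp
    then show ?thesis by (simp add: \<omega>_def c' sc[symmetric, unfolded c'])
  qed
  define J :: "'k mpoly set" where "J = monomial_ideal n U"
  have J: "ideal J ?S" unfolding J_def by (rule monomial_ideal_ideal[OF U])
  interpret J: ideal J ?S by (rule J)
  have prod: "\<omega> c T \<in> {xmon (\<Sum>i\<in>{..<r} - T. single (v i) 1), - xmon (\<Sum>i\<in>{..<r} - T. single (v i) 1)}"
    if T: "T \<subseteq> {..<r}" "\<And>k. k < c \<Longrightarrow> misses_one T {s k..<s (Suc k)}" for T
  proof -
    let ?p = "xmon (\<Sum>i\<in>{..<r} - T. single (v i) 1) :: 'k mpoly"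
    have p: "finprod ?S q ({..<s c} - T) = ?p"
      unfolding q_def sc by (rule finprod_var_seq[OF v1]) auto
    have "finprod ?S q ({..<s c} - T) \<in> carrier ?S" using q by (intro finprod_closed) auto
    then have "\<ominus>\<^bsub>?S\<^esub> ?p = - ?p" unfolding p by (rule mpoly_ring_uminus(2))
    then show ?thesis
      using sphere_eq(1)[where q = q and s = s and c = c and T = T, OF q s0 smono] T sc p unfolding \<omega>_def by simp
  qed
  \<comment> \<open>The indices missing from \<open>T\<close>, one in each block, select a variable
    of each colour.\<close>
  have sel: "\<exists>\<tau>. (\<forall>k<c. \<tau> k \<in> W \<and> \<kappa> (\<tau> k) = k) \<and>
      (\<Sum>i\<in>{..<r} - T. single (v i) 1) = (\<Sum>k<c. single (\<tau> k) (1::nat))"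
    if T: "T \<subseteq> {..<r}" "\<And>k. k < c \<Longrightarrow> misses_one T {s k..<s (Suc k)}" for T
  proof -
    have "\<forall>k<c. \<exists>i. i \<in> {s k..<s (Suc k)} \<and> T \<inter> {s k..<s (Suc k)} = {s k..<s (Suc k)} - {i}"
      using T(2) unfolding misses_one_def by blast
    then obtain \<iota> where \<iota>: "\<And>k. k < c \<Longrightarrow> \<iota> k \<in> {s k..<s (Suc k)}"
      "\<And>k. k < c \<Longrightarrow> T \<inter> {s k..<s (Suc k)} = {s k..<s (Suc k)} - {\<iota> k}" by metis
    have \<iota>r: "\<iota> k < r" "\<kappa> (v (\<iota> k)) = k" if "k < c" for k using \<iota>(1)[OF that] unfolding block by auto
    have "bij_betw \<iota> {..<c} ({..<r} - T)"
    proof (rule bij_betw_imageI)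
      show "inj_on \<iota> {..<c}" using \<iota>r(2) by (metis inj_onI lessThan_iff)
      show "\<iota> ` {..<c} = {..<r} - T"
      proof (intro equalityI subsetI)
        fix i assume "i \<in> \<iota> ` {..<c}"
        then obtain k where k: "k < c" "i = \<iota> k" by auto
        have "\<iota> k \<notin> T \<inter> {s k..<s (Suc k)}" unfolding \<iota>(2)[OF k(1)] by blast
        then show "i \<in> {..<r} - T" using \<iota>(1)[OF k(1)] \<iota>r(1)[OF k(1)] k(2) by blast
      next
        fix i assume i: "i \<in> {..<r} - T"
        define k where "k = \<kappa> (v i)"
        have k: "k < c" using i colours vW by (simp add: k_def)
        have "i \<in> {s k..<s (Suc k)}" using i unfolding block k_def by simp
        moreover have "i \<notin> {s k..<s (Suc k)} - {\<iota> k}" unfolding \<iota>(2)[OF k, symmetric] using i by simp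
        ultimately have "i = \<iota> k" by blast
        then show "i \<in> \<iota> ` {..<c}" using k by simp
      qed
    qed
    then have "(\<Sum>i\<in>{..<r} - T. single (v i) (1::nat)) = (\<Sum>k<c. single (v (\<iota> k)) 1)"
      by (rule sum.reindex_bij_betw[symmetric])
    moreover have "\<forall>k<c. v (\<iota> k) \<in> W \<and> \<kappa> (v (\<iota> k)) = k" using \<iota>r vW by auto
    ultimately show ?thesis by (intro exI[of _ "\<lambda>k. v (\<iota> k)"]) simp
  qed
  define i where "i = card W - c + 1"
  have "enat i \<le> projective_dimension ?S (quotient_module ?S J)"
  proof (rule projective_dimension_ge[where q = q and r = r and z = z, OF J q _ z])
    show "koszul_exact ?S q (self_module ?S) r (Suc i)" for i
      unfolding q_def by (rule koszul_exact_var_seq[OF v1 inj])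
  next
    fix T assume T: "T \<subseteq> {..<r}"
    show "S.kz r z T \<in> J"
    proof (cases "\<forall>k<c. misses_one T {s k..<s (Suc k)}")
      case True
      define e :: "nat \<Rightarrow>\<^sub>0 nat" where "e = (\<Sum>i\<in>{..<r} - T. single (v i) 1)"
      have pm: "\<omega> c T = xmon e \<or> \<omega> c T = - xmon e" using prod[OF T] True unfolding e_def by blast
      from sel[OF T] True obtain \<tau> where \<tau>: "\<forall>k<c. \<tau> k \<in> W \<and> \<kappa> (\<tau> k) = k" "e = (\<Sum>k<c. single (\<tau> k) 1)"
        unfolding e_def by blast
      have "u + e \<in> U" unfolding \<tau>(2) by (rule trans) (use \<tau>(1) in blast)
      moreover have "S.kz r z T \<in> carrier ?S" using S.kz_closed[of z r T] z by simp
      moreover have "keys (S.kz r z T) \<subseteq> {u + e}"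
        using pm unfolding kz by (auto simp: mult_single)
      ultimately show ?thesis unfolding J_def monomial_ideal_def by blast
    next
      case False
      then obtain k where "k < c" "\<not> misses_one T {s k..<s (Suc k)}" by blast
      then have "\<omega> c T = 0" using sphere_eq(2)[where q = q and s = s and c = c and T = T, OF q s0 smono] T sc unfolding \<omega>_def by simp
      then show ?thesis unfolding kz by (simp add: J_def monomial_ideal_def carrier_mpoly_ring)
    qed
  next
    fix w :: "nat set \<Rightarrow> (nat \<Rightarrow>\<^sub>0 nat) \<Rightarrow>\<^sub>0 'k" assume w: "\<And>U. w U \<in> carrier ?S"
    define \<iota> where "\<iota> = (\<lambda>k. inv_into {..<r} v (\<tau>0 k))"
    have \<iota>: "\<iota> k < r" "v (\<iota> k) = \<tau>0 k" if "k < c" for k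
    proof -
      have "\<tau>0 k \<in> v ` {..<r}" using \<tau>0[OF that] v by (simp add: bij_betw_def)
      from inv_into_into[OF this] f_inv_into_f[OF this] show "\<iota> k < r" "v (\<iota> k) = \<tau>0 k" by (auto simp: \<iota>_def)
    qed
    \<comment> \<open>The set in the support of the sphere whose coefficient is the product over the
      transversal \<open>\<tau>0\<close>.\<close>
    define T where "T = {..<r} - \<iota> ` {..<c}"
    have T: "T \<subseteq> {..<r}" and compl: "{..<r} - T = \<iota> ` {..<c}" using \<iota>(1) by (auto simp: T_def)
    have \<iota>inj: "inj_on \<iota> {..<c}"
      using \<iota>(2) \<tau>0 by (intro inj_onI) (metis lessThan_iff)
    have cardT: "card T = r - c"
      unfolding T_def using \<iota>(1) card_image[OF \<iota>inj] by (subst card_Diff_subset) auto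
    have cr: "c \<le> r" using card_mono[of "{..<r}" "\<iota> ` {..<c}"] \<iota>(1) card_image[OF \<iota>inj] by auto
    have miss: "misses_one T {s k..<s (Suc k)}" if k: "k < c" for k
      unfolding misses_one_def
    proof (intro bexI)
      show "\<iota> k \<in> {s k..<s (Suc k)}" unfolding block using \<iota>[OF k] \<tau>0[OF k] by simp
      show "T \<inter> {s k..<s (Suc k)} = {s k..<s (Suc k)} - {\<iota> k}"
      proof (intro equalityI subsetI)
        fix i assume "i \<in> T \<inter> {s k..<s (Suc k)}"
        then show "i \<in> {s k..<s (Suc k)} - {\<iota> k}" using k unfolding T_def by blast
      next
        fix i assume i: "i \<in> {s k..<s (Suc k)} - {\<iota> k}"
        then have i': "i < r" "\<kappa> (v i) = k" using block[of i k] by blast+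
        have "i \<notin> \<iota> ` {..<c}"
        proof
          assume "i \<in> \<iota> ` {..<c}"
          then obtain k' where "k' < c" "i = \<iota> k'" by auto
          then have "k' = k" using i'(2) \<iota>(2) \<tau>0 by simp
          with \<open>i = \<iota> k'\<close> i show False by blast
        qed
        then show "i \<in> T \<inter> {s k..<s (Suc k)}" using i i'(1) unfolding T_def by blast
      qed
    qed
    define e :: "nat \<Rightarrow>\<^sub>0 nat" where "e = (\<Sum>k<c. single (\<tau>0 k) 1)"
    have e: "(\<Sum>i\<in>{..<r} - T. single (v i) 1) = e"
      unfolding compl e_def by (subst sum.reindex[OF \<iota>inj]) (auto intro!: sum.cong simp: \<iota>(2))
    have pm: "\<omega> c T = xmon e \<or> \<omega> c T = - xmon e" using prod[OF T miss] unfolding e by blast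
    show "\<exists>T\<subseteq>{..<r}. card T = i \<and> z T \<ominus>\<^bsub>?S\<^esub> S.kz r w T \<notin> J"
    proof (rule ccontr)
      assume "\<not> ?thesis"
      then have inJ: "z T \<ominus>\<^bsub>?S\<^esub> S.kz r w T \<in> J" if "T \<subseteq> {..<r}" "card T = i" for T using that by blast
      define y where "y = (\<lambda>T. z T \<ominus>\<^bsub>?S\<^esub> S.kz r w T)"
      have wc: "S.kz r w T \<in> carrier ?S" for T using S.kz_closed[of w r T] w by simp
      have y: "y T \<in> carrier ?S" for T unfolding y_def using z wc by simp
      have "S.kz r y T = S.kz r z T"
      proof -
        have "S.kz r y T = S.kz r z T \<ominus>\<^bsub>?S\<^esub> S.kz r (S.kz r w) T"
          using S.kz_minus[of z "S.kz r w" r T] z wc unfolding y_def by simp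
        also have "\<dots> = S.kz r z T"
          using S.kz_kz[of w r T] w S.kz_closed[of z r T] z mpoly_ring_minus[of "S.kz r z T" n 0]
          by (simp add: carrier_mpoly_ring)
        finally show ?thesis .
      qed
      then have "lookup (S.kz r y T) (u + e) = lookup (xmon u * \<omega> c T) (u + e)"
        by (simp add: kz)
      also have "\<dots> \<noteq> 0" using pm by (auto simp: mult_single lookup_single_mult)
      finally have nz: "lookup (S.kz r y T) (u + e) \<noteq> 0" .
      have "lookup (S.kz r y T) (u + e) = 0"
        unfolding q_def
      proof (rule lookup_koszul_zero[OF v1 y order_refl])
        fix i' \<nu> assume i': "i' < r" "i' \<notin> T" "u + e = single (v i') 1 + \<nu>"
        then have "i' \<in> \<iota> ` {..<c}" using compl by blast
        then obtain k where k: "k < c" "i' = \<iota> k" by auto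
        let ?e = "\<Sum>j\<in>{..<c} - {k}. single (\<tau>0 j) 1 :: nat \<Rightarrow>\<^sub>0 nat"
        have "e = single (\<tau>0 k) 1 + ?e"
          unfolding e_def using k(1) by (subst sum.remove[of _ k]) auto
        then have "single (\<tau>0 k) 1 + \<nu> = single (\<tau>0 k) 1 + (u + ?e)"
          unfolding i'(3)[symmetric, unfolded k(2) \<iota>(2)[OF k(1)]] by (simp only: add.left_commute)
        then have \<nu>: "\<nu> = u + ?e" by (simp only: add_left_cancel)
        have "card (insert i' T) = i"
          using i'(2) cardT cr finite_subset[OF T] unfolding i_def r_def[symmetric] by simp
        then have "y (insert i' T) \<in> J" unfolding y_def using i'(1) T by (intro inJ) auto
        then have "keys (y (insert i' T)) \<subseteq> U"
          unfolding J_def monomial_ideal_def mem_Collect_eq by (rule conjunct2)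
        then show "lookup (y (insert i' T)) \<nu> = 0"
          using minimal[OF k(1)] unfolding \<nu> in_keys_iff[symmetric, of _ "y (insert i' T)"] by (meson in_keys_iff subsetD)
      qed
      with nz show False by contradiction
    qed
  qed
  then show ?thesis unfolding i_def J_def .
qed

section \<open>Powers of path ideals described by multiplicities\<close>

definition path_exp :: "nat \<Rightarrow> nat \<Rightarrow> (nat \<Rightarrow>\<^sub>0 nat)"
  where "path_exp m i = (\<Sum>j\<in>{i..<i + m}. single j 1)"

text \<open>The starting points of the \<open>m\<close>-paths through \<open>j\<close>.\<close>

definition window :: "nat \<Rightarrow> nat \<Rightarrow> nat set"
  where "window m j = {i. i \<le> j \<and> j < i + m}"

text \<open>Exponents of the multiples of a product of \<open>t\<close> paths in \<open>1, \<dots>, n\<close>; \<open>c i\<close> is the number of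
  factors starting at \<open>i\<close>.\<close>

definition path_powers :: "nat \<Rightarrow> nat \<Rightarrow> nat \<Rightarrow> (nat \<Rightarrow>\<^sub>0 nat) set"
  where "path_powers n m t = {\<nu>. \<exists>c :: nat \<Rightarrow> nat. (\<forall>i. c i \<noteq> 0 \<longrightarrow> 1 \<le> i \<and> i + m \<le> n + 1) \<and>
     (\<Sum>i\<le>n. c i) = t \<and> (\<forall>j. (\<Sum>i\<in>window m j. c i) \<le> lookup \<nu> j)}"

lemma finite_window [simp]: "finite (window m j)"
  by (rule finite_subset[of _ "{..j}"]) (auto simp: window_def)

lemma lookup_path_exp: "lookup (path_exp m i) j = (if i \<in> window m j then 1 else 0)"
  by (simp add: path_exp_def lookup_sum lookup_single when_def window_def)

lemma path_powersI:
  assumes "\<And>i. c i \<noteq> 0 \<Longrightarrow> 1 \<le> i \<and> i + m \<le> n + 1" "(\<Sum>i\<le>n. c i) = t"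
    "\<And>j. (\<Sum>i\<in>window m j. c i) \<le> lookup \<nu> j"
  shows "\<nu> \<in> path_powers n m t"
  using assms unfolding path_powers_def by blast

lemma path_powersE:
  assumes "\<nu> \<in> path_powers n m t"
  obtains c where "\<And>i. c i \<noteq> 0 \<Longrightarrow> 1 \<le> i \<and> i + m \<le> n + 1" "(\<Sum>i\<le>n. c i) = t"
    "\<And>j. (\<Sum>i\<in>window m j. c i) \<le> lookup \<nu> j"
  using assms unfolding path_powers_def by blast

lemma sum_add_one:
  fixes c :: "nat \<Rightarrow> nat"
  assumes "finite A"
  shows "(\<Sum>k\<in>A. c k + (if k = i then 1 else 0)) = (\<Sum>k\<in>A. c k) + (if i \<in> A then 1 else 0)"
  using assms by (simp add: sum.distrib)

lemma sum_fun_dec: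
  fixes c :: "nat \<Rightarrow> nat"
  assumes "finite A" "c i > 0"
  shows "(\<Sum>k\<in>A. (c(i := c i - 1)) k) + (if i \<in> A then 1 else 0) = (\<Sum>k\<in>A. c k)"
proof -
  have "(\<Sum>k\<in>A. (c(i := c i - 1)) k + (if k = i then 1 else 0)) = (\<Sum>k\<in>A. c k)"
    by (rule sum.cong) (use assms(2) in auto)
  then show ?thesis using sum_add_one[OF assms(1), of "c(i := c i - 1)" i] by simp
qed

lemma upclosed_path_powers: "upclosed (path_powers n m t)"
  unfolding upclosed_def
proof (intro ballI allI)
  fix \<mu> \<nu> assume "\<mu> \<in> path_powers n m t"
  then obtain c where c: "\<And>i. c i \<noteq> 0 \<Longrightarrow> 1 \<le> i \<and> i + m \<le> n + 1" "(\<Sum>i\<le>n. c i) = t"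
    "\<And>j. (\<Sum>i\<in>window m j. c i) \<le> lookup \<mu> j" by (rule path_powersE) (rule that)
  show "\<mu> + \<nu> \<in> path_powers n m t"
    by (rule path_powersI[of c]) (use c in \<open>auto simp: lookup_add intro: trans_le_add1\<close>)
qed

lemma path_powers_0: "path_powers n m 0 = UNIV"
  unfolding path_powers_def by (auto intro!: exI[of _ "\<lambda>_. 0"])

lemma path_powers_small:
  assumes "n < m" "t \<ge> 1"
  shows "path_powers n m t = {}"
proof (rule equals0I)
  fix \<nu> assume "\<nu> \<in> path_powers n m t"
  then obtain c where c: "\<And>i. c i \<noteq> 0 \<Longrightarrow> 1 \<le> i \<and> i + m \<le> n + 1" "(\<Sum>i\<le>n. c i) = t"
    by (rule path_powersE) (rule that)
  have "c i = 0" for i using c(1)[of i] assms(1) by fastforce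
  then show False using c(2) assms(2) by simp
qed

lemma path_powers_add_path:
  assumes \<mu>: "\<mu> \<in> path_powers n m t" and i: "1 \<le> i" "i + m \<le> n + 1" and m: "m \<ge> 1"
  shows "path_exp m i + \<mu> \<in> path_powers n m (Suc t)"
proof -
  from \<mu> obtain c where c: "\<And>i. c i \<noteq> 0 \<Longrightarrow> 1 \<le> i \<and> i + m \<le> n + 1" "(\<Sum>i\<le>n. c i) = t"
    "\<And>j. (\<Sum>i\<in>window m j. c i) \<le> lookup \<mu> j" by (rule path_powersE) (rule that)
  show ?thesis
  proof (rule path_powersI[of "\<lambda>k. c k + (if k = i then 1 else 0)"])
    show "1 \<le> k \<and> k + m \<le> n + 1" if "c k + (if k = i then 1 else 0) \<noteq> 0" for k
      using that c(1)[of k] i by (cases "k = i") auto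
    show "(\<Sum>k\<le>n. c k + (if k = i then 1 else 0)) = Suc t"
      using sum_add_one[of "{..n}" c i] c(2) i m by simp
    show "(\<Sum>k\<in>window m j. c k + (if k = i then 1 else 0)) \<le> lookup (path_exp m i + \<mu>) j" for j
      using sum_add_one[OF finite_window, of c i m j] c(3)[of j] by (simp add: lookup_add lookup_path_exp)
  qed
qed

lemma path_powers_Suc:
  assumes m: "m \<ge> 1" and \<nu>: "\<nu> \<in> path_powers n m (Suc t)"
  obtains i \<mu> where "1 \<le> i" "i + m \<le> n + 1" "\<mu> \<in> path_powers n m t" "\<nu> = path_exp m i + \<mu>"
proof -
  from \<nu> obtain c where c: "\<And>i. c i \<noteq> 0 \<Longrightarrow> 1 \<le> i \<and> i + m \<le> n + 1" "(\<Sum>i\<le>n. c i) = Suc t"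
    "\<And>j. (\<Sum>i\<in>window m j. c i) \<le> lookup \<nu> j" by (rule path_powersE) (rule that)
  have "\<exists>i\<le>n. c i > 0"
  proof (rule ccontr)
    assume "\<not> ?thesis"
    then have "(\<Sum>i\<le>n. c i) = 0" by simp
    with c(2) show False by simp
  qed
  then obtain i where i: "i \<le> n" "c i > 0" by blast
  let ?c = "c(i := c i - 1)" and ?\<mu> = "\<nu> - path_exp m i"
  have dec: "(\<Sum>k\<in>window m j. ?c k) + (if i \<in> window m j then 1 else 0) = (\<Sum>k\<in>window m j. c k)" for j
    by (rule sum_fun_dec[where c = c and i = i, OF finite_window i(2)])
  have le: "(\<Sum>k\<in>window m j. ?c k) + (if i \<in> window m j then 1 else 0) \<le> lookup \<nu> j" for j
    using c(3)[of j] dec[of j] by simp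
  have "?\<mu> \<in> path_powers n m t"
  proof (rule path_powersI[of ?c])
    show "1 \<le> k \<and> k + m \<le> n + 1" if "?c k \<noteq> 0" for k
      using that c(1)[of k] i(2) by (cases "k = i") auto
    show "(\<Sum>k\<le>n. ?c k) = t" using sum_fun_dec[of "{..n}" c i] i c(2) by simp
    show "(\<Sum>k\<in>window m j. ?c k) \<le> lookup ?\<mu> j" for j
      using le[of j] by (simp add: lookup_minus lookup_path_exp)
  qed
  moreover have "\<nu> = path_exp m i + ?\<mu>"
  proof (rule poly_mapping_eqI)
    fix j
    show "lookup \<nu> j = lookup (path_exp m i + ?\<mu>) j"
      using le[of j] by (simp add: lookup_add lookup_minus lookup_path_exp)
  qed
  ultimately show thesis using c(1)[of i] i(2) by (intro that[of i ?\<mu>]) auto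
qed

lemma exponent_power_paths:
  assumes m: "m \<ge> 1"
  shows "exponent_power (\<Union>(multiples ` path_exp m ` {i. 1 \<le> i \<and> i + m \<le> n + 1})) t = path_powers n m t"
    (is "exponent_power ?U t = _")
proof (induction t)
  case 0
  then show ?case by (simp add: path_powers_0)
next
  case (Suc t)
  show ?case
  proof (intro equalityI subsetI)
    fix \<nu> assume "\<nu> \<in> exponent_power ?U (Suc t)"
    then obtain a b where ab: "\<nu> = a + b" "a \<in> path_powers n m t" "b \<in> ?U" using Suc by auto
    then obtain i \<rho> where i: "1 \<le> i" "i + m \<le> n + 1" "b = path_exp m i + \<rho>" by (auto simp: multiples_def)
    have "\<nu> = path_exp m i + (a + \<rho>)" by (simp add: ab i add_ac)
    moreover have "a + \<rho> \<in> path_powers n m t" using upclosed_path_powers ab(2) unfolding upclosed_def by blast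
    ultimately show "\<nu> \<in> path_powers n m (Suc t)" using path_powers_add_path[OF _ i(1,2) m] by simp
  next
    fix \<nu> assume "\<nu> \<in> path_powers n m (Suc t)"
    then obtain i \<mu> where i: "1 \<le> i" "i + m \<le> n + 1" "\<mu> \<in> path_powers n m t" "\<nu> = path_exp m i + \<mu>"
      by (rule path_powers_Suc[OF m])
    have "path_exp m i \<in> multiples (path_exp m i)" unfolding multiples_def by (rule range_eqI[of _ _ 0]) simp
    then have "path_exp m i \<in> ?U" using i(1,2) by blast
    moreover have "\<mu> \<in> exponent_power ?U t" using i(3) Suc by simp
    moreover have "\<nu> = \<mu> + path_exp m i" by (simp add: i(4) add.commute)
    ultimately show "\<nu> \<in> exponent_power ?U (Suc t)" by auto
  qed
qed

lemma path_exp_exponents: "1 \<le> i \<Longrightarrow> i + m \<le> n + 1 \<Longrightarrow> path_exp m i \<in> exponents n"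
proof -
  assume i: "1 \<le> i" "i + m \<le> n + 1"
  have "j \<in> {1..n}" if "j \<in> keys (path_exp m i)" for j
    using that i by (auto simp: in_keys_iff lookup_path_exp window_def split: if_splits)
  then show ?thesis unfolding exponents_def by blast
qed

lemma prod_poly_var: "finite A \<Longrightarrow> (\<Prod>j\<in>A. poly_var j) = (xmon (\<Sum>j\<in>A. single j 1) :: 'k::field mpoly)"
  by (induction A rule: finite_induct) (simp_all add: poly_var_def mult_single)

theorem path_ideal_power:
  assumes m: "m \<ge> 1"
  shows "path_ideal n m [^]\<^bsub>ideals_set (mpoly_ring n)\<^esub> t = (monomial_ideal n (path_powers n m t) :: 'k::field mpoly set)"
proof -
  let ?A = "{i. 1 \<le> i \<and> i + m \<le> n + 1}"
  have "{\<Prod>j\<in>{i..<i + m}. poly_var j | i. 1 \<le> i \<and> i + m \<le> n + 1} = (xmon ` path_exp m ` ?A :: 'k mpoly set)"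
    by (auto simp: prod_poly_var path_exp_def image_image)
  then have "path_ideal n m = (monomial_ideal n (\<Union>(multiples ` path_exp m ` ?A)) :: 'k mpoly set)"
    unfolding path_ideal_def using path_exp_exponents by (subst genideal_monomials[symmetric]) auto
  moreover have "upclosed (\<Union>(multiples ` path_exp m ` ?A))"
    using upclosed_multiples unfolding upclosed_def by blast
  ultimately show ?thesis by (simp only: monomial_ideal_power exponent_power_paths[OF m])
qed

section \<open>The upper bound\<close>

lemma path_powers_colon_last:
  assumes m: "m \<ge> 1" and n: "n \<ge> m"
  shows "{\<nu>. path_exp m (n + 1 - m) + \<nu> \<in> path_powers n m (Suc t)} = path_powers n m t"
proof (intro equalityI subsetI CollectI)
  fix \<nu> assume "\<nu> \<in> path_powers n m t"
  then show "path_exp m (n + 1 - m) + \<nu> \<in> path_powers n m (Suc t)"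
    by (rule path_powers_add_path) (use m n in auto)
next
  fix \<nu> assume "\<nu> \<in> {\<nu>. path_exp m (n + 1 - m) + \<nu> \<in> path_powers n m (Suc t)}"
  then have "path_exp m (n + 1 - m) + \<nu> \<in> path_powers n m (Suc t)" by simp
  then obtain c where c: "\<And>i. c i \<noteq> 0 \<Longrightarrow> 1 \<le> i \<and> i + m \<le> n + 1" "(\<Sum>i\<le>n. c i) = Suc t"
    "\<And>j. (\<Sum>i\<in>window m j. c i) \<le> lookup (path_exp m (n + 1 - m) + \<nu>) j" by (rule path_powersE) (rule that)
  have "\<exists>i\<le>n. c i > 0"
  proof (rule ccontr)
    assume "\<not> ?thesis"
    then have "(\<Sum>i\<le>n. c i) = 0" by simp
    with c(2) show False by simp
  qed
  then have ne: "{i. i \<le> n \<and> c i > 0} \<noteq> {}" by blast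
  have fin: "finite {i. i \<le> n \<and> c i > 0}" by simp
  \<comment> \<open>Dropping the factor with the largest starting point makes room for the last path.\<close>
  define i where "i = Max {i. i \<le> n \<and> c i > 0}"
  have i: "i \<le> n" "c i > 0" using Max_in[OF fin ne] unfolding i_def by blast+
  have max: "c k = 0" if "k > i" for k
  proof (rule ccontr)
    assume k: "c k \<noteq> 0"
    then have "k \<le> n" using c(1)[OF k] m by simp
    then have "k \<le> i" unfolding i_def using k by (intro Max_ge[OF fin]) simp
    with that show False by simp
  qed
  have im: "1 \<le> i" "i + m \<le> n + 1" using c(1)[of i] i(2) by auto
  let ?c = "c(i := c i - 1)"
  show "\<nu> \<in> path_powers n m t"
  proof (rule path_powersI[of ?c])
    show "1 \<le> k \<and> k + m \<le> n + 1" if "?c k \<noteq> 0" for k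
      using that c(1)[of k] im by (cases "k = i") auto
    show "(\<Sum>k\<le>n. ?c k) = t" using sum_fun_dec[of "{..n}" c i] i c(2) by simp
    show "(\<Sum>k\<in>window m j. ?c k) \<le> lookup \<nu> j" for j
    \<comment> \<open>From \<open>i + m\<close> on, no factor is left after dropping the path at
      \<open>i\<close>. Before \<open>i + m\<close>, each vertex of the last path also lies on the
      dropped one, as the latter starts no later; so the extra exponent there is
      compensated.\<close>
    proof (cases "j < i + m")
      case False
      then have "?c k = 0" if "k \<in> window m j" for k using that max[of k] by (auto simp: window_def)
      then have "(\<Sum>k\<in>window m j. ?c k) = 0" by (intro sum.neutral) blast
      then show ?thesis by simp
    next
      case True
      have "i \<in> window m j" if "n + 1 - m \<in> window m j" using that True im by (auto simp: window_def)
      then show ?thesis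
        using sum_fun_dec[where c = c and i = i, OF finite_window[of m j] i(2)] c(3)[of j] by (auto simp: lookup_add lookup_path_exp split: if_splits)
    qed
  qed
qed

lemma path_powers_mono:
  assumes "n \<le> n'" and m: "m \<ge> 1"
  shows "path_powers n m t \<subseteq> path_powers n' m t"
proof
  fix \<nu> assume "\<nu> \<in> path_powers n m t"
  then obtain c where c: "\<And>i. c i \<noteq> 0 \<Longrightarrow> 1 \<le> i \<and> i + m \<le> n + 1" "(\<Sum>i\<le>n. c i) = t"
    "\<And>j. (\<Sum>i\<in>window m j. c i) \<le> lookup \<nu> j" by (rule path_powersE) (rule that)
  have "(\<Sum>i\<le>n'. c i) = (\<Sum>i\<le>n. c i)"
    by (rule sum.mono_neutral_right) (use assms c(1) in fastforce)+
  then show "\<nu> \<in> path_powers n' m t" using c assms by (intro path_powersI[of c]) fastforce+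
qed

text \<open>No path inside the first \<open>n\<close> variables meets a later one, so the
  inequalities for \<open>j > n\<close> hold trivially.\<close>

lemma path_powers_restrict:
  assumes "n \<le> n'" and m: "m \<ge> 1"
    and c: "\<And>i. c i \<noteq> 0 \<Longrightarrow> 1 \<le> i \<and> i + m \<le> n + 1" "(\<Sum>i\<le>n'. c i) = t"
      "\<And>j. j \<le> n \<Longrightarrow> (\<Sum>i\<in>window m j. c i) \<le> lookup \<nu> j"
  shows "\<nu> \<in> path_powers n m t"
proof (rule path_powersI[of c])
  have "(\<Sum>i\<le>n'. c i) = (\<Sum>i\<le>n. c i)"
    by (rule sum.mono_neutral_right) (use assms(1) m c(1) in fastforce)+
  then show "(\<Sum>i\<le>n. c i) = t" using c(2) by simp
  show "(\<Sum>i\<in>window m j. c i) \<le> lookup \<nu> j" for j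
  proof (cases "j \<le> n")
    case False
    have "c i = 0" if "i \<in> window m j" for i using that c(1)[of i] False by (fastforce simp: window_def)
    then have "(\<Sum>i\<in>window m j. c i) = 0" by (intro sum.neutral) blast
    then show ?thesis by simp
  qed (rule c(3))
qed (rule c(1))

lemma path_powers_irrelevant:
  assumes "j0 > n" and m: "m \<ge> 1"
  shows "single j0 k + \<nu> \<in> path_powers n m t \<longleftrightarrow> \<nu> \<in> path_powers n m t"
proof
  assume "single j0 k + \<nu> \<in> path_powers n m t"
  then obtain c where c: "\<And>i. c i \<noteq> 0 \<Longrightarrow> 1 \<le> i \<and> i + m \<le> n + 1" "(\<Sum>i\<le>n. c i) = t"
    "\<And>j. (\<Sum>i\<in>window m j. c i) \<le> lookup (single j0 k + \<nu>) j" by (rule path_powersE) (rule that)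
  show "\<nu> \<in> path_powers n m t"
  proof (rule path_powers_restrict[OF order_refl m c(1,2)])
    show "(\<Sum>i\<in>window m j. c i) \<le> lookup \<nu> j" if "j \<le> n" for j
      using c(3)[of j] that assms(1) by (simp add: lookup_add lookup_single)
  qed
next
  assume "\<nu> \<in> path_powers n m t"
  then show "single j0 k + \<nu> \<in> path_powers n m t"
    using upclosed_path_powers unfolding upclosed_def by (metis add.commute)
qed

text \<open>Either the last path is one of the factors, and the monomial is a multiple of it, or all
  factors lie in the first \<open>n - 1\<close> variables.\<close>

lemma path_powers_Un_last:
  assumes m: "m \<ge> 1" and n: "n \<ge> m"
  shows "path_powers n m t \<union> multiples (path_exp m (n + 1 - m)) =
    path_powers (n - 1) m t \<union> multiples (path_exp m (n + 1 - m))"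
proof -
  have "\<nu> \<in> path_powers (n - 1) m t \<union> multiples (path_exp m (n + 1 - m))" if "\<nu> \<in> path_powers n m t" for \<nu>
  proof -
    from that obtain c where c: "\<And>i. c i \<noteq> 0 \<Longrightarrow> 1 \<le> i \<and> i + m \<le> n + 1" "(\<Sum>i\<le>n. c i) = t"
      "\<And>j. (\<Sum>i\<in>window m j. c i) \<le> lookup \<nu> j" by (rule path_powersE) (rule that)
    let ?g = "path_exp m (n + 1 - m)"
    show ?thesis
    proof (cases "c (n + 1 - m) = 0")
      case True
      have "\<nu> \<in> path_powers (n - 1) m t"
      proof (rule path_powers_restrict[of "n - 1" n, OF _ m _ c(2)])
        show "1 \<le> i \<and> i + m \<le> n - 1 + 1" if "c i \<noteq> 0" for i
        proof -
          have "i \<noteq> n + 1 - m" using that True by auto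
          then show ?thesis using c(1)[OF that] n by auto
        qed
      qed (use c(3) in auto)
      then show ?thesis by simp
    next
      case False
      have "\<nu> = ?g + (\<nu> - ?g)"
      proof (rule poly_mapping_eqI)
        fix j
        have "lookup \<nu> j \<ge> 1" if "n + 1 - m \<in> window m j"
          using c(3)[of j] member_le_sum[OF that, of c] False by simp
        then show "lookup \<nu> j = lookup (?g + (\<nu> - ?g)) j"
          by (simp add: lookup_add lookup_minus lookup_path_exp)
      qed
      then show ?thesis unfolding multiples_def by blast
    qed
  qed
  then show ?thesis using path_powers_mono[of "n - 1" n m t] m by auto
qed

lemma path_exp_shift:
  assumes m: "m \<ge> 1" and n: "n \<ge> m + 1"
  shows "path_exp m (n + 1 - m) + single (n - m) 1 = single n 1 + path_exp m (n - m)"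
  by (rule poly_mapping_eqI) (use assms in \<open>auto simp: lookup_add lookup_single lookup_path_exp window_def when_def\<close>)

text \<open>The variable at \<open>n - m\<close> times the last path equals the variable at
  \<open>n\<close> times the path before it. The variable at \<open>n\<close> is irrelevant for
  paths in the first \<open>n - 1\<close> variables, so what remains is the colon by the last path
  there.\<close>

lemma path_powers_colon_colon:
  assumes m: "m \<ge> 1" and n: "n \<ge> m + 1"
  shows "{\<nu>. single (n - m) 1 + \<nu> \<in> {\<nu>. path_exp m (n + 1 - m) + \<nu> \<in> path_powers (n - 1) m (Suc t)}} =
    path_powers (n - 1) m t"
proof -
  have "path_exp m (n + 1 - m) + (single (n - m) 1 + \<nu>) \<in> path_powers (n - 1) m (Suc t) \<longleftrightarrow>
      path_exp m (n - 1 + 1 - m) + \<nu> \<in> path_powers (n - 1) m (Suc t)" for \<nu>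
  proof -
    have "path_exp m (n + 1 - m) + (single (n - m) 1 + \<nu>) =
        single n 1 + (path_exp m (n - 1 + 1 - m) + \<nu>)"
      using path_exp_shift[OF assms] n by (simp add: add.assoc[symmetric])
    then show ?thesis using path_powers_irrelevant[of "n - 1" n m 1] m n by simp
  qed
  then have "{\<nu>. single (n - m) 1 + \<nu> \<in> {\<nu>. path_exp m (n + 1 - m) + \<nu> \<in> path_powers (n - 1) m (Suc t)}} =
      {\<nu>. path_exp m (n - 1 + 1 - m) + \<nu> \<in> path_powers (n - 1) m (Suc t)}" by simp
  also have "\<dots> = path_powers (n - 1) m t"
    by (rule path_powers_colon_last[OF m]) (use n in auto)
  finally show ?thesis .
qed

text \<open>If the variable at \<open>n - m\<close> does not divide the monomial \<nu>, no factor
  passes through it, as the last path begins only behind it. A factor ends at \<open>n - 1\<close>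
  or earlier, so it starts at \<open>n - m\<close> or earlier; avoiding \<open>n - m\<close>, it
  ends before it. The last path has no influence there.\<close>

lemma path_powers_colon_Un:
  assumes m: "m \<ge> 1" and n: "n \<ge> m + 1"
  shows "{\<nu>. path_exp m (n + 1 - m) + \<nu> \<in> path_powers (n - 1) m t} \<union> multiples (single (n - m) 1) =
    path_powers (n - m - 1) m t \<union> multiples (single (n - m) 1)"
proof -
  have "\<nu> \<in> path_powers (n - m - 1) m t \<union> multiples (single (n - m) 1)"
    if "path_exp m (n + 1 - m) + \<nu> \<in> path_powers (n - 1) m t" for \<nu>
  proof (cases "lookup \<nu> (n - m) > 0")
    case True
    then show ?thesis using keys_variable_decompose[OF True] unfolding multiples_def by blast
  next
    case False
    from that obtain c where c: "\<And>i. c i \<noteq> 0 \<Longrightarrow> 1 \<le> i \<and> i + m \<le> n - 1 + 1" "(\<Sum>i\<le>n - 1. c i) = t"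
      "\<And>j. (\<Sum>i\<in>window m j. c i) \<le> lookup (path_exp m (n + 1 - m) + \<nu>) j" by (rule path_powersE) (rule that)
    have z: "n + 1 - m \<notin> window m j" if "j \<le> n - m" for j using that n by (auto simp: window_def)
    have "(\<Sum>i\<in>window m (n - m). c i) = 0"
      using c(3)[of "n - m"] False z[of "n - m"] by (simp add: lookup_add lookup_path_exp)
    then have c0: "c i = 0" if "i \<in> window m (n - m)" for i using that by simp
    have "\<nu> \<in> path_powers (n - m - 1) m t"
    proof (rule path_powers_restrict[of "n - m - 1" "n - 1", OF _ m _ c(2)])
      show "1 \<le> i \<and> i + m \<le> n - m - 1 + 1" if "c i \<noteq> 0" for i
      proof -
        have "i \<notin> window m (n - m)" using c0[of i] that by auto
        then show ?thesis using c(1)[OF that] n by (auto simp: window_def)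
      qed
      show "(\<Sum>i\<in>window m j. c i) \<le> lookup \<nu> j" if "j \<le> n - m - 1" for j
        using c(3)[of j] z[of j] that by (simp add: lookup_add lookup_path_exp)
    qed auto
    then show ?thesis by simp
  qed
  moreover have "path_exp m (n + 1 - m) + \<nu> \<in> path_powers (n - 1) m t" if "\<nu> \<in> path_powers (n - m - 1) m t" for \<nu>
  proof -
    have "n - m - 1 \<le> n - 1" by simp
    then have "\<nu> \<in> path_powers (n - 1) m t" using that path_powers_mono[OF _ m] by blast
    then show ?thesis using upclosed_path_powers unfolding upclosed_def by (metis add.commute)
  qed
  ultimately show ?thesis by blast
qed

section \<open>Floor plus ceiling of \<open>k / (m + 1)\<close>, and the numerical recursion\<close>

definition div_sum :: "nat \<Rightarrow> nat \<Rightarrow> nat"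
  where "div_sum m k = k div (m + 1) + (k + m) div (m + 1)"

text \<open>One more than the projective dimension, so that it is \<open>0\<close> for the zero module.\<close>

definition pd_bound :: "nat \<Rightarrow> nat \<Rightarrow> nat \<Rightarrow> nat"
  where "pd_bound m n t = (if t = 0 then 0 else if n < m then 1
     else if t \<le> n + 1 - m then t - 1 + div_sum m (n + 2 - t) else n - m + 2)"

text \<open>The ceiling for \<open>k + 1\<close> is the floor for \<open>k\<close> plus one, and the
  floor for \<open>k + 1\<close> is at most the ceiling for \<open>k\<close>: the two summands
  change places.\<close>

lemma div_sum_Suc:
  assumes "m \<ge> 1"
  shows "div_sum m (Suc k) \<le> Suc (div_sum m k)"
proof -
  have "(Suc k + m) div (m + 1) = Suc (k div (m + 1))"
    using div_add_self2[of "m + 1" k] by (simp add: add.commute add.left_commute)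
  moreover have "Suc k div (m + 1) \<le> (k + m) div (m + 1)" using assms by (intro div_le_mono) simp
  ultimately show ?thesis by (simp add: div_sum_def)
qed

lemma div_sum_mono: "k \<le> l \<Longrightarrow> div_sum m k \<le> div_sum m l"
  unfolding div_sum_def by (intro add_mono div_le_mono) auto

lemma div_sum_shift: "div_sum m (k + (m + 1)) = div_sum m k + 2"
proof -
  have "(k + (m + 1) + m) div (m + 1) = (k + m + (m + 1)) div (m + 1)" by (simp add: add_ac)
  also have "\<dots> = (k + m) div (m + 1) + 1" by (rule div_add_self2) simp
  finally have 1: "(k + (m + 1) + m) div (m + 1) = (k + m) div (m + 1) + 1" .
  have 2: "(k + (m + 1)) div (m + 1) = k div (m + 1) + 1" by (rule div_add_self2) simp
  show ?thesis unfolding div_sum_def 1 2 by simp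
qed

lemma div_sum_base: "div_sum m (m + 1) = 2"
  using div_sum_shift[of m 0] by (simp add: div_sum_def)

lemma div_sum_ge_3:
  assumes "k \<ge> m + 2"
  shows "div_sum m k \<ge> 3"
proof -
  have "div_sum m (m + 2) = div_sum m 1 + 2" using div_sum_shift[of m 1] by simp
  moreover have "div_sum m 1 \<ge> 1" by (simp add: div_sum_def)
  ultimately show ?thesis using div_sum_mono[OF assms, of m] by simp
qed

text \<open>The two formulas agree at \<open>t = n + 1 - m\<close>, where \<open>div_sum\<close> is
  evaluated at \<open>m + 1\<close> and equals 2. Hence both ranges may include this value, which
  spares case distinctions later.\<close>

lemma pd_bound_cases:
  shows pd_bound_0: "pd_bound m n 0 = 0"
    and pd_bound_less: "t \<ge> 1 \<Longrightarrow> n < m \<Longrightarrow> pd_bound m n t = 1"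
    and pd_bound_le: "t \<ge> 1 \<Longrightarrow> n \<ge> m \<Longrightarrow> t \<le> n + 1 - m \<Longrightarrow> pd_bound m n t = t - 1 + div_sum m (n + 2 - t)"
    and pd_bound_gt: "t \<ge> 1 \<Longrightarrow> n \<ge> m \<Longrightarrow> t \<ge> n + 1 - m \<Longrightarrow> pd_bound m n t = n - m + 2"
proof -
  assume t: "t \<ge> 1" "n \<ge> m" "t \<ge> n + 1 - m"
  show "pd_bound m n t = n - m + 2"
  proof (cases "t = n + 1 - m")
    case True
    then have "n + 2 - t = m + 1" using t by simp
    then show ?thesis using True t div_sum_base[of m] by (simp add: pd_bound_def)
  qed (use t in \<open>simp add: pd_bound_def\<close>)
qed (auto simp: pd_bound_def)

text \<open>For the colon of the \<open>t\<close>-th power by the last path. In the main range, one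
  more factor gains 1 in the summand \<open>t - 1\<close> and loses at most 1 in
  \<open>div_sum\<close>.\<close>

lemma pd_bound_pred_t:
  assumes "m \<ge> 1" "n \<ge> m"
  shows "pd_bound m n t \<le> pd_bound m n (Suc t)"
proof -
  consider "t = 0" | "t \<ge> 1" "t \<ge> n + 1 - m" | "t \<ge> 1" "Suc t \<le> n + 1 - m" by linarith
  then show ?thesis
  proof cases
    case 1
    then show ?thesis by (simp add: pd_bound_0)
  next
    case 2
    then show ?thesis using assms by (simp add: pd_bound_gt)
  next
    case 3
    then have "n + 2 - t = Suc (n + 2 - Suc t)" by simp
    then have "div_sum m (n + 2 - t) \<le> Suc (div_sum m (n + 2 - Suc t))" using div_sum_Suc assms by simp
    moreover have "pd_bound m n t = t - 1 + div_sum m (n + 2 - t)" using 3 assms by (intro pd_bound_le) auto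
    moreover have "pd_bound m n (Suc t) = Suc t - 1 + div_sum m (n + 2 - Suc t)" using 3 assms by (intro pd_bound_le) auto
    ultimately show ?thesis using 3 by linarith
  qed
qed

lemma pd_bound_pred_n:
  assumes "m \<ge> 1" "n > m"
  shows "pd_bound m (n - 1) t \<le> pd_bound m n t"
proof -
  consider "t = 0" | "t \<ge> 1" "t \<ge> n + 1 - m" | "t \<ge> 1" "t \<le> n - m" by linarith
  then show ?thesis
  proof cases
    case 1
    then show ?thesis by (simp add: pd_bound_0)
  next
    case 2
    then show ?thesis using assms by (simp add: pd_bound_gt)
  next
    case 3
    have "div_sum m (n - 1 + 2 - t) \<le> div_sum m (n + 2 - t)" by (rule div_sum_mono) simp
    moreover have "pd_bound m (n - 1) t = t - 1 + div_sum m (n - 1 + 2 - t)" using 3 assms by (intro pd_bound_le) auto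
    moreover have "pd_bound m n t = t - 1 + div_sum m (n + 2 - t)" using 3 assms by (intro pd_bound_le) auto
    ultimately show ?thesis by linarith
  qed
qed

text \<open>For the colon by \<open>g\<close> and then by the variable. Lowering \<open>n\<close>
  and \<open>t\<close> together leaves the argument of \<open>div_sum\<close> unchanged, so in the
  main range exactly one step is gained.\<close>

lemma pd_bound_pred_both:
  assumes "m \<ge> 1" "n > m"
  shows "Suc (pd_bound m (n - 1) t) \<le> pd_bound m n (Suc t)"
proof -
  consider "t = 0" | "t \<ge> 1" "t \<ge> n - m" | "t \<ge> 1" "t < n - m" by linarith
  then show ?thesis
  proof cases
    case 1
    have "pd_bound m n 1 = div_sum m (n + 1)" using assms pd_bound_le[of 1 m n] by simp
    moreover have "div_sum m (n + 1) \<ge> 2" using div_sum_mono[of "m + 1" "n + 1" m] div_sum_base[of m] assms by simp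
    ultimately show ?thesis using 1 by (simp add: pd_bound_0)
  next
    case 2
    then show ?thesis using assms by (simp add: pd_bound_gt)
  next
    case 3
    then have "n - 1 + 2 - t = n + 2 - Suc t" by simp
    moreover have "pd_bound m (n - 1) t = t - 1 + div_sum m (n - 1 + 2 - t)" using 3 assms by (intro pd_bound_le) auto
    moreover have "pd_bound m n (Suc t) = Suc t - 1 + div_sum m (n + 2 - Suc t)" using 3 assms by (intro pd_bound_le) auto
    ultimately show ?thesis using 3 by simp
  qed
qed

text \<open>The two steps pay for adjoining the variable and \<open>g\<close>. In the main range,
  the argument of \<open>div_sum\<close> drops by \<open>m + 1\<close>, which costs exactly 2. The
  remaining cases are those in which one side or both are given by another branch of
  \<open>pd_bound\<close>.\<close>

lemma pd_bound_step:
  assumes m: "m \<ge> 1" and n: "n > m" and t: "t \<ge> 1"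
  shows "pd_bound m (n - m - 1) t + 2 \<le> pd_bound m n t"
proof -
  let ?n = "n - m - 1" and ?k = "n + 2 - t"
  have k: "?k = m + 1 \<or> ?k \<ge> m + 2" if "t \<le> n + 1 - m" using that n by linarith
  have R: "pd_bound m n t = t - 1 + div_sum m ?k" if "t \<le> n + 1 - m" using that n t by (intro pd_bound_le) auto
  consider "?n < m" | "?n \<ge> m" "t \<le> ?n + 1 - m" | "?n \<ge> m" "t > ?n + 1 - m" "t \<le> n + 1 - m" | "t > n + 1 - m" by linarith
  then show ?thesis
  proof cases
    case 1
    then have L: "pd_bound m ?n t = 1" using t by (simp add: pd_bound_less)
    show ?thesis
    proof (cases "t \<le> n + 1 - m")
      case True
      from k[OF True] show ?thesis
      proof
        assume "?k = m + 1"
        moreover from this have "t \<ge> 2" using n by linarith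
        ultimately show ?thesis unfolding L R[OF True] using div_sum_base[of m] by simp
      next
        assume "?k \<ge> m + 2"
        from div_sum_ge_3[OF this] show ?thesis unfolding L R[OF True] by simp
      qed
    next
      case False
      then show ?thesis unfolding L using n t by (simp add: pd_bound_gt)
    qed
  next
    case 2
    have k: "?k = (?n + 2 - t) + (m + 1)" using 2 n by simp
    have "div_sum m ?k = div_sum m (?n + 2 - t) + 2" unfolding k by (rule div_sum_shift)
    moreover have "pd_bound m ?n t = t - 1 + div_sum m (?n + 2 - t)" using 2 t by (intro pd_bound_le) auto
    moreover have "t \<le> n + 1 - m" using 2 by simp
    ultimately show ?thesis using R by simp
  next
    case 3
    have L: "pd_bound m ?n t = ?n - m + 2" using 3 t by (intro pd_bound_gt) auto
    from k[OF 3(3)] show ?thesis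
    proof
      assume "?k = m + 1"
      moreover from this have "t = n + 1 - m" using 3 n by linarith
      ultimately show ?thesis unfolding L R[OF 3(3)] using div_sum_base[of m] 3 n m by simp
    next
      assume "?k \<ge> m + 2"
      from div_sum_ge_3[OF this] show ?thesis unfolding L R[OF 3(3)] using 3 n m by linarith
    qed
  next
    case 4
    then have "pd_bound m n t = n - m + 2" using n t by (intro pd_bound_gt) auto
    moreover have "pd_bound m ?n t \<le> (if ?n < m then 1 else ?n - m + 2)"
      using 4 t by (auto simp: pd_bound_less pd_bound_gt)
    ultimately show ?thesis using n m by (auto split: if_splits)
  qed
qed

text \<open>The ring keeps its \<open>n0\<close> variables while \<open>n\<close> decreases, so that
  all modules in the exact sequences are over one ring. The outer induction is on \<open>n\<close>,
  the inner one on \<open>t\<close>.\<close>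

theorem mon_res_path_powers:
  assumes m: "m \<ge> 1"
  shows "n \<le> n0 \<Longrightarrow> mon_res TYPE('k::field) n0 (pd_bound m n t) (path_powers n m t)"
proof (induction n arbitrary: t rule: less_induct)
  case (less n)
  show ?case
  proof (induction t)
    case 0
    then show ?case using mon_res_UNIV by (simp add: path_powers_0 pd_bound_0)
  next
    case (Suc t)
    show ?case
    proof (cases "n < m")
      case True
      then show ?thesis using mon_res_empty by (simp add: path_powers_small pd_bound_less)
    next
      case False
      then have n: "n \<ge> m" by simp
      let ?g = "path_exp m (n + 1 - m)" and ?e = "pd_bound m n (Suc t)"
      have g: "?g \<in> exponents n0" using m n less.prems by (intro path_exp_exponents) auto
      have up: "upclosed (path_powers k m l)" for k l by (rule upclosed_path_powers)
      have "mon_res TYPE('k) n0 ?e (path_powers (n - 1) m (Suc t) \<union> multiples ?g)"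
      proof (cases "n = m")
        case True
        \<comment> \<open>No path fits into \<open>n - 1\<close> variables, so only the principal
          ideal of \<open>g\<close> remains.\<close>
        have e: "path_powers (n - 1) m (Suc t) = {}" using True m by (intro path_powers_small) auto
        have 1: "mon_res TYPE('k) n0 1 {}" by (rule mon_res_empty)
        have "upclosed {}" by (simp add: upclosed_def)
        note e0 = this
        have "mon_res TYPE('k) n0 (Suc 1) ({} \<union> multiples ?g)"
        proof (rule mon_res_Un[OF e0 g])
          show "mon_res TYPE('k) n0 1 {\<nu>. ?g + \<nu> \<in> {}}" using 1 by simp
          show "mon_res TYPE('k) n0 (Suc 1) {}" by (rule mon_res_mono[OF e0 1]) simp
        qed
        moreover have "?e \<ge> Suc 1" using True m pd_bound_gt[of "Suc t" m n] by simp
        ultimately show ?thesis unfolding e by (rule mon_res_mono[OF upclosed_Un[OF e0 upclosed_multiples]])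
      next
        case False
        then have n1: "n \<ge> m + 1" using n by simp
        let ?L = "{\<nu>. ?g + \<nu> \<in> path_powers (n - 1) m (Suc t)}" and ?x = "single (n - m) 1 :: nat \<Rightarrow>\<^sub>0 nat"
        have x: "?x \<in> exponents n0" using n1 less.prems by (intro single_var_exponents) auto
        \<comment> \<open>The ideal \<open>?L\<close> enters the resolution of the sum with
          \<open>g\<close> shifted by one, so it has one step less at its disposal than
          \<open>?e\<close>.\<close>
        obtain l where l: "?e = Suc l" using pd_bound_pred_both[of m n t] m n1 by (cases ?e) auto
        have "mon_res TYPE('k) n0 l ?L"
        proof (rule mon_res_middle[OF upclosed_colon[OF up] x])
          have "mon_res TYPE('k) n0 (pd_bound m (n - 1) t) (path_powers (n - 1) m t)"
            using n1 less.prems by (intro less.IH) auto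
          moreover have "pd_bound m (n - 1) t \<le> l" using pd_bound_pred_both[of m n t] m n1 l by simp
          ultimately show "mon_res TYPE('k) n0 l {\<nu>. ?x + \<nu> \<in> ?L}"
            unfolding path_powers_colon_colon[OF m n1] by (rule mon_res_mono[OF up])
          let ?l = "pd_bound m (n - m - 1) (Suc t)"
          have r: "mon_res TYPE('k) n0 ?l (path_powers (n - m - 1) m (Suc t))"
            using n1 less.prems by (intro less.IH) auto
          \<comment> \<open>The variable lies behind all these paths, so the colon by it changes
            nothing and adjoining it costs one step.\<close>
          have "{\<nu>. ?x + \<nu> \<in> path_powers (n - m - 1) m (Suc t)} = path_powers (n - m - 1) m (Suc t)"
            using path_powers_irrelevant[of "n - m - 1" "n - m" m 1] m n1 by simp
          then have "mon_res TYPE('k) n0 (Suc ?l) (path_powers (n - m - 1) m (Suc t) \<union> multiples ?x)"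
            using r by (intro mon_res_Un[OF up x] mon_res_mono[OF up r]) simp_all
          moreover have "Suc ?l \<le> l" using pd_bound_step[of m n "Suc t"] m n1 l by simp
          ultimately show "mon_res TYPE('k) n0 l (?L \<union> multiples ?x)"
            unfolding path_powers_colon_Un[OF m n1] by (rule mon_res_mono[OF upclosed_Un[OF up upclosed_multiples]])
        qed
        moreover have "mon_res TYPE('k) n0 (Suc l) (path_powers (n - 1) m (Suc t))"
        proof (rule mon_res_mono[OF up])
          show "mon_res TYPE('k) n0 (pd_bound m (n - 1) (Suc t)) (path_powers (n - 1) m (Suc t))"
            using n1 less.prems by (intro less.IH) auto
          show "pd_bound m (n - 1) (Suc t) \<le> Suc l" using pd_bound_pred_n[of m n "Suc t"] m n1 l by simp
        qed
        ultimately show ?thesis unfolding l by (intro mon_res_Un[OF up g])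
      qed
      moreover have "mon_res TYPE('k) n0 ?e {\<nu>. ?g + \<nu> \<in> path_powers n m (Suc t)}"
        unfolding path_powers_colon_last[OF m n]
        by (rule mon_res_mono[OF up Suc.IH pd_bound_pred_t[OF m n]])
      ultimately show ?thesis
        unfolding path_powers_Un_last[OF m n, symmetric] by (intro mon_res_middle[OF up g])
    qed
  qed
qed

section \<open>The lower bound\<close>

lemma window_residue:
  assumes "m \<ge> 1" "\<rho> < m"
  shows "\<exists>!j. i \<in> window m j \<and> j mod m = \<rho>"
proof -
  define x where "x = (\<rho> + (m - i mod m)) mod m"
  have "i mod m < m" using assms by simp
  have "(i + x) mod m = (i mod m + (\<rho> + (m - i mod m))) mod m"
    unfolding x_def by (simp add: mod_add_left_eq mod_add_right_eq)
  also have "i mod m + (\<rho> + (m - i mod m)) = \<rho> + m" using \<open>i mod m < m\<close> by simp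
  finally have "(i + x) mod m = \<rho>" using assms by simp
  moreover have "x < m" using assms by (simp add: x_def)
  ultimately have ex: "i \<in> window m (i + x) \<and> (i + x) mod m = \<rho>" by (simp add: window_def)
  have uniq: "j = j'" if "i \<in> window m j" "i \<in> window m j'" "j mod m = j' mod m" "j \<le> j'" for j j'
  proof -
    have "m dvd j' - j" using mod_eq_dvd_iff_nat[OF that(4), of m] that(3) by simp
    moreover have "j' - j < m" using that by (auto simp: window_def)
    ultimately have "j' - j = 0" by (meson dvd_imp_le not_le gr0I)
    with that(4) show ?thesis by simp
  qed
  show ?thesis
  proof (rule ex1I[of _ "i + x"])
    show "i \<in> window m (i + x) \<and> (i + x) mod m = \<rho>" by (rule ex)
    fix j assume "i \<in> window m j \<and> j mod m = \<rho>"
    then show "j = i + x" using uniq[of j "i + x"] uniq[of "i + x" j] ex by (metis nat_le_linear)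
  qed
qed

text \<open>Every path meets every residue class modulo \<open>m\<close> exactly once.\<close>

lemma sum_residue_windows:
  assumes m: "m \<ge> 1" and \<rho>: "\<rho> < m" and c: "\<And>i. c i \<noteq> 0 \<Longrightarrow> 1 \<le> i \<and> i + m \<le> N + 1" and "N \<le> n"
  shows "(\<Sum>j\<in>{j \<in> {1..N}. j mod m = \<rho>}. \<Sum>i\<in>window m j. c i) = (\<Sum>i\<le>n. c i :: nat)"
proof -
  let ?A = "{j \<in> {1..N}. j mod m = \<rho>}"
  have "(\<Sum>i\<in>window m j. c i) = (\<Sum>i\<le>n. if i \<in> window m j then c i else 0)" if "j \<in> ?A" for j
  proof -
    have "window m j \<subseteq> {..n}" using that \<open>N \<le> n\<close> by (auto simp: window_def)
    then have "{..n} \<inter> window m j = window m j" by blast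
    then show ?thesis using sum.inter_restrict[of "{..n}" c "window m j"] by simp
  qed
  then have "(\<Sum>j\<in>?A. \<Sum>i\<in>window m j. c i) = (\<Sum>j\<in>?A. \<Sum>i\<le>n. if i \<in> window m j then c i else 0)"
    by (rule sum.cong[OF refl])
  also have "\<dots> = (\<Sum>i\<le>n. \<Sum>j\<in>?A. if i \<in> window m j then c i else 0)" by (rule sum.swap)
  also have "\<dots> = (\<Sum>i\<le>n. c i)"
  proof (rule sum.cong[OF refl])
    fix i
    show "(\<Sum>j\<in>?A. if i \<in> window m j then c i else 0) = c i"
    proof (cases "c i = 0")
      case False
      note ex1 = window_residue[OF m \<rho>, of i]
      define j where "j = (THE j. i \<in> window m j \<and> j mod m = \<rho>)"
      have j: "i \<in> window m j \<and> j mod m = \<rho>" unfolding j_def by (rule theI'[OF ex1])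
      have uniq: "j' = j" if "i \<in> window m j' \<and> j' mod m = \<rho>" for j'
        unfolding j_def by (rule the1_equality[OF ex1 that, symmetric])
      have "j \<in> ?A" using j c[OF False] by (auto simp: window_def)
      have "(\<Sum>j\<in>?A. if i \<in> window m j then c i else 0) = (\<Sum>j'\<in>?A. if j' = j then c i else 0)"
      proof (rule sum.cong[OF refl])
        fix j' assume "j' \<in> ?A"
        then have "i \<in> window m j' \<longleftrightarrow> j' = j" using uniq[of j'] j(1) by auto
        then show "(if i \<in> window m j' then c i else 0) = (if j' = j then c i else 0)" by simp
      qed
      also have "\<dots> = c i" using \<open>j \<in> ?A\<close> by simp
      finally show ?thesis .
    qed simp
  qed
  finally show ?thesis .
qed

text \<open>The window of \<open>j\<close> is the interval of the \<open>m\<close> starting points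
  up to \<open>j\<close>. For \<open>j < m\<close> it begins at 0, whose increment is set to zero,
  and the truncated difference \<open>j - m\<close> is 0 as well; so the formula covers this
  case.\<close>

lemma telescope_window:
  fixes E :: "nat \<Rightarrow> int"
  assumes "m \<ge> 1"
  shows "(\<Sum>i\<in>window m j. if i = 0 then 0 else E i - E (i - 1)) = E j - E (j - m)"
proof -
  let ?d = "\<lambda>i. if i = 0 then 0 else E i - E (i - 1)"
  have pre: "(\<Sum>i\<le>k. ?d i) = E k - E 0" for k by (induction k) auto
  show ?thesis
  proof (cases "j < m")
    case True
    then have "window m j = {..j}" by (auto simp: window_def)
    then show ?thesis using True pre[of j] by simp
  next
    case False
    have "{..j} = {..j - m} \<union> window m j" "{..j - m} \<inter> window m j = {}" using False assms by (auto simp: window_def)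
    then have "(\<Sum>i\<le>j. ?d i) = (\<Sum>i\<le>j - m. ?d i) + (\<Sum>i\<in>window m j. ?d i)" by (simp add: sum.union_disjoint)
    then show ?thesis using pre[of j] pre[of "j - m"] by simp
  qed
qed

section \<open>The variables, colours and monomial of the Koszul class\<close>

locale lower_bound =
  fixes n m t t0 N :: nat
  assumes m: "m \<ge> 1" and n: "n \<ge> m" and t: "t \<ge> 1"
    and t0: "t0 = min t (n - m)" and N: "N = t0 + m"
begin

lemma N_le: "N \<le> n" "m \<le> N" using N t0 n by auto

text \<open>The multiplicities of a product of \<open>t - 1\<close> paths inside \<open>2, \<dots>, N - 1\<close> (of copies of the first
  path, as far as there are not enough others).\<close>

definition mult :: "nat \<Rightarrow> nat"
  where "mult i = (if i = 1 then t - max t0 1 else if 2 \<le> i \<and> i \<le> t0 then 1 else 0)"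

text \<open>The first and last vertices of the blocks of \<open>m + 1\<close> vertices behind \<open>N\<close>; the last block may lack
  its last vertex.\<close>

definition firsts :: "nat set" where "firsts = (\<lambda>p. N + p * (m + 1) + 1) ` {..<(n - N + 1) div (m + 1)}"

definition lasts :: "nat set" where "lasts = (\<lambda>p. N + (p + 1) * (m + 1)) ` {..<(n - N) div (m + 1)}"

text \<open>Counted from \<open>N\<close>, the blocks begin at residue 1 and end at residue 0 modulo
  \<open>m + 1\<close>; all other residues lie strictly inside.\<close>

definition inner :: "nat \<Rightarrow> bool"
  where "inner j \<longleftrightarrow> N < j \<and> (j - N) mod (m + 1) \<notin> {0, 1}"

definition base_exp :: "nat \<Rightarrow> nat"
  where "base_exp j = (\<Sum>i\<in>window m j. mult i) + (if inner j then 1 else 0)"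

definition base :: "nat \<Rightarrow>\<^sub>0 nat"
  where "base = (\<Sum>j\<in>{1..n}. single j (base_exp j))"

definition verts :: "nat set" where "verts = {1..N} \<union> (firsts \<union> lasts)"

definition colour :: "nat \<Rightarrow> nat" where "colour w = (if w \<le> N then w mod m else 0)"

lemma mult_support: "mult i \<noteq> 0 \<Longrightarrow> 1 \<le> i \<and> i \<le> max t0 1"
  by (auto simp: mult_def split: if_splits)

lemma mult_range: "mult i \<noteq> 0 \<Longrightarrow> 1 \<le> i \<and> i + m \<le> N + 1"
  using mult_support[of i] N by fastforce

lemma mult_range_n: "mult i \<noteq> 0 \<Longrightarrow> 1 \<le> i \<and> i + m \<le> n + 1"
  using mult_range[of i] N_le by fastforce

lemma sum_mult: "(\<Sum>i\<le>n. mult i) = t - 1"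
proof -
  have "(\<Sum>i\<le>n. mult i) = (\<Sum>i\<in>{1..max t0 1}. mult i)"
  proof (rule sum.mono_neutral_right)
    show "{1..max t0 1} \<subseteq> {..n}" using t0 n m by auto
    show "\<forall>i\<in>{..n} - {1..max t0 1}. mult i = 0" using mult_support by (meson DiffE atLeastAtMost_iff)
  qed simp
  also have "{1..max t0 1} = insert 1 {2..t0}" by auto
  also have "(\<Sum>i\<in>insert 1 {2..t0}. mult i) = mult 1 + (\<Sum>i\<in>{2..t0}. mult i)" by (subst sum.insert) auto
  also have "(\<Sum>i\<in>{2..t0}. mult i) = (\<Sum>i\<in>{2..t0}. 1)" by (rule sum.cong) (auto simp: mult_def)
  also have "mult 1 + \<dots> = t - 1"
  proof -
    have "mult 1 = t - max t0 1" by (simp add: mult_def)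
    then show ?thesis using t t0 by (cases "t0 = 0") simp_all
  qed
  finally show ?thesis .
qed

lemma lookup_base: "lookup base j = (if j \<in> {1..n} then base_exp j else 0)"
  by (simp add: base_def lookup_sum lookup_single when_def)

lemma base_exponents: "base \<in> exponents n"
  unfolding exponents_def by (auto simp: in_keys_iff lookup_base split: if_splits)

lemma window_mult_le: "(\<Sum>i\<in>window m j. mult i) \<le> lookup base j"
proof (cases "j \<in> {1..n}")
  case True
  then show ?thesis by (simp add: lookup_base base_exp_def)
next
  case False
  have "mult i = 0" if "i \<in> window m j" for i
    using that mult_range_n[of i] False by (fastforce simp: window_def)
  then have "(\<Sum>i\<in>window m j. mult i) = 0" by (intro sum.neutral) blast
  then show ?thesis by simp
qed

lemma firsts_bounds:
  assumes "y = N + p * (m + 1) + 1" "p < (n - N + 1) div (m + 1)"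
  shows "N < y" "y + m \<le> n + 1"
proof -
  have "(p + 1) * (m + 1) \<le> (n - N + 1) div (m + 1) * (m + 1)" using assms(2) by (intro mult_le_mono1) simp
  also have "\<dots> \<le> n - N + 1" by (rule div_times_less_eq_dividend)
  finally show "N < y" "y + m \<le> n + 1" using assms(1) N_le by (simp_all add: algebra_simps)
qed

lemma lasts_bounds:
  assumes "y = N + (p + 1) * (m + 1)" "p < (n - N) div (m + 1)"
  shows "N < y" "y \<le> n"
proof -
  have "(p + 1) * (m + 1) \<le> (n - N) div (m + 1) * (m + 1)" using assms(2) by (intro mult_le_mono1) simp
  also have "\<dots> \<le> n - N" by (rule div_times_less_eq_dividend)
  finally have "(p + 1) * (m + 1) \<le> n - N" .
  then show "y \<le> n" using assms(1) N_le by linarith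
  show "N < y" using assms(1) by simp
qed

lemma verts_subset: "verts \<subseteq> {1..n}"
proof -
  have "firsts \<subseteq> {1..n}" using firsts_bounds m by (fastforce simp: firsts_def)
  moreover have "lasts \<subseteq> {1..n}" using lasts_bounds by (fastforce simp: lasts_def)
  ultimately show ?thesis using N_le unfolding verts_def by auto
qed

text \<open>The path starts at a first vertex or ends at a last vertex of a block; as it has one
  vertex less than the block, its other vertices are inner. It will supply the factor that the
  \<open>t - 1\<close> paths of \<open>base\<close> lack.\<close>

lemma verts_gt:
  assumes "y \<in> verts" "y > N"
  obtains a where "1 \<le> a" "a + m \<le> n + 1" "\<And>j. a \<in> window m j \<Longrightarrow> j = y \<or> inner j \<and> j \<in> {1..n}"
proof -
  from assms have "y \<in> firsts \<or> y \<in> lasts" by (auto simp: verts_def)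
  then show thesis
  proof
    assume "y \<in> firsts"
    then obtain p where p: "y = N + p * (m + 1) + 1" "p < (n - N + 1) div (m + 1)" by (auto simp: firsts_def)
    note b = firsts_bounds[OF p]
    show thesis
    proof (rule that[of y])
      fix j assume j: "y \<in> window m j"
      show "j = y \<or> inner j \<and> j \<in> {1..n}"
      proof (cases "j = y")
        case False
        define i where "i = j - y"
        have i: "j = y + i" "1 \<le> i" "i < m" using j False by (auto simp: window_def i_def)
        have "j - N = (i + 1) + p * (m + 1)" using i p by simp
        then have "(j - N) mod (m + 1) = (i + 1) mod (m + 1)" by (simp only: mod_mult_self1)
        also have "\<dots> = i + 1" using i by simp
        finally show ?thesis using i b by (auto simp: inner_def)
      qed simp
    qed (use b in auto)
  next
    assume "y \<in> lasts"
    then obtain p where p: "y = N + (p + 1) * (m + 1)" "p < (n - N) div (m + 1)" by (auto simp: lasts_def)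
    note b = lasts_bounds[OF p]
    have ym: "y \<ge> N + m + 1" using p(1) by simp
    show thesis
    proof (rule that[of "y + 1 - m"])
      fix j assume j: "y + 1 - m \<in> window m j"
      show "j = y \<or> inner j \<and> j \<in> {1..n}"
      proof (cases "j = y")
        case False
        define i where "i = y - j"
        have i: "y = j + i" "1 \<le> i" "i < m" using j False ym m by (auto simp: window_def i_def)
        have "j - N = (m + 1 - i) + p * (m + 1)" using i p(1) by simp
        then have "(j - N) mod (m + 1) = (m + 1 - i) mod (m + 1)" by (simp only: mod_mult_self1)
        also have "\<dots> = m + 1 - i" using i by simp
        finally show ?thesis using i b ym by (auto simp: inner_def)
      qed simp
    qed (use b ym m in auto)
  qed
qed

text \<open>A transversal that uses a variable behind \<open>N\<close> completes a new path with the
  inner variables of a block. Otherwise it consists of one variable of each residue class in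
  \<open>{1..N}\<close>, which in general do not form a path, and the existing factors have to be
  rearranged.\<close>

lemma transversal:
  assumes \<tau>: "\<And>k. k < m \<Longrightarrow> \<tau> k \<in> verts \<and> colour (\<tau> k) = k"
  shows "base + (\<Sum>k<m. single (\<tau> k) 1) \<in> path_powers n m t"
proof -
  let ?e = "\<Sum>k<m. single (\<tau> k) 1 :: nat \<Rightarrow>\<^sub>0 nat"
  have look: "lookup ?e j \<ge> 1" if "k < m" "\<tau> k = j" for k j
  proof -
    have "(1::nat) = (\<Sum>k\<in>{k}. if \<tau> k = j then 1 else 0)" using that by simp
    also have "\<dots> \<le> (\<Sum>k<m. if \<tau> k = j then 1 else 0)" using that by (intro sum_mono2) auto
    finally show ?thesis by (simp add: lookup_sum lookup_single when_def del: One_nat_def)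
  qed
  show ?thesis
  proof (cases "\<exists>k<m. \<tau> k > N")
    case True
    then obtain k where k: "k < m" "\<tau> k > N" by blast
    obtain a where a: "1 \<le> a" "a + m \<le> n + 1" "\<And>j. a \<in> window m j \<Longrightarrow> j = \<tau> k \<or> inner j \<and> j \<in> {1..n}"
      using verts_gt[of "\<tau> k"] \<tau>[OF k(1)] k(2) by blast
    show ?thesis
    proof (rule path_powersI[of "\<lambda>i. mult i + (if i = a then 1 else 0)"])
      show "1 \<le> i \<and> i + m \<le> n + 1" if "mult i + (if i = a then 1 else 0) \<noteq> 0" for i
        using that mult_range_n[of i] a(1,2) by (cases "i = a") auto
      show "(\<Sum>i\<le>n. mult i + (if i = a then 1 else 0)) = t"
        using sum_add_one[of "{..n}" mult a] sum_mult a m t by simp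
      show "(\<Sum>i\<in>window m j. mult i + (if i = a then 1 else 0)) \<le> lookup (base + ?e) j" for j
      proof (cases "a \<in> window m j")
        case False
        then show ?thesis using sum_add_one[of "window m j" mult a] window_mult_le[of j] by (simp add: lookup_add)
      next
        case aj: True
        from a(3)[OF aj] show ?thesis
        proof
          assume "j = \<tau> k"
          then show ?thesis
            using sum_add_one[of "window m j" mult a] window_mult_le[of j] look[OF k(1), of j] aj by (simp add: lookup_add)
        next
          assume "inner j \<and> j \<in> {1..n}"
          then show ?thesis
            using sum_add_one[of "window m j" mult a] aj by (simp add: lookup_add lookup_base base_exp_def)
        qed
      qed
    qed
  next
    case False
    then have \<tau>N: "1 \<le> \<tau> k" "\<tau> k \<le> N" "\<tau> k mod m = k" if "k < m" for k
      using \<tau>[OF that] verts_subset that by (auto simp: colour_def)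
    \<comment> \<open>The last starting point of a path inside \<open>{1..N}\<close>. Freezing
      \<open>E\<close> from there on keeps the rearranged paths inside.\<close>
    define P where "P = t0 + 1"
    \<comment> \<open>Along each residue class, \<open>B\<close> jumps from 0 to 1 at the chosen
      variable. So a difference over the distance \<open>m\<close>, which is what a window sum of
      increments yields, is positive only at a chosen variable, where the exponent has
      grown.\<close>
    define B where "B = (\<lambda>j. if \<tau> (j mod m) \<le> j then 1 else 0 :: int)"
    \<comment> \<open>Multiplying by the transversal moves the starting points of the paths: the new multiplicities are
      those of the \<open>t - 1\<close> paths plus the increments of \<open>B\<close>.\<close>
    define E where "E = (\<lambda>j. B (min j P))"
    define d where "d = (\<lambda>i. if i = 0 then 0 else E i - E (i - 1))"
    have jm: "j mod m < m" for j using m by simp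
    have eqmod: "a \<ge> b + m" if "a mod m = b mod m" "a > b" for a b
    proof -
      have "m dvd a - b" using mod_eq_dvd_iff_nat[of b a m] that by simp
      then have "m \<le> a - b" using that(2) by (intro dvd_imp_le) auto
      then show ?thesis using that(2) by linarith
    qed
    have B0: "B 0 = 0" using \<tau>N(1)[of 0] m by (auto simp: B_def)
    have BP: "B j = 1" if "j \<ge> P" for j
    proof -
      have "\<tau> (j mod m) \<le> j"
      proof (rule ccontr)
        assume "\<not> ?thesis"
        then have "\<tau> (j mod m) \<ge> j + m" using eqmod[of "\<tau> (j mod m)" j] \<tau>N(3)[OF jm] by simp
        then show False using \<tau>N(2)[OF jm, of j] that by (simp add: P_def N)
      qed
      then show ?thesis by (simp add: B_def)
    qed
    have B01: "B j = 0 \<or> B j = 1" for j by (simp add: B_def)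
    have EP: "E j = 1" if "j \<ge> P" for j using that BP[of P] by (simp add: E_def)
    have E0: "E 0 = 0" using B0 by (simp add: E_def)
    have d_supp: "1 \<le> i \<and> i \<le> P" if "d i \<noteq> 0" for i
    proof (rule ccontr)
      assume "\<not> ?thesis"
      then have "i = 0 \<or> i - 1 \<ge> P" by auto
      with that EP show False by (auto simp: d_def)
    qed
    \<comment> \<open>An increment of -1 is absorbed by the path of \<open>base\<close> starting
      there, for starting points 2 to \<open>t0\<close>. At 1 and at \<open>P\<close> the increment
      is nonnegative, because \<open>E\<close> begins with 0 and ends with 1.\<close>
    have d_ge: "int (mult i) + d i \<ge> 0" for i
    proof -
      consider "i = 0 \<or> i > P" | "i = 1" | "2 \<le> i" "i \<le> t0" | "i = P" "i \<ge> 2" by (auto simp: P_def) linarith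
      then show ?thesis
      proof cases
        case 1
        then have "d i = 0" using d_supp[of i] by fastforce
        then show ?thesis by simp
      next
        case 2
        then have "d i = E 1" by (simp add: d_def E0)
        then show ?thesis using B01[of "min 1 P"] by (auto simp: E_def)
      next
        case 3
        then have "mult i = 1" by (simp add: mult_def)
        moreover have "d i \<ge> -1" using B01[of "min i P"] B01[of "min (i - 1) P"] by (auto simp: d_def E_def)
        ultimately show ?thesis by simp
      next
        case 4
        then have "d i = 1 - E (i - 1)" by (simp add: d_def EP)
        then show ?thesis using B01[of "min (i - 1) P"] by (auto simp: E_def)
      qed
    qed
    define c where "c = (\<lambda>i. nat (int (mult i) + d i))"
    have intc: "int (c i) = int (mult i) + d i" for i using d_ge[of i] by (simp add: c_def)
    have P_le: "P + m = N + 1" by (simp add: P_def N)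
    show ?thesis
    proof (rule path_powersI[of c])
      show "1 \<le> i \<and> i + m \<le> n + 1" if "c i \<noteq> 0" for i
      proof -
        have "mult i \<noteq> 0 \<or> d i \<noteq> 0" using that intc[of i] by auto
        then show ?thesis using mult_range_n[of i] d_supp[of i] P_le N_le by fastforce
      qed
      have "int (\<Sum>i\<le>n. c i) = int (\<Sum>i\<le>n. mult i) + (\<Sum>i\<le>n. d i)" by (simp add: intc sum.distrib)
      also have "(\<Sum>i\<le>n. d i) = E n - E 0"
      proof -
        have "(\<Sum>i\<le>k. d i) = E k - E 0" for k by (induction k) (auto simp: d_def)
        then show ?thesis .
      qed
      also have "E n = 1" using P_le N_le m by (intro EP) simp
      finally have "int (\<Sum>i\<le>n. c i) = int (t - 1) + (1 - 0)" unfolding sum_mult E0 .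
      also have "\<dots> = int t" using t by simp
      finally show "(\<Sum>i\<le>n. c i) = t" by (simp only: of_nat_eq_iff)
      show "(\<Sum>i\<in>window m j. c i) \<le> lookup (base + ?e) j" for j
      proof -
        have "int (\<Sum>i\<in>window m j. c i) = int (\<Sum>i\<in>window m j. mult i) + (\<Sum>i\<in>window m j. d i)"
          by (simp add: intc sum.distrib)
        also have "(\<Sum>i\<in>window m j. d i) = E j - E (j - m)"
          unfolding d_def by (rule telescope_window[OF m])
        \<comment> \<open>In the only case with a positive difference, the chosen variable of the
          class of \<open>j\<close> is at most \<open>j\<close> and, if \<open>j\<close> is at least
          \<open>m\<close>, greater than \<open>j - m\<close>; being congruent to \<open>j\<close>,
          it is \<open>j\<close> itself.\<close>
        also have "E j - E (j - m) \<le> int (lookup ?e j)"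
        proof (cases "E j = 1 \<and> E (j - m) = 0")
          case False
          have "E j = 0 \<or> E j = 1" "E (j - m) = 0 \<or> E (j - m) = 1" using B01 by (auto simp: E_def)
          with False have "E j - E (j - m) \<le> 0" by auto
          then show ?thesis by simp
        next
          case True
          have jP: "j - m < P" using True EP[of "j - m"] by force
          then have "B (j - m) = 0" using True by (simp add: E_def)
          moreover have "(j - m) mod m = j mod m" if "j \<ge> m" using that by (simp add: le_mod_geq)
          ultimately have lo: "\<tau> (j mod m) > j - m" if "j \<ge> m" using that by (auto simp: B_def split: if_splits)
          have up: "\<tau> (j mod m) \<le> j"
          proof (cases "j \<le> P")
            case True
            then have "B j = 1" using \<open>E j = 1 \<and> E (j - m) = 0\<close> by (simp add: E_def)
            then show ?thesis by (simp add: B_def split: if_splits)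
          next
            case False
            then have "B j = 1" by (intro BP) simp
            then show ?thesis by (simp add: B_def split: if_splits)
          qed
          have "\<tau> (j mod m) = j"
          proof (rule ccontr)
            assume "\<tau> (j mod m) \<noteq> j"
            then have "j \<ge> \<tau> (j mod m) + m" using eqmod[of j "\<tau> (j mod m)"] \<tau>N(3)[OF jm] up by simp
            moreover from this have "j \<ge> m" by simp
            ultimately show False using lo by simp
          qed
          then have "lookup ?e j \<ge> 1" using look[OF jm] by blast
          then show ?thesis using True by simp
        qed
        finally have "int (\<Sum>i\<in>window m j. c i) \<le> int (\<Sum>i\<in>window m j. mult i) + int (lookup ?e j)" by simp
        then have "(\<Sum>i\<in>window m j. c i) \<le> (\<Sum>i\<in>window m j. mult i) + lookup ?e j"
          by (simp only: of_nat_add[symmetric] of_nat_le_iff)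
        then show ?thesis unfolding lookup_add using window_mult_le[of j] by (rule order_trans[OF _ add_right_mono])
      qed
    qed
  qed
qed

text \<open>The chosen transversal consists of the variables 1 to \<open>m\<close>, that is, of the
  first path; residue 0 is represented by \<open>m\<close>.\<close>

definition rep :: "nat \<Rightarrow> nat" where "rep k = (if k = 0 then m else k)"

lemma rep:
  assumes "k < m"
  shows "rep k \<in> verts \<and> colour (rep k) = k"
  using assms N_le m by (auto simp: rep_def verts_def colour_def)

text \<open>The block ends behind \<open>N\<close> have exponent 0, and every path leaving
  \<open>{1..N}\<close> meets such an end. So all \<open>t\<close> factors lie in
  \<open>{1..N}\<close>, where each meets the residue class of \<open>j0\<close> once. With the
  representative of this class removed, the exponents of the class sum to \<open>t - 1\<close>
  only.\<close>

lemma minimal: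
  assumes j0: "j0 < m"
  shows "base + (\<Sum>k\<in>{..<m} - {j0}. single (rep k) 1) \<notin> path_powers n m t"
proof
  let ?e = "\<Sum>k\<in>{..<m} - {j0}. single (rep k) 1 :: nat \<Rightarrow>\<^sub>0 nat"
  have le: "lookup ?e j = (\<Sum>k\<in>{..<m} - {j0}. if rep k = j then 1 else 0)" for j
    by (simp add: lookup_sum lookup_single when_def del: One_nat_def)
  have e_gt: "lookup ?e j = 0" if "j > N" for j
    unfolding le using that N_le m by (intro sum.neutral) (auto simp: rep_def)
  have e_res: "lookup ?e j = 0" if "j mod m = j0" for j
    unfolding le using that by (intro sum.neutral) (auto simp: rep_def)
  assume "base + ?e \<in> path_powers n m t"
  then obtain c where c: "\<And>i. c i \<noteq> 0 \<Longrightarrow> 1 \<le> i \<and> i + m \<le> n + 1" "(\<Sum>i\<le>n. c i) = t"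
    "\<And>j. (\<Sum>i\<in>window m j. c i) \<le> lookup (base + ?e) j" by (rule path_powersE) (rule that)
  have gap: "c i = 0" if "i \<in> window m j" "j > N" "(j - N) mod (m + 1) \<in> {0, 1}" for i j
  proof -
    have "mult k = 0" if "k \<in> window m j" for k
      using that \<open>j > N\<close> mult_range[of k] by (fastforce simp: window_def)
    then have "base_exp j = 0" using that(3) by (auto simp: base_exp_def inner_def)
    then have "lookup (base + ?e) j = 0" using e_gt[OF that(2)] by (simp add: lookup_add lookup_base)
    then have "(\<Sum>i\<in>window m j. c i) = 0" using c(3)[of j] by simp
    then show ?thesis using that(1) by simp
  qed
  have c': "1 \<le> i \<and> i + m \<le> N + 1" if ci: "c i \<noteq> 0" for i
  proof (rule ccontr)
    assume "\<not> ?thesis"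
    then have i: "i + m > N + 1" using c(1)[OF ci] by auto
    show False
    proof (cases "i \<le> N + 1")
      case True
      have "i \<in> window m (N + 1)" using True i by (simp add: window_def)
      moreover have "(N + 1 - N) mod (m + 1) \<in> {0, 1}" using m by simp
      ultimately have "c i = 0" by (intro gap[of i "N + 1"]) simp_all
      with ci show False by simp
    next
      case False
      define \<rho> where "\<rho> = (i - N) mod (m + 1)"
      show False
      proof (cases "\<rho> \<in> {0, 1}")
        case True
        have "c i = 0" using True False m by (intro gap[of i i]) (auto simp: window_def \<rho>_def)
        with ci show False by simp
      next
        case r: False
        have \<rho>: "\<rho> < m + 1" by (simp add: \<rho>_def)
        \<comment> \<open>The next last vertex of a block; since the residue of \<open>i\<close> is
          at least 2, its distance is at most \<open>m - 1\<close> and the path from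
          \<open>i\<close> reaches it.\<close>
        let ?j = "i + (m + 1 - \<rho>)"
        have "?j - N = (i - N) + (m + 1 - \<rho>)" using False by simp
        then have "(?j - N) mod (m + 1) = (\<rho> + (m + 1 - \<rho>)) mod (m + 1)"
          unfolding \<rho>_def by (simp only: mod_add_left_eq)
        also have "\<rho> + (m + 1 - \<rho>) = m + 1" using \<rho> by simp
        finally have "(?j - N) mod (m + 1) \<in> {0, 1}" by simp
        moreover have "i \<in> window m ?j" using r \<rho> by (auto simp: window_def)
        ultimately have "c i = 0" using False by (intro gap[of i ?j]) simp_all
        with ci show False by simp
      qed
    qed
  qed
  let ?A = "{j \<in> {1..N}. j mod m = j0}"
  have "t = (\<Sum>j\<in>?A. \<Sum>i\<in>window m j. c i)"
    using sum_residue_windows[OF m j0 c' N_le(1)] c(2) by simp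
  also have "\<dots> \<le> (\<Sum>j\<in>?A. \<Sum>i\<in>window m j. mult i)"
  proof (rule sum_mono)
    fix j assume j: "j \<in> ?A"
    then have "base_exp j = (\<Sum>i\<in>window m j. mult i)" by (simp add: base_exp_def inner_def)
    then show "(\<Sum>i\<in>window m j. c i) \<le> (\<Sum>i\<in>window m j. mult i)"
      using c(3)[of j] e_res[of j] j N_le by (simp add: lookup_add lookup_base)
  qed
  also have "\<dots> = t - 1"
    using sum_residue_windows[OF m j0 mult_range N_le(1)] sum_mult by simp
  finally show False using t by simp
qed

lemma card_verts: "card verts = N + ((n - N + 1) div (m + 1) + (n - N) div (m + 1))"
proof -
  have inj: "x = y" if "x * (m + 1) = y * (m + 1)" for x y :: nat
    using that by (simp only: mult_cancel2) simp
  have f: "card firsts = (n - N + 1) div (m + 1)"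
    unfolding firsts_def
  proof (subst card_image)
    show "inj_on (\<lambda>p. N + p * (m + 1) + 1) {..<(n - N + 1) div (m + 1)}"
      by (rule inj_onI, rule inj) linarith
  qed simp
  have l: "card lasts = (n - N) div (m + 1)"
    unfolding lasts_def
  proof (subst card_image)
    show "inj_on (\<lambda>p. N + (p + 1) * (m + 1)) {..<(n - N) div (m + 1)}"
    proof (rule inj_onI)
      fix x y assume "N + (x + 1) * (m + 1) = N + (y + 1) * (m + 1)"
      then have "(x + 1) * (m + 1) = (y + 1) * (m + 1)" by (rule add_left_imp_eq)
      then have "x + 1 = y + 1" by (rule inj)
      then show "x = y" by simp
    qed
  qed simp
  have "firsts \<inter> lasts = {}"
  proof (rule equals0I)
    fix y assume "y \<in> firsts \<inter> lasts"
    then obtain p p' where "y = N + p * (m + 1) + 1" "y = N + (p' + 1) * (m + 1)"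
      unfolding firsts_def lasts_def by blast
    then have "1 + p * (m + 1) = 0 + (p' + 1) * (m + 1)" by simp
    then have "(1 + p * (m + 1)) mod (m + 1) = (0 + (p' + 1) * (m + 1)) mod (m + 1)" by (rule arg_cong)
    then show False using m by (simp only: mod_mult_self1) simp
  qed
  moreover have "{1..N} \<inter> (firsts \<union> lasts) = {}" by (auto simp: firsts_def lasts_def)
  moreover have "finite firsts" "finite lasts" by (auto simp: firsts_def lasts_def)
  ultimately show ?thesis unfolding verts_def by (simp add: card_Un_disjoint f l)
qed

lemma projective_dimension_ge_bound:
  "enat (pd_bound m n t - 1) \<le> projective_dimension (mpoly_ring n)
    (quotient_module (mpoly_ring n) (monomial_ideal n (path_powers n m t) :: 'k::field mpoly set))"
proof -
  have "enat (card verts - m + 1) \<le> projective_dimension (mpoly_ring n)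
    (quotient_module (mpoly_ring n) (monomial_ideal n (path_powers n m t) :: 'k mpoly set))"
  proof (rule projective_dimension_monomial_ge[where \<kappa> = colour and ?\<tau>0.0 = rep])
    show "colour w < m" if "w \<in> verts" for w using m by (simp add: colour_def)
    show "upclosed (path_powers n m t)" by (rule upclosed_path_powers)
    show "base \<in> exponents n" by (rule base_exponents)
    show "verts \<subseteq> {1..n}" by (rule verts_subset)
    show "1 \<le> m" by (rule m)
    show "base + (\<Sum>k<m. single (\<tau> k) 1) \<in> path_powers n m t"
      if "\<And>k. k < m \<Longrightarrow> \<tau> k \<in> verts \<and> colour (\<tau> k) = k" for \<tau> by (rule transversal[OF that])
    show "rep k \<in> verts \<and> colour (rep k) = k" if "k < m" for k by (rule rep[OF that])
    show "base + (\<Sum>k\<in>{..<m} - {j}. single (rep k) 1) \<notin> path_powers n m t" if "j < m" for j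
      by (rule minimal[OF that])
  qed
  moreover have "card verts - m + 1 = pd_bound m n t - 1"
  \<comment> \<open>The value \<open>t = n + 1 - m\<close> belongs to the second case here: then
    \<open>N = n\<close>, no blocks are left, and the two formulas for \<open>pd_bound\<close>
    agree.\<close>
  proof (cases "t \<le> n - m")
    case True
    then have tN: "t0 = t" "N = t + m" using t0 N by auto
    have "n + 2 - t = (n - N + 1) + (m + 1)" using True tN n by simp
    then have "div_sum m (n + 2 - t) = div_sum m (n - N + 1) + 2" by (simp only: div_sum_shift)
    moreover have "div_sum m (n - N + 1) = (n - N + 1) div (m + 1) + ((n - N) div (m + 1) + 1)"
    proof -
      have "n - N + 1 + m = n - N + (m + 1)" by simp
      then have "(n - N + 1 + m) div (m + 1) = (n - N) div (m + 1) + 1" by (simp only: div_add_self2)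
      then show ?thesis by (simp only: div_sum_def)
    qed
    moreover have "pd_bound m n t = t - 1 + div_sum m (n + 2 - t)" using True n t by (intro pd_bound_le) auto
    ultimately show ?thesis unfolding card_verts using tN t by simp
  next
    case False
    then have "N = n" using t0 N n by auto
    moreover have "pd_bound m n t = n - m + 2" using False n t by (intro pd_bound_gt) auto
    ultimately show ?thesis unfolding card_verts using m n by simp
  qed
  ultimately show ?thesis by simp
qed

end

section \<open>Comparison with the formula over the reals\<close>

lemma ceiling_div_nat: "\<lceil>real k / real (m + 1)\<rceil> = int ((k + m) div (m + 1))"
proof -
  define z where "z = (k + m) div (m + 1)"
  have "z * (m + 1) \<le> k + m" unfolding z_def by (rule div_times_less_eq_dividend)
  moreover have "k + m < (z + 1) * (m + 1)"
    unfolding z_def using dividend_less_times_div[of "m + 1" "k + m"] by (simp add: algebra_simps)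
  ultimately have "z * (m + 1) < k + (m + 1)" "k \<le> z * (m + 1)" by (simp_all add: algebra_simps)
  then have "real (z * (m + 1)) < real (k + (m + 1))" "real k \<le> real (z * (m + 1))" by (simp_all only: of_nat_less_iff of_nat_le_iff)
  then have "real z - 1 < real k / real (m + 1)" "real k / real (m + 1) \<le> real z"
    by (simp_all add: field_simps)
  then show ?thesis unfolding z_def[symmetric] by (intro ceiling_unique) simp_all
qed

theorem corollary2p8:
  fixes n m t :: nat
  assumes "n \<ge> m" and "m \<ge> 1" and "t \<ge> 1"
  shows "\<exists>d::nat.
    projective_dimension (mpoly_ring n :: 'k::field mpoly ring)
      (quotient_module (mpoly_ring n) (path_ideal n m [^]\<^bsub>ideals_set (mpoly_ring n)\<^esub> t)) = enat d \<and>
    int d =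
      (if t \<le> n + 1 - m
       then int t - 2 + \<lfloor>(real n - real t + 2) / (real m + 1)\<rfloor>
              + \<lceil>(real n - real t + 2) / (real m + 1)\<rceil>
       else int n - int m + 1)"
proof (intro exI conjI)
  let ?S = "mpoly_ring n :: 'k mpoly ring"
  let ?J = "monomial_ideal n (path_powers n m t) :: 'k mpoly set"
  interpret cring ?S by (rule mpoly_ring_cring)
  define d where "d = pd_bound m n t - 1"
  \<comment> \<open>\<open>pd_bound\<close> is positive, so the subtraction in \<open>d\<close> is
    not truncated.\<close>
  have b: "pd_bound m n t = Suc d"
  proof -
    have "pd_bound m n t \<ge> pd_bound m n 1"
      using assms(3) by (induction t rule: dec_induct) (auto intro: order_trans pd_bound_pred_t assms)
    moreover have "pd_bound m n 1 = div_sum m (n + 1)" using assms pd_bound_le[of 1 m n] by simp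
    moreover have "div_sum m (n + 1) \<ge> 2" using div_sum_mono[of "m + 1" "n + 1" m] div_sum_base[of m] assms by simp
    ultimately show ?thesis unfolding d_def by simp
  qed
  have "free_res ?S (Suc d) (quotient_module ?S ?J)"
    using mon_res_path_powers[OF assms(2) order_refl, of n t, where 'k = 'k] unfolding b mon_res_def .
  then have le: "projective_dimension ?S (quotient_module ?S ?J) \<le> enat d"
    by (rule projective_dimension_le[OF quotient_module_is_module[OF monomial_ideal_ideal[OF upclosed_path_powers]]])
  interpret L: lower_bound n m t "min t (n - m)" "min t (n - m) + m"
    by unfold_locales (use assms in auto)
  have ge: "enat d \<le> projective_dimension ?S (quotient_module ?S ?J)"
    unfolding d_def by (rule L.projective_dimension_ge_bound)
  show "projective_dimension ?S (quotient_module ?S (path_ideal n m [^]\<^bsub>ideals_set ?S\<^esub> t)) = enat d"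
    unfolding path_ideal_power[OF assms(2)] using le ge by (rule antisym)
  show "int d = (if t \<le> n + 1 - m
       then int t - 2 + \<lfloor>(real n - real t + 2) / (real m + 1)\<rfloor> + \<lceil>(real n - real t + 2) / (real m + 1)\<rceil>
       else int n - int m + 1)"
  proof (cases "t \<le> n + 1 - m")
    case True
    have k: "(real n - real t + 2) / (real m + 1) = real (n + 2 - t) / real (m + 1)"
    proof -
      have "real (n + 2 - t) = real n - real t + 2" using True assms by (simp add: of_nat_diff)
      moreover have "real (m + 1) = real m + 1" by simp
      ultimately show ?thesis by (simp only:)
    qed
    have "Suc d = t - 1 + div_sum m (n + 2 - t)" unfolding b[symmetric] using True assms by (intro pd_bound_le) auto
    then have "int d = int t - 2 + int ((n + 2 - t) div (m + 1)) + int ((n + 2 - t + m) div (m + 1))"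
      using assms(3) by (simp add: div_sum_def)
    then show ?thesis unfolding k ceiling_div_nat floor_divide_of_nat_eq using True by simp
  next
    case False
    then have "Suc d = n - m + 2" unfolding b[symmetric] using assms by (intro pd_bound_gt) auto
    then show ?thesis using False assms by simp
  qed
qed

end
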